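(* Let $s_j, b_j \in \mathbb{R}$, $j=1,2,3$, satisfy $$b_1+b_2+b_3 > \tfrac12, \qquad b_j+b_k>0 \quad (j\neq k),$$ and, for $k\in\{1,2\}$, $$\begin{aligned} s_1+s_2 &\geq 0,\\ s_k+s_3 &> -b_{min},\\ s_k+s_3 &> \tfrac12-b_1-b_2-b_3,\\ s_1+s_2+s_3 &> \tfrac12-b_3,\\ s_1+s_2+s_3 &> \big(\tfrac12-b_{max}\big)_+ + \big(\tfrac12-b_{med}\big)_+ - b_{min}.\end{aligned}$$ Then, for either choice of sign $\pm$ (with $\mp$ the opposite sign), there is a constant $C$ depending only on the $s_j,b_j$ such that for all Schwartz functions $\psi_1,\psi_2,\psi_3$ on $\mathbb{R}^2$, $$\Big|\int_{\mathbb{R}^2} \psi_1(t,x)\psi_2(t,x)\psi_3(t,x)\,dx\,dt\Big| \leq C\, \|\psi_1\|_{X^{s_1,b_1}_\pm}\|\psi_2\|_{X^{s_2,b_2}_\pm}\|\psi_3\|_{X^{s_3,b_3}_\mp}.$$ Moreover, the conditions are sharp up to equality: if $s_j,b_j\in\mathbb{R}$ are such that this trilinear estimate holds, then $b_j+b_k\geq 0$ for $j\ne k$, $b_1+b_2+b_3\geq\frac12$, and for $k\in\{1,2\}$: $s_1+s_2\geq 0$, $s_k+s_3\geq -b_{min}$, $s_k+s_3\geq \frac12-b_1-b_2-b_3$, $s_1+s_2+s_3\geq\frac12-b_3$, and $s_1+s_2+s_3\geq (\frac12-b_{max})_+ + (\frac12-b_{med})_+ - b_{min}$.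
   Context: Write $\langle y\rangle=\sqrt{1+|y|^2}$ and let $\widetilde\psi(\tau,\xi)$ be the space-time Fourier transform of $\psi(t,x)$, $(t,x)\in\mathbb{R}^{1+1}$. The spaces $X^{s,b}_\pm$ on $\mathbb{R}^2$ are defined by the norm $$\|\psi\|_{X^{s,b}_\pm}=\big\|\langle\tau\pm\xi\rangle^b\langle\xi\rangle^s\widetilde\psi(\tau,\xi)\big\|_{L^2_{\tau,\xi}(\mathbb{R}^2)}.$$ For real numbers $b_1,b_2,b_3$, $b_{max},b_{med},b_{min}$ denote their maximum, median and minimum. For $a\in\mathbb{R}$, $a_+=a$ if $a>0$ and $a_+=0$ if $a\leq0$. *)

theory Defs
  imports "HOL-Analysis.Analysis"
begin

fun iterated_deriv ::
    "'a list \<Rightarrow> ('a::euclidean_space \<Rightarrow> complex) \<Rightarrow> 'a \<Rightarrow> complex" where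
  "iterated_deriv [] f = f"
| "iterated_deriv (v # vs) f = (\<lambda>p. frechet_derivative (iterated_deriv vs f) (at p) v)"

(* Lists over Basis enumerate all iterated partial derivatives, so the first conjunct is
   C-infinity smoothness and the second is rapid decay of every partial derivative. *)
definition schwartz :: "('a::euclidean_space \<Rightarrow> complex) \<Rightarrow> bool" where
  "schwartz f \<longleftrightarrow>
     (\<forall>vs. set vs \<subseteq> Basis \<longrightarrow>
        (\<forall>p. iterated_deriv vs f differentiable (at p)) \<and>
        (\<forall>N::nat. bounded (range (\<lambda>p. (1 + norm p) ^ N *\<^sub>R iterated_deriv vs f p))))"

(* Unnormalised convention; another normalisation only changes the constant in the estimate. *)
definition fourier :: "('a::euclidean_space \<Rightarrow> complex) \<Rightarrow> 'a \<Rightarrow> complex" where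
  "fourier f q = (LINT p|lborel. cis (- (p \<bullet> q)) * f p)"

definition jbracket :: "real \<Rightarrow> real" where
  "jbracket y = sqrt (1 + y\<^sup>2)"

(* Points of the plane are (t, x) in physical space and (tau, xi) in frequency space.
   The sign sigma is 1 or -1.  For Schwartz psi the integrand is integrable, so the
   Bochner integral is the genuine squared L2 norm. *)
definition X_norm ::
    "real \<Rightarrow> real \<Rightarrow> real \<Rightarrow> (real \<times> real \<Rightarrow> complex) \<Rightarrow> real" where
  "X_norm \<sigma> s b \<psi> =
     sqrt (LINT (\<tau>, \<xi>)|lborel.
       (jbracket (\<tau> + \<sigma> * \<xi>) powr b * jbracket \<xi> powr s * norm (fourier \<psi> (\<tau>, \<xi>)))\<^sup>2)"

definition trilinear_estimate ::
    "real \<Rightarrow> real \<Rightarrow> real \<Rightarrow> real \<Rightarrow> real \<Rightarrow> real \<Rightarrow> real \<Rightarrow> real \<Rightarrow> bool" where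
  "trilinear_estimate \<sigma> s1 s2 s3 b1 b2 b3 C \<longleftrightarrow>
     (\<forall>\<psi>1 \<psi>2 \<psi>3 :: real \<times> real \<Rightarrow> complex.
        schwartz \<psi>1 \<longrightarrow> schwartz \<psi>2 \<longrightarrow> schwartz \<psi>3 \<longrightarrow>
        norm (LINT p|lborel. \<psi>1 p * \<psi>2 p * \<psi>3 p)
          \<le> C * X_norm \<sigma> s1 b1 \<psi>1 * X_norm \<sigma> s2 b2 \<psi>2 * X_norm (- \<sigma>) s3 b3 \<psi>3)"

definition max3 :: "real \<Rightarrow> real \<Rightarrow> real \<Rightarrow> real" where
  "max3 x y z = Max {x, y, z}"

definition med3 :: "real \<Rightarrow> real \<Rightarrow> real \<Rightarrow> real" where
  "med3 x y z = sort [x, y, z] ! 1"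

definition min3 :: "real \<Rightarrow> real \<Rightarrow> real \<Rightarrow> real" where
  "min3 x y z = Min {x, y, z}"

definition pos_part :: "real \<Rightarrow> real" where
  "pos_part a = (if a > 0 then a else 0)"

end

theory Submission
  imports Defs "HOL-Probability.Probability"
begin

text \<open>
  Sufficiency. Fourier inversion bounds the trilinear integral by a convolution form in frequency
  space, weighted by negative powers of the three modulations and the three frequencies. The
  frequencies sum to zero, and the modulations sum to a multiple of the third frequency. Hence the
  two largest of the three frequencies are comparable, and so are the two largest among the three
  modulations and the third frequency. In logarithmic coordinates the weight is a linear function on
  a polyhedral complex with these constraints, and a comparison along its extreme rays bounds it by
  one of eleven products of two decaying factors. For each product one point can be held
  fixed such that its square is integrable over the remaining variables. One application of the
  Cauchy--Schwarz inequality then gives the estimate.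

  Necessity. Gaussian wave packets have explicit Fourier transforms that are Gaussians in frequency
  space, and when their phases cancel the trilinear integral is the integral of a positive Gaussian.
  Each condition comes from one choice of centres of size M and widths 1 or M to the power 1 - \<epsilon>,
  letting M tend to infinity and then \<epsilon> to 0.
\<close>

section \<open>Japanese brackets and integrals over the plane\<close>

text \<open>The opposite sign in the third norm makes the time frequencies cancel in the sum of the
  modulations but not the spatial ones, so a high third frequency forces a high modulation. No sum
  over dyadic scales appears: at each pair of points one of the eleven products dominates the
  weight, and the majorant is their sum. Of the twelve pairs that contain a modulation, only that of
  the first two modulations is missing. These belong to parallel characteristics: their sum depends
  on the third point alone, so no choice of fixed point makes both factors decay independently.
  Avoiding this pair when the third modulation is the large one is what the condition with 1/2 - b_3
  pays for. The strict inequalities that involve 1/2 leave room for some \<rho> > 1/2, which makes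
  each factor square integrable in one variable. The sum s_1 + s_2 may vanish because it only
  multiplies the excess of two high frequencies over a low one, where no decay is asked for. For
  necessity, widths below M^(1 - \<epsilon>) keep the weights at the size of their central values,
  up to powers of the distance that the Gaussian absorbs.\<close>

lemma jbracket_ge_1: "1 \<le> jbracket y"
  by (simp add: jbracket_def)

lemma jbracket_pos [simp]: "0 < jbracket y"
  using jbracket_ge_1[of y] by linarith

lemma jbracket_nonneg [simp]: "0 \<le> jbracket y"
  by (simp add: less_imp_le)

lemma jbracket_0 [simp]: "jbracket 0 = 1"
  by (simp add: jbracket_def)

lemma jbracket_abs_le: "\<bar>y\<bar> \<le> jbracket y"
  unfolding jbracket_def by (rule real_le_rsqrt) simp

lemma jbracket_le: "jbracket y \<le> 1 + \<bar>y\<bar>"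
  unfolding jbracket_def by (rule real_le_lsqrt) (auto simp: power2_eq_square algebra_simps)

text \<open>The bracket is the Euclidean norm of (1, x), hence 1-Lipschitz.\<close>

lemma jbracket_add: "jbracket (x + y) \<le> jbracket x + \<bar>y\<bar>"
proof -
  have "jbracket (x + y) = norm ((1, x) + (0, y) :: real \<times> real)"
    by (simp add: jbracket_def norm_prod_def)
  also have "\<dots> \<le> norm (1 :: real, x) + norm (0 :: real, y)" by (rule norm_triangle_ineq)
  finally show ?thesis by (simp add: jbracket_def norm_prod_def)
qed

lemma jbracket_measurable [measurable]: "jbracket \<in> borel_measurable borel"
  unfolding jbracket_def[abs_def] by measurable

text \<open>On the half line (1 + y) powr -r has an explicit antiderivative, and its mirror image
  covers the negative axis. The bracket and 1 + |y| differ by at most a factor 2.\<close>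

lemma nn_integral_jbracket_finite:
  assumes "1 < r"
  shows "(\<integral>\<^sup>+y. ennreal (jbracket y powr - r) \<partial>lborel) < \<infinity>"
proof -
  let ?f = "\<lambda>y. ennreal ((1 + y) powr - r) * indicator {0..} y"
  have "(\<integral>\<^sup>+y. ?f y \<partial>lborel) = ennreal (0 - (1 + 0) powr (1 - r) / (1 - r))"
  proof (rule nn_integral_FTC_atLeast)
    show "((\<lambda>y. (1 + y) powr (1 - r) / (1 - r)) \<longlongrightarrow> 0) at_top"
    proof -
      have "((\<lambda>y::real. (1 + y) powr - (r - 1)) \<longlongrightarrow> 0) at_top"
        using assms
        by (intro tendsto_neg_powr filterlim_tendsto_add_at_top[OF tendsto_const] filterlim_ident) auto
      then have "((\<lambda>y::real. (1 + y) powr (1 - r) / (1 - r)) \<longlongrightarrow> 0 / (1 - r)) at_top"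
        using assms by (intro tendsto_divide tendsto_const) (simp_all add: algebra_simps)
      then show ?thesis by simp
    qed
    show "DERIV (\<lambda>y. (1 + y) powr (1 - r) / (1 - r)) x :> (1 + x) powr - r" if "0 \<le> x" for x
      using that assms by (auto intro!: derivative_eq_intros)
  qed auto
  then have f: "(\<integral>\<^sup>+y. ?f y \<partial>lborel) < \<infinity>" by simp
  have f': "(\<integral>\<^sup>+y. ?f (- y) \<partial>lborel) = (\<integral>\<^sup>+y. ?f y \<partial>lborel)"
    using nn_integral_real_affine[of ?f "-1" 0] by simp
  have "(\<integral>\<^sup>+y. ennreal (jbracket y powr - r) \<partial>lborel) \<le> (\<integral>\<^sup>+y. ennreal (2 powr r) * (?f y + ?f (- y)) \<partial>lborel)"
  proof (rule nn_integral_mono)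
    fix y :: real
    have "1 + \<bar>y\<bar> \<le> 2 * jbracket y" using jbracket_ge_1[of y] jbracket_abs_le[of y] by linarith
    then have "(1 + \<bar>y\<bar>) powr r \<le> (2 * jbracket y) powr r"
      using assms by (intro powr_mono2) auto
    moreover have "0 < (1 + \<bar>y\<bar>) powr r" "0 < jbracket y powr r"
      using jbracket_pos[of y] by (simp_all del: jbracket_pos)
    ultimately have "jbracket y powr - r \<le> 2 powr r * (1 + \<bar>y\<bar>) powr - r"
      by (simp add: powr_mult powr_minus field_simps del: powr_gt_zero)
    then have "ennreal (jbracket y powr - r) \<le> ennreal (2 powr r) * ennreal ((1 + \<bar>y\<bar>) powr - r)"
      by (simp flip: ennreal_mult add: ennreal_leI)
    also have "\<dots> \<le> ennreal (2 powr r) * (?f y + ?f (- y))"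
      by (intro mult_left_mono) (auto simp: indicator_def)
    finally show "ennreal (jbracket y powr - r) \<le> ennreal (2 powr r) * (?f y + ?f (- y))" .
  qed
  also have "\<dots> = ennreal (2 powr r) * ((\<integral>\<^sup>+y. ?f y \<partial>lborel) + (\<integral>\<^sup>+y. ?f (- y) \<partial>lborel))"
    by (simp add: nn_integral_cmult nn_integral_add)
  also have "\<dots> < \<infinity>" using f f' by (simp add: ennreal_mult_less_top)
  finally show ?thesis .
qed

section \<open>Lebesgue measure under translation and reflection, and on products\<close>

lemma nn_integral_lborel_affine:
  fixes f :: "'a::euclidean_space \<Rightarrow> ennreal"
  assumes [measurable]: "f \<in> borel_measurable borel" and c: "\<bar>c\<bar> = 1"
  shows "(\<integral>\<^sup>+x. f (t + c *\<^sub>R x) \<partial>lborel) = (\<integral>\<^sup>+x. f x \<partial>lborel)"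
proof -
  have "c \<noteq> 0" using c by auto
  then show ?thesis
    by (subst (2) lborel_affine[where t = t and c = c]) (simp_all add: nn_integral_density nn_integral_distr c)
qed

lemma integral_lborel_affine:
  fixes f :: "'a::euclidean_space \<Rightarrow> 'b::{banach, second_countable_topology}"
  assumes [measurable]: "f \<in> borel_measurable borel" and c: "\<bar>c\<bar> = 1"
  shows "(LINT x|lborel. f (t + c *\<^sub>R x)) = (LINT x|lborel. f x)"
proof -
  have "c \<noteq> 0" using c by auto
  then show ?thesis
    by (subst (2) lborel_affine[where t = t and c = c]) (simp_all add: integral_density integral_distr c density_1)
qed

lemma nn_integral_lborel_pair:
  fixes f :: "'a::euclidean_space \<times> 'b::euclidean_space \<Rightarrow> ennreal"
  assumes "f \<in> borel_measurable borel"
  shows "(\<integral>\<^sup>+p. f p \<partial>lborel) = (\<integral>\<^sup>+x. \<integral>\<^sup>+y. f (x, y) \<partial>lborel \<partial>lborel)"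
    and "(\<integral>\<^sup>+p. f p \<partial>lborel) = (\<integral>\<^sup>+y. \<integral>\<^sup>+x. f (x, y) \<partial>lborel \<partial>lborel)"
  using assms lborel.nn_integral_fst[of f lborel] lborel_pair.nn_integral_snd[of f]
  by (simp_all add: lborel_prod)

lemma fst_snd_borel_measurable [measurable]:
  "(fst :: 'a::second_countable_topology \<times> 'b::second_countable_topology \<Rightarrow> 'a) \<in> borel_measurable borel"
  "(snd :: 'a::second_countable_topology \<times> 'b::second_countable_topology \<Rightarrow> 'b) \<in> borel_measurable borel"
  by (simp_all add: borel_prod[symmetric])

section \<open>Admissible kernels\<close>

text \<open>Boundedness on L2 of the trilinear convolution form with kernel \<open>k\<close>,
  squared to avoid roots of extended values. Since only nonnegative functions occur, the class is
  closed under sums and pointwise majorants.\<close>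

definition admissible_kernel :: "(real \<times> real \<Rightarrow> real \<times> real \<Rightarrow> ennreal) \<Rightarrow> bool" where
  "admissible_kernel k \<longleftrightarrow> case_prod k \<in> borel_measurable (borel \<Otimes>\<^sub>M borel) \<and>
    (\<exists>B<\<infinity>. \<forall>F\<in>borel_measurable borel. \<forall>G\<in>borel_measurable borel. \<forall>H\<in>borel_measurable borel.
      (\<integral>\<^sup>+p. \<integral>\<^sup>+q. k p q * (F p * G q * H (- p - q)) \<partial>lborel \<partial>lborel)\<^sup>2
        \<le> B * ((\<integral>\<^sup>+p. (F p)\<^sup>2 \<partial>lborel) * (\<integral>\<^sup>+p. (G p)\<^sup>2 \<partial>lborel) * (\<integral>\<^sup>+p. (H p)\<^sup>2 \<partial>lborel)))"

lemma Cauchy_Schwarz_iterated: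
  fixes X Y :: "real \<times> real \<Rightarrow> real \<times> real \<Rightarrow> ennreal"
  assumes [measurable]: "case_prod X \<in> borel_measurable (borel \<Otimes>\<^sub>M borel)"
    "case_prod Y \<in> borel_measurable (borel \<Otimes>\<^sub>M borel)"
  shows "(\<integral>\<^sup>+p. \<integral>\<^sup>+q. X p q * Y p q \<partial>lborel \<partial>lborel)\<^sup>2
    \<le> (\<integral>\<^sup>+p. \<integral>\<^sup>+q. (X p q)\<^sup>2 \<partial>lborel \<partial>lborel) * (\<integral>\<^sup>+p. \<integral>\<^sup>+q. (Y p q)\<^sup>2 \<partial>lborel \<partial>lborel)"
proof -
  have e: "(\<integral>\<^sup>+p. \<integral>\<^sup>+q. Z p q \<partial>lborel \<partial>lborel) = integral\<^sup>N (lborel \<Otimes>\<^sub>M lborel) (case_prod Z)"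
    if [measurable]: "case_prod Z \<in> borel_measurable (borel \<Otimes>\<^sub>M borel)" for Z :: "real \<times> real \<Rightarrow> real \<times> real \<Rightarrow> ennreal"
    using lborel.nn_integral_fst[of "case_prod Z" lborel] by simp
  show ?thesis
    using Cauchy_Schwarz_nn_integral[of "case_prod X" "lborel \<Otimes>\<^sub>M lborel" "case_prod Y"]
    by (simp add: e case_prod_beta')
qed

lemma reflected_integral:
  fixes H :: "real \<times> real \<Rightarrow> ennreal"
  assumes [measurable]: "H \<in> borel_measurable borel"
  shows "(\<integral>\<^sup>+p. H (- p - q) \<partial>lborel) = (\<integral>\<^sup>+p. H p \<partial>lborel)"
    and "(\<integral>\<^sup>+p. H (- q - p) \<partial>lborel) = (\<integral>\<^sup>+p. H p \<partial>lborel)"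
proof -
  show "(\<integral>\<^sup>+p. H (- q - p) \<partial>lborel) = (\<integral>\<^sup>+p. H p \<partial>lborel)"
    using nn_integral_lborel_affine[of H "-1" "- q"] by simp
  then show "(\<integral>\<^sup>+p. H (- p - q) \<partial>lborel) = (\<integral>\<^sup>+p. H p \<partial>lborel)"
    by (simp only: minus_diff_commute)
qed

lemma iterated_swap:
  fixes X :: "real \<times> real \<Rightarrow> real \<times> real \<Rightarrow> ennreal"
  assumes [measurable]: "case_prod X \<in> borel_measurable (borel \<Otimes>\<^sub>M borel)"
  shows "(\<integral>\<^sup>+p. \<integral>\<^sup>+q. X p q \<partial>lborel \<partial>lborel) = (\<integral>\<^sup>+q. \<integral>\<^sup>+p. X p q \<partial>lborel \<partial>lborel)"
  using lborel_pair.Fubini'[of X] by simp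

text \<open>With \<open>p\<close> fixed, \<open>k\<close> is grouped with \<open>F\<close>, which
  leaves \<open>G q * H (- p - q)\<close>. Translation invariance turns the square integral of the
  latter into a product, so only the integral of the squared kernel over \<open>q\<close> needs a
  uniform bound.\<close>

lemma admissible_kernelI1:
  assumes k[measurable]: "case_prod k \<in> borel_measurable (borel \<Otimes>\<^sub>M borel)"
    and B: "B < \<infinity>" "\<And>p. (\<integral>\<^sup>+q. (k p q)\<^sup>2 \<partial>lborel) \<le> B"
  shows "admissible_kernel k"
  unfolding admissible_kernel_def
proof (intro conjI exI[of _ B] ballI k B)
  fix F G H :: "real \<times> real \<Rightarrow> ennreal"
  assume [measurable]: "F \<in> borel_measurable borel" "G \<in> borel_measurable borel" "H \<in> borel_measurable borel"
  have "(\<integral>\<^sup>+p. \<integral>\<^sup>+q. k p q * (F p * G q * H (- p - q)) \<partial>lborel \<partial>lborel)\<^sup>2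
      = (\<integral>\<^sup>+p. \<integral>\<^sup>+q. (F p * k p q) * (G q * H (- p - q)) \<partial>lborel \<partial>lborel)\<^sup>2"
    by (simp add: mult_ac)
  also have "\<dots> \<le> (\<integral>\<^sup>+p. \<integral>\<^sup>+q. (F p * k p q)\<^sup>2 \<partial>lborel \<partial>lborel) * (\<integral>\<^sup>+p. \<integral>\<^sup>+q. (G q * H (- p - q))\<^sup>2 \<partial>lborel \<partial>lborel)"
    by (rule Cauchy_Schwarz_iterated) measurable
  also have "(\<integral>\<^sup>+p. \<integral>\<^sup>+q. (F p * k p q)\<^sup>2 \<partial>lborel \<partial>lborel) = (\<integral>\<^sup>+p. (F p)\<^sup>2 * (\<integral>\<^sup>+q. (k p q)\<^sup>2 \<partial>lborel) \<partial>lborel)"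
    by (simp add: power_mult_distrib nn_integral_cmult)
  also have "\<dots> \<le> (\<integral>\<^sup>+p. (F p)\<^sup>2 * B \<partial>lborel)"
    by (intro nn_integral_mono mult_left_mono B) auto
  also have "\<dots> = (\<integral>\<^sup>+p. (F p)\<^sup>2 \<partial>lborel) * B"
    by (simp add: nn_integral_multc)
  also have "(\<integral>\<^sup>+p. \<integral>\<^sup>+q. (G q * H (- p - q))\<^sup>2 \<partial>lborel \<partial>lborel) = (\<integral>\<^sup>+q. \<integral>\<^sup>+p. (G q)\<^sup>2 * (H (- p - q))\<^sup>2 \<partial>lborel \<partial>lborel)"
    unfolding power_mult_distrib by (rule iterated_swap) measurable
  also have "\<dots> = (\<integral>\<^sup>+q. (G q)\<^sup>2 * (\<integral>\<^sup>+p. (H p)\<^sup>2 \<partial>lborel) \<partial>lborel)"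
    by (subst nn_integral_cmult) (simp_all add: reflected_integral[of "\<lambda>p. (H p)\<^sup>2"])
  also have "\<dots> = (\<integral>\<^sup>+q. (G q)\<^sup>2 \<partial>lborel) * (\<integral>\<^sup>+p. (H p)\<^sup>2 \<partial>lborel)"
    by (simp add: nn_integral_multc)
  finally show "(\<integral>\<^sup>+p. \<integral>\<^sup>+q. k p q * (F p * G q * H (- p - q)) \<partial>lborel \<partial>lborel)\<^sup>2
        \<le> B * ((\<integral>\<^sup>+p. (F p)\<^sup>2 \<partial>lborel) * (\<integral>\<^sup>+p. (G p)\<^sup>2 \<partial>lborel) * (\<integral>\<^sup>+p. (H p)\<^sup>2 \<partial>lborel))"
    by (simp add: mult_ac mult_right_mono)
qed

text \<open>Exchanging \<open>p\<close> and \<open>q\<close> exchanges \<open>F\<close> and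
  \<open>G\<close> and preserves \<open>- p - q\<close>, which reduces the claim to the first
  criterion.\<close>

lemma admissible_kernelI2:
  assumes k[measurable]: "case_prod k \<in> borel_measurable (borel \<Otimes>\<^sub>M borel)"
    and B: "B < \<infinity>" "\<And>q. (\<integral>\<^sup>+p. (k p q)\<^sup>2 \<partial>lborel) \<le> B"
  shows "admissible_kernel k"
proof -
  define k' where "k' p q = k q p" for p q
  have k'[measurable]: "case_prod k' \<in> borel_measurable (borel \<Otimes>\<^sub>M borel)"
    unfolding k'_def by measurable
  obtain B' where B': "B' < \<infinity>"
    "\<And>F G H. F \<in> borel_measurable borel \<Longrightarrow> G \<in> borel_measurable borel \<Longrightarrow> H \<in> borel_measurable borel \<Longrightarrow>
      (\<integral>\<^sup>+p. \<integral>\<^sup>+q. k' p q * (F p * G q * H (- p - q)) \<partial>lborel \<partial>lborel)\<^sup>2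
        \<le> B' * ((\<integral>\<^sup>+p. (F p)\<^sup>2 \<partial>lborel) * (\<integral>\<^sup>+p. (G p)\<^sup>2 \<partial>lborel) * (\<integral>\<^sup>+p. (H p)\<^sup>2 \<partial>lborel))"
    using admissible_kernelI1[OF k' B(1)] B(2) unfolding admissible_kernel_def k'_def by blast
  show ?thesis
    unfolding admissible_kernel_def
  proof (intro conjI exI[of _ B'] ballI k B')
    fix F G H :: "real \<times> real \<Rightarrow> ennreal"
    assume m[measurable]: "F \<in> borel_measurable borel" "G \<in> borel_measurable borel" "H \<in> borel_measurable borel"
    have "(\<integral>\<^sup>+p. \<integral>\<^sup>+q. k p q * (F p * G q * H (- p - q)) \<partial>lborel \<partial>lborel)
      = (\<integral>\<^sup>+q. \<integral>\<^sup>+p. k p q * (F p * G q * H (- p - q)) \<partial>lborel \<partial>lborel)"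
      by (rule iterated_swap) measurable
    also have "\<dots> = (\<integral>\<^sup>+q. \<integral>\<^sup>+p. k' q p * (G q * F p * H (- q - p)) \<partial>lborel \<partial>lborel)"
      unfolding k'_def by (simp only: minus_diff_commute mult.left_commute mult.commute)
    finally show "(\<integral>\<^sup>+p. \<integral>\<^sup>+q. k p q * (F p * G q * H (- p - q)) \<partial>lborel \<partial>lborel)\<^sup>2
        \<le> B' * ((\<integral>\<^sup>+p. (F p)\<^sup>2 \<partial>lborel) * (\<integral>\<^sup>+p. (G p)\<^sup>2 \<partial>lborel) * (\<integral>\<^sup>+p. (H p)\<^sup>2 \<partial>lborel))"
      using B'(2)[OF m(2,1,3)] by (simp add: mult_ac)
  qed
qed

text \<open>Here the third point r = - p - q is held fixed. The substitution q = - r - p makes r the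
  first variable and rotates the functions to \<open>H\<close>, \<open>F\<close>,
  \<open>G\<close>.\<close>

lemma admissible_kernelI3:
  assumes k[measurable]: "case_prod k \<in> borel_measurable (borel \<Otimes>\<^sub>M borel)"
    and B: "B < \<infinity>" "\<And>r. (\<integral>\<^sup>+p. (k p (- r - p))\<^sup>2 \<partial>lborel) \<le> B"
  shows "admissible_kernel k"
proof -
  define k' where "k' r p = k p (- r - p)" for r p
  have k'[measurable]: "case_prod k' \<in> borel_measurable (borel \<Otimes>\<^sub>M borel)"
    unfolding k'_def by measurable
  obtain B' where B': "B' < \<infinity>"
    "\<And>F G H. F \<in> borel_measurable borel \<Longrightarrow> G \<in> borel_measurable borel \<Longrightarrow> H \<in> borel_measurable borel \<Longrightarrow>
      (\<integral>\<^sup>+p. \<integral>\<^sup>+q. k' p q * (F p * G q * H (- p - q)) \<partial>lborel \<partial>lborel)\<^sup>2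
        \<le> B' * ((\<integral>\<^sup>+p. (F p)\<^sup>2 \<partial>lborel) * (\<integral>\<^sup>+p. (G p)\<^sup>2 \<partial>lborel) * (\<integral>\<^sup>+p. (H p)\<^sup>2 \<partial>lborel))"
    using admissible_kernelI1[OF k' B(1)] B(2) unfolding admissible_kernel_def k'_def by blast
  show ?thesis
    unfolding admissible_kernel_def
  proof (intro conjI exI[of _ B'] ballI k B')
    fix F G H :: "real \<times> real \<Rightarrow> ennreal"
    assume m[measurable]: "F \<in> borel_measurable borel" "G \<in> borel_measurable borel" "H \<in> borel_measurable borel"
    have "(\<integral>\<^sup>+q. k p q * (F p * G q * H (- p - q)) \<partial>lborel) = (\<integral>\<^sup>+r. k' r p * (H r * F p * G (- r - p)) \<partial>lborel)" for p
      unfolding k'_def using reflected_integral(1)[of "\<lambda>q. k p q * (F p * G q * H (- p - q))" p]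
      by (simp add: mult_ac)
    then have "(\<integral>\<^sup>+p. \<integral>\<^sup>+q. k p q * (F p * G q * H (- p - q)) \<partial>lborel \<partial>lborel)
      = (\<integral>\<^sup>+p. \<integral>\<^sup>+r. k' r p * (H r * F p * G (- r - p)) \<partial>lborel \<partial>lborel)" by simp
    also have "\<dots> = (\<integral>\<^sup>+r. \<integral>\<^sup>+p. k' r p * (H r * F p * G (- r - p)) \<partial>lborel \<partial>lborel)"
      by (rule iterated_swap) measurable
    finally show "(\<integral>\<^sup>+p. \<integral>\<^sup>+q. k p q * (F p * G q * H (- p - q)) \<partial>lborel \<partial>lborel)\<^sup>2
        \<le> B' * ((\<integral>\<^sup>+p. (F p)\<^sup>2 \<partial>lborel) * (\<integral>\<^sup>+p. (G p)\<^sup>2 \<partial>lborel) * (\<integral>\<^sup>+p. (H p)\<^sup>2 \<partial>lborel))"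
      using B'(2)[OF m(3,1,2)] by (simp add: mult_ac)
  qed
qed


lemma admissible_kernel_cmult_mono:
  assumes k: "admissible_kernel k" and [measurable]: "case_prod l \<in> borel_measurable (borel \<Otimes>\<^sub>M borel)"
    and c: "c < \<infinity>" "\<And>p q. l p q \<le> c * k p q"
  shows "admissible_kernel l"
proof -
  have km[measurable]: "case_prod k \<in> borel_measurable (borel \<Otimes>\<^sub>M borel)" using k by (simp add: admissible_kernel_def)
  obtain B where B: "B < \<infinity>"
    "\<And>F G H. F \<in> borel_measurable borel \<Longrightarrow> G \<in> borel_measurable borel \<Longrightarrow> H \<in> borel_measurable borel \<Longrightarrow>
      (\<integral>\<^sup>+p. \<integral>\<^sup>+q. k p q * (F p * G q * H (- p - q)) \<partial>lborel \<partial>lborel)\<^sup>2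
        \<le> B * ((\<integral>\<^sup>+p. (F p)\<^sup>2 \<partial>lborel) * (\<integral>\<^sup>+p. (G p)\<^sup>2 \<partial>lborel) * (\<integral>\<^sup>+p. (H p)\<^sup>2 \<partial>lborel))"
    using k unfolding admissible_kernel_def by blast
  show ?thesis
    unfolding admissible_kernel_def
  proof (intro conjI exI[of _ "c\<^sup>2 * B"] ballI)
    show "c\<^sup>2 * B < \<infinity>" using c B by (simp add: ennreal_mult_less_top power_less_top_ennreal)
    fix F G H :: "real \<times> real \<Rightarrow> ennreal"
    assume m[measurable]: "F \<in> borel_measurable borel" "G \<in> borel_measurable borel" "H \<in> borel_measurable borel"
    have "(\<integral>\<^sup>+p. \<integral>\<^sup>+q. l p q * (F p * G q * H (- p - q)) \<partial>lborel \<partial>lborel)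
      \<le> (\<integral>\<^sup>+p. \<integral>\<^sup>+q. c * (k p q * (F p * G q * H (- p - q))) \<partial>lborel \<partial>lborel)"
      unfolding mult.assoc[of c, symmetric]
      by (intro nn_integral_mono mult_right_mono c) auto
    also have "\<dots> = c * (\<integral>\<^sup>+p. \<integral>\<^sup>+q. k p q * (F p * G q * H (- p - q)) \<partial>lborel \<partial>lborel)"
      by (simp add: nn_integral_cmult)
    finally have "(\<integral>\<^sup>+p. \<integral>\<^sup>+q. l p q * (F p * G q * H (- p - q)) \<partial>lborel \<partial>lborel)\<^sup>2
      \<le> (c * (\<integral>\<^sup>+p. \<integral>\<^sup>+q. k p q * (F p * G q * H (- p - q)) \<partial>lborel \<partial>lborel))\<^sup>2"
      by (intro power_mono) auto
    also have "\<dots> \<le> c\<^sup>2 * (B * ((\<integral>\<^sup>+p. (F p)\<^sup>2 \<partial>lborel) * (\<integral>\<^sup>+p. (G p)\<^sup>2 \<partial>lborel) * (\<integral>\<^sup>+p. (H p)\<^sup>2 \<partial>lborel)))"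
      unfolding power_mult_distrib by (intro mult_left_mono B m) auto
    finally show "(\<integral>\<^sup>+p. \<integral>\<^sup>+q. l p q * (F p * G q * H (- p - q)) \<partial>lborel \<partial>lborel)\<^sup>2
        \<le> c\<^sup>2 * B * ((\<integral>\<^sup>+p. (F p)\<^sup>2 \<partial>lborel) * (\<integral>\<^sup>+p. (G p)\<^sup>2 \<partial>lborel) * (\<integral>\<^sup>+p. (H p)\<^sup>2 \<partial>lborel))"
      by (simp add: mult_ac)
  qed measurable
qed

lemma admissible_kernel_add:
  assumes k: "admissible_kernel k" and l: "admissible_kernel l"
  shows "admissible_kernel (\<lambda>p q. k p q + l p q)"
proof -
  have km[measurable]: "case_prod k \<in> borel_measurable (borel \<Otimes>\<^sub>M borel)" using k by (simp add: admissible_kernel_def)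
  have lm[measurable]: "case_prod l \<in> borel_measurable (borel \<Otimes>\<^sub>M borel)" using l by (simp add: admissible_kernel_def)
  obtain B where B: "B < \<infinity>"
    "\<And>F G H. F \<in> borel_measurable borel \<Longrightarrow> G \<in> borel_measurable borel \<Longrightarrow> H \<in> borel_measurable borel \<Longrightarrow>
      (\<integral>\<^sup>+p. \<integral>\<^sup>+q. k p q * (F p * G q * H (- p - q)) \<partial>lborel \<partial>lborel)\<^sup>2
        \<le> B * ((\<integral>\<^sup>+p. (F p)\<^sup>2 \<partial>lborel) * (\<integral>\<^sup>+p. (G p)\<^sup>2 \<partial>lborel) * (\<integral>\<^sup>+p. (H p)\<^sup>2 \<partial>lborel))"
    using k unfolding admissible_kernel_def by blast
  obtain B' where B': "B' < \<infinity>"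
    "\<And>F G H. F \<in> borel_measurable borel \<Longrightarrow> G \<in> borel_measurable borel \<Longrightarrow> H \<in> borel_measurable borel \<Longrightarrow>
      (\<integral>\<^sup>+p. \<integral>\<^sup>+q. l p q * (F p * G q * H (- p - q)) \<partial>lborel \<partial>lborel)\<^sup>2
        \<le> B' * ((\<integral>\<^sup>+p. (F p)\<^sup>2 \<partial>lborel) * (\<integral>\<^sup>+p. (G p)\<^sup>2 \<partial>lborel) * (\<integral>\<^sup>+p. (H p)\<^sup>2 \<partial>lborel))"
    using l unfolding admissible_kernel_def by blast
  show ?thesis
    unfolding admissible_kernel_def
  proof (intro conjI exI[of _ "4 * (B + B')"] ballI)
    show "4 * (B + B') < \<infinity>" using B B' by (simp add: ennreal_mult_less_top)
    fix F G H :: "real \<times> real \<Rightarrow> ennreal"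
    assume m[measurable]: "F \<in> borel_measurable borel" "G \<in> borel_measurable borel" "H \<in> borel_measurable borel"
    define I where "I k = (\<integral>\<^sup>+p. \<integral>\<^sup>+q. k p q * (F p * G q * H (- p - q)) \<partial>lborel \<partial>lborel)" for k
    define N where "N = (\<integral>\<^sup>+p. (F p)\<^sup>2 \<partial>lborel) * (\<integral>\<^sup>+p. (G p)\<^sup>2 \<partial>lborel) * (\<integral>\<^sup>+p. (H p)\<^sup>2 \<partial>lborel)"
    have "I (\<lambda>p q. k p q + l p q) = I k + I l"
      unfolding I_def by (simp add: distrib_right nn_integral_add)
    \<comment> \<open>Going through the maximum gives (x + y)^2 <= 4 (x^2 + y^2) for extended values
      too; this is the 4 in the constant.\<close>
    also have "\<dots> \<le> 2 * max (I k) (I l)"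
      unfolding mult_2 by (intro add_mono) auto
    finally have "(I (\<lambda>p q. k p q + l p q))\<^sup>2 \<le> (2 * max (I k) (I l))\<^sup>2" by (intro power_mono) auto
    also have "\<dots> = 4 * (max (I k) (I l))\<^sup>2" by (simp add: power_mult_distrib)
    also have "\<dots> \<le> 4 * ((I k)\<^sup>2 + (I l)\<^sup>2)" by (intro mult_left_mono) (auto simp: max_def)
    also have "\<dots> \<le> 4 * (B * N + B' * N)"
      using B(2)[OF m] B'(2)[OF m] unfolding I_def N_def by (intro mult_left_mono add_mono) auto
    finally show "(\<integral>\<^sup>+p. \<integral>\<^sup>+q. (k p q + l p q) * (F p * G q * H (- p - q)) \<partial>lborel \<partial>lborel)\<^sup>2
        \<le> 4 * (B + B') * ((\<integral>\<^sup>+p. (F p)\<^sup>2 \<partial>lborel) * (\<integral>\<^sup>+p. (G p)\<^sup>2 \<partial>lborel) * (\<integral>\<^sup>+p. (H p)\<^sup>2 \<partial>lborel))"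
      unfolding I_def N_def by (simp add: algebra_simps)
  qed measurable
qed

section \<open>Decay factors and their square integrals over fibres\<close>

definition decay_weight :: "real \<Rightarrow> real \<Rightarrow> ennreal" where
  "decay_weight \<rho> y = ennreal (jbracket y powr - \<rho>)"

lemma decay_weight_measurable [measurable]: "decay_weight \<rho> \<in> borel_measurable borel"
  unfolding decay_weight_def[abs_def] by measurable

lemma nn_integral_decay_weight_affine:
  assumes "1 \<le> \<bar>c\<bar>"
  shows "(\<integral>\<^sup>+y. (decay_weight \<rho> (t + c * y))\<^sup>2 \<partial>lborel) \<le> (\<integral>\<^sup>+y. (decay_weight \<rho> y)\<^sup>2 \<partial>lborel)"
proof -
  let ?I = "\<integral>\<^sup>+y. (decay_weight \<rho> (t + c * y))\<^sup>2 \<partial>lborel"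
  have "?I = 1 * ?I" by simp
  also have "\<dots> \<le> ennreal \<bar>c\<bar> * ?I"
    using assms by (intro mult_right_mono) (auto simp: ennreal_leI simp flip: ennreal_1)
  also have "\<dots> = (\<integral>\<^sup>+y. (decay_weight \<rho> y)\<^sup>2 \<partial>lborel)"
    using assms by (intro nn_integral_real_affine[symmetric]) auto
  finally show ?thesis .
qed

lemma nn_integral_decay_weight_finite:
  assumes "1/2 < \<rho>"
  shows "(\<integral>\<^sup>+y. (decay_weight \<rho> y)\<^sup>2 \<partial>lborel) < \<infinity>"
proof -
  have "(decay_weight \<rho> y)\<^sup>2 = ennreal (jbracket y powr - (2 * \<rho>))" for y
    by (simp add: decay_weight_def power2_eq_square flip: ennreal_mult powr_add)
  then show ?thesis using nn_integral_jbracket_finite[of "2 * \<rho>"] assms by simp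
qed

text \<open>For each \<xi> the offset \<open>c \<xi>\<close> is removed by a translation in \<tau>,
  so the \<tau>-integral is bounded uniformly before the \<xi>-integral is taken.\<close>

lemma fibre_bound_mixed:
  fixes c :: "real \<Rightarrow> real"
  assumes [measurable]: "c \<in> borel_measurable borel" and e: "1 \<le> \<bar>e\<bar>" "1 \<le> \<bar>f\<bar>"
  shows "(\<integral>\<^sup>+q. (decay_weight \<rho> (c (snd q) + e * fst q) * decay_weight \<rho> (d + f * snd q))\<^sup>2 \<partial>lborel)
    \<le> (\<integral>\<^sup>+y. (decay_weight \<rho> y)\<^sup>2 \<partial>lborel)\<^sup>2" (is "?L \<le> ?J\<^sup>2")
proof -
  have "?L = (\<integral>\<^sup>+\<xi>. \<integral>\<^sup>+\<tau>. (decay_weight \<rho> (c \<xi> + e * \<tau>))\<^sup>2 * (decay_weight \<rho> (d + f * \<xi>))\<^sup>2 \<partial>lborel \<partial>lborel)"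
    by (subst nn_integral_lborel_pair(2)) (simp_all add: power_mult_distrib)
  also have "\<dots> = (\<integral>\<^sup>+\<xi>. (\<integral>\<^sup>+\<tau>. (decay_weight \<rho> (c \<xi> + e * \<tau>))\<^sup>2 \<partial>lborel) * (decay_weight \<rho> (d + f * \<xi>))\<^sup>2 \<partial>lborel)"
    by (intro nn_integral_cong nn_integral_multc) measurable
  also have "\<dots> \<le> (\<integral>\<^sup>+\<xi>. ?J * (decay_weight \<rho> (d + f * \<xi>))\<^sup>2 \<partial>lborel)"
    by (intro nn_integral_mono mult_right_mono nn_integral_decay_weight_affine e) auto
  also have "\<dots> = ?J * (\<integral>\<^sup>+\<xi>. (decay_weight \<rho> (d + f * \<xi>))\<^sup>2 \<partial>lborel)"
    by (intro nn_integral_cmult) measurable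
  also have "\<dots> \<le> ?J * ?J"
    by (intro mult_left_mono nn_integral_decay_weight_affine e) auto
  finally show ?thesis by (simp add: power2_eq_square)
qed

text \<open>The linear forms \<tau> + \<sigma>\<xi> and -\<tau> + \<sigma>\<xi> are independent.
  Once \<tau> is shifted by \<sigma>\<xi>, the first factor no longer contains \<xi> and the second
  contains it with coefficient 2\<sigma>.\<close>

lemma fibre_bound_transversal:
  assumes \<sigma>: "\<bar>\<sigma>\<bar> = 1"
  shows "(\<integral>\<^sup>+q. (decay_weight \<rho> (fst q + \<sigma> * snd q) * decay_weight \<rho> (t - fst q + \<sigma> * snd q))\<^sup>2 \<partial>lborel)
    \<le> (\<integral>\<^sup>+y. (decay_weight \<rho> y)\<^sup>2 \<partial>lborel)\<^sup>2" (is "?L \<le> ?J\<^sup>2")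
proof -
  have "?L = (\<integral>\<^sup>+\<xi>. \<integral>\<^sup>+\<tau>. (decay_weight \<rho> (\<tau> + \<sigma> * \<xi>))\<^sup>2 * (decay_weight \<rho> (t - \<tau> + \<sigma> * \<xi>))\<^sup>2 \<partial>lborel \<partial>lborel)"
    by (subst nn_integral_lborel_pair(2)) (simp_all add: power_mult_distrib)
  also have "\<dots> = (\<integral>\<^sup>+\<xi>. \<integral>\<^sup>+\<tau>. (decay_weight \<rho> \<tau>)\<^sup>2 * (decay_weight \<rho> ((t - \<tau>) + (2 * \<sigma>) * \<xi>))\<^sup>2 \<partial>lborel \<partial>lborel)"
  proof (rule nn_integral_cong)
    fix \<xi> :: real
    show "(\<integral>\<^sup>+\<tau>. (decay_weight \<rho> (\<tau> + \<sigma> * \<xi>))\<^sup>2 * (decay_weight \<rho> (t - \<tau> + \<sigma> * \<xi>))\<^sup>2 \<partial>lborel)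
      = (\<integral>\<^sup>+\<tau>. (decay_weight \<rho> \<tau>)\<^sup>2 * (decay_weight \<rho> ((t - \<tau>) + (2 * \<sigma>) * \<xi>))\<^sup>2 \<partial>lborel)"
      using nn_integral_lborel_affine[of "\<lambda>\<tau>. (decay_weight \<rho> \<tau>)\<^sup>2 * (decay_weight \<rho> ((t - \<tau>) + (2 * \<sigma>) * \<xi>))\<^sup>2" 1 "\<sigma> * \<xi>"]
      by (simp add: algebra_simps)
  qed
  also have "\<dots> = (\<integral>\<^sup>+\<tau>. \<integral>\<^sup>+\<xi>. (decay_weight \<rho> \<tau>)\<^sup>2 * (decay_weight \<rho> ((t - \<tau>) + (2 * \<sigma>) * \<xi>))\<^sup>2 \<partial>lborel \<partial>lborel)"
    by (rule lborel_pair.Fubini') measurable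
  also have "\<dots> = (\<integral>\<^sup>+\<tau>. (decay_weight \<rho> \<tau>)\<^sup>2 * (\<integral>\<^sup>+\<xi>. (decay_weight \<rho> ((t - \<tau>) + (2 * \<sigma>) * \<xi>))\<^sup>2 \<partial>lborel) \<partial>lborel)"
    by (intro nn_integral_cong nn_integral_cmult) measurable
  also have "\<dots> \<le> (\<integral>\<^sup>+\<tau>. (decay_weight \<rho> \<tau>)\<^sup>2 * ?J \<partial>lborel)"
    using \<sigma> by (intro nn_integral_mono mult_left_mono nn_integral_decay_weight_affine) auto
  also have "\<dots> = ?J * ?J"
    by (intro nn_integral_multc) measurable
  finally show ?thesis by (simp add: power2_eq_square)
qed

text \<open>
  Modulation and frequency of the three functions at the points p, q and - p - q; the last
  frequency is taken up to sign.
\<close>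

definition mod1 :: "real \<Rightarrow> real \<times> real \<Rightarrow> real \<times> real \<Rightarrow> real" where "mod1 \<sigma> p q = fst p + \<sigma> * snd p"
definition mod2 :: "real \<Rightarrow> real \<times> real \<Rightarrow> real \<times> real \<Rightarrow> real" where "mod2 \<sigma> p q = fst q + \<sigma> * snd q"
definition mod3 :: "real \<Rightarrow> real \<times> real \<Rightarrow> real \<times> real \<Rightarrow> real" where "mod3 \<sigma> p q = - fst p - fst q + \<sigma> * (snd p + snd q)"
definition freq1 :: "real \<times> real \<Rightarrow> real \<times> real \<Rightarrow> real" where "freq1 p q = snd p"
definition freq2 :: "real \<times> real \<Rightarrow> real \<times> real \<Rightarrow> real" where "freq2 p q = snd q"
definition freq3 :: "real \<times> real \<Rightarrow> real \<times> real \<Rightarrow> real" where "freq3 p q = snd p + snd q"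

lemmas mod_freq_defs = mod1_def mod2_def mod3_def freq1_def freq2_def freq3_def

section \<open>The eleven admissible products\<close>

context
  fixes \<sigma> \<rho> :: real
  assumes \<sigma>: "\<bar>\<sigma>\<bar> = 1" and \<rho>: "1/2 < \<rho>"
begin

lemma pair_kernel_measurable:
  assumes "X \<in> {mod1 \<sigma>, mod2 \<sigma>, mod3 \<sigma>, freq1, freq2, freq3}"
    "Y \<in> {mod1 \<sigma>, mod2 \<sigma>, mod3 \<sigma>, freq1, freq2, freq3}"
  shows "(\<lambda>(p, q). decay_weight \<rho> (X p q) * decay_weight \<rho> (Y p q)) \<in> borel_measurable (borel \<Otimes>\<^sub>M borel)"
proof -
  have m: "(\<lambda>(p, q). decay_weight \<rho> (X p q)) \<in> borel_measurable (borel \<Otimes>\<^sub>M borel)"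
    if "X \<in> {mod1 \<sigma>, mod2 \<sigma>, mod3 \<sigma>, freq1, freq2, freq3}" for X
    using that unfolding mod_freq_defs[abs_def] by (elim insertE emptyE; hypsubst) measurable
  from m[OF assms(1)] m[OF assms(2)] show ?thesis
    unfolding case_prod_beta' by (rule borel_measurable_times_ennreal)
qed

abbreviation "pair_kernel X Y \<equiv> (\<lambda>p q. decay_weight \<rho> (X p q) * decay_weight \<rho> (Y p q))"

lemma decay_weight_bound_finite: "(\<integral>\<^sup>+y. (decay_weight \<rho> y)\<^sup>2 \<partial>lborel)\<^sup>2 < \<infinity>"
  using nn_integral_decay_weight_finite[OF \<rho>] by (simp add: power_less_top_ennreal)

lemmas admissible_pair_kernelI1 = admissible_kernelI1[OF pair_kernel_measurable decay_weight_bound_finite]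
lemmas admissible_pair_kernelI2 = admissible_kernelI2[OF pair_kernel_measurable decay_weight_bound_finite]
lemmas admissible_pair_kernelI3 = admissible_kernelI3[OF pair_kernel_measurable decay_weight_bound_finite]

text \<open>The point held fixed is always one whose index occurs in neither factor, so both factors
  vary along the fibre and in independent directions. For \<open>mod1\<close> and
  \<open>mod2\<close> this would be the third point, but \<open>mod1 + mod2\<close> is constant on
  its fibres, so the square is not integrable there.\<close>

lemma admissible_pair_kernels:
  "admissible_kernel (pair_kernel (mod2 \<sigma>) (mod3 \<sigma>))"
  "admissible_kernel (pair_kernel (mod1 \<sigma>) (mod3 \<sigma>))"
  "admissible_kernel (pair_kernel (mod1 \<sigma>) freq1)"
  "admissible_kernel (pair_kernel (mod1 \<sigma>) freq2)"
  "admissible_kernel (pair_kernel (mod1 \<sigma>) freq3)"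
  "admissible_kernel (pair_kernel (mod2 \<sigma>) freq1)"
  "admissible_kernel (pair_kernel (mod2 \<sigma>) freq2)"
  "admissible_kernel (pair_kernel (mod2 \<sigma>) freq3)"
  "admissible_kernel (pair_kernel (mod3 \<sigma>) freq1)"
  "admissible_kernel (pair_kernel (mod3 \<sigma>) freq2)"
  "admissible_kernel (pair_kernel (mod3 \<sigma>) freq3)"
proof -
  \<comment> \<open>Offsets of the modulations as affine functions of the integrated time frequency:
    the second is for \<open>mod3\<close>, the third for \<open>mod2\<close> on fibres with the
    third point fixed.\<close>
  have m: "(\<lambda>\<xi>. \<sigma> * \<xi>) \<in> borel_measurable borel"
    "(\<lambda>\<xi>. - t + \<sigma> * (\<xi> + x)) \<in> borel_measurable borel"
    "(\<lambda>\<xi>. - t - \<sigma> * (\<xi> + x)) \<in> borel_measurable borel" for t x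
    by measurable
  show "admissible_kernel (pair_kernel (mod2 \<sigma>) (mod3 \<sigma>))"
  proof (rule admissible_pair_kernelI1)
    show "(\<integral>\<^sup>+q. (pair_kernel (mod2 \<sigma>) (mod3 \<sigma>) x q)\<^sup>2 \<partial>lborel) \<le> (\<integral>\<^sup>+y. (decay_weight \<rho> y)\<^sup>2 \<partial>lborel)\<^sup>2" for x
      using fibre_bound_transversal[OF \<sigma>, of \<rho> "- fst x + \<sigma> * snd x"]
      by (simp add: mod_freq_defs algebra_simps)
  qed simp_all
  show "admissible_kernel (pair_kernel (mod1 \<sigma>) (mod3 \<sigma>))"
  proof (rule admissible_pair_kernelI2)
    show "(\<integral>\<^sup>+q. (pair_kernel (mod1 \<sigma>) (mod3 \<sigma>) q x)\<^sup>2 \<partial>lborel) \<le> (\<integral>\<^sup>+y. (decay_weight \<rho> y)\<^sup>2 \<partial>lborel)\<^sup>2" for x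
      using fibre_bound_transversal[OF \<sigma>, of \<rho> "- fst x + \<sigma> * snd x"]
      by (simp add: mod_freq_defs algebra_simps)
  qed simp_all
  show "admissible_kernel (pair_kernel (mod1 \<sigma>) freq1)"
  proof (rule admissible_pair_kernelI2)
    show "(\<integral>\<^sup>+q. (pair_kernel (mod1 \<sigma>) freq1 q x)\<^sup>2 \<partial>lborel) \<le> (\<integral>\<^sup>+y. (decay_weight \<rho> y)\<^sup>2 \<partial>lborel)\<^sup>2" for x
      using fibre_bound_mixed[OF m(1), of 1 1 \<rho> 0, simplified]
      by (simp add: mod_freq_defs algebra_simps)
  qed simp_all
  show "admissible_kernel (pair_kernel (mod1 \<sigma>) freq3)"
  proof (rule admissible_pair_kernelI2)
    show "(\<integral>\<^sup>+q. (pair_kernel (mod1 \<sigma>) freq3 q x)\<^sup>2 \<partial>lborel) \<le> (\<integral>\<^sup>+y. (decay_weight \<rho> y)\<^sup>2 \<partial>lborel)\<^sup>2" for x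
      using fibre_bound_mixed[OF m(1), of 1 1 \<rho> "snd x", simplified]
      by (simp add: mod_freq_defs algebra_simps)
  qed simp_all
  show "admissible_kernel (pair_kernel (mod3 \<sigma>) freq1)"
  proof (rule admissible_pair_kernelI2)
    show "(\<integral>\<^sup>+q. (pair_kernel (mod3 \<sigma>) freq1 q x)\<^sup>2 \<partial>lborel) \<le> (\<integral>\<^sup>+y. (decay_weight \<rho> y)\<^sup>2 \<partial>lborel)\<^sup>2" for x
      using fibre_bound_mixed[OF m(2)[of "fst x" "snd x"], of "-1" 1 \<rho> 0, simplified]
      by (simp add: mod_freq_defs algebra_simps)
  qed simp_all
  show "admissible_kernel (pair_kernel (mod2 \<sigma>) freq2)"
  proof (rule admissible_pair_kernelI1)
    show "(\<integral>\<^sup>+q. (pair_kernel (mod2 \<sigma>) freq2 x q)\<^sup>2 \<partial>lborel) \<le> (\<integral>\<^sup>+y. (decay_weight \<rho> y)\<^sup>2 \<partial>lborel)\<^sup>2" for x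
      using fibre_bound_mixed[OF m(1), of 1 1 \<rho> 0, simplified]
      by (simp add: mod_freq_defs algebra_simps)
  qed simp_all
  show "admissible_kernel (pair_kernel (mod2 \<sigma>) freq3)"
  proof (rule admissible_pair_kernelI1)
    show "(\<integral>\<^sup>+q. (pair_kernel (mod2 \<sigma>) freq3 x q)\<^sup>2 \<partial>lborel) \<le> (\<integral>\<^sup>+y. (decay_weight \<rho> y)\<^sup>2 \<partial>lborel)\<^sup>2" for x
      using fibre_bound_mixed[OF m(1), of 1 1 \<rho> "snd x", simplified]
      by (simp add: mod_freq_defs algebra_simps)
  qed simp_all
  show "admissible_kernel (pair_kernel (mod3 \<sigma>) freq2)"
  proof (rule admissible_pair_kernelI1)
    show "(\<integral>\<^sup>+q. (pair_kernel (mod3 \<sigma>) freq2 x q)\<^sup>2 \<partial>lborel) \<le> (\<integral>\<^sup>+y. (decay_weight \<rho> y)\<^sup>2 \<partial>lborel)\<^sup>2" for x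
      using fibre_bound_mixed[OF m(2)[of "fst x" "snd x"], of "-1" 1 \<rho> 0, simplified]
      by (simp add: mod_freq_defs algebra_simps)
  qed simp_all
  show "admissible_kernel (pair_kernel (mod3 \<sigma>) freq3)"
  proof (rule admissible_pair_kernelI1)
    show "(\<integral>\<^sup>+q. (pair_kernel (mod3 \<sigma>) freq3 x q)\<^sup>2 \<partial>lborel) \<le> (\<integral>\<^sup>+y. (decay_weight \<rho> y)\<^sup>2 \<partial>lborel)\<^sup>2" for x
      using fibre_bound_mixed[OF m(2)[of "fst x" "snd x"], of "-1" 1 \<rho> "snd x", simplified]
      by (simp add: mod_freq_defs algebra_simps)
  qed simp_all
  show "admissible_kernel (pair_kernel (mod1 \<sigma>) freq2)"
  proof (rule admissible_pair_kernelI3)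
    show "(\<integral>\<^sup>+q. (pair_kernel (mod1 \<sigma>) freq2 q (- x - q))\<^sup>2 \<partial>lborel) \<le> (\<integral>\<^sup>+y. (decay_weight \<rho> y)\<^sup>2 \<partial>lborel)\<^sup>2" for x
      using fibre_bound_mixed[OF m(1), of 1 "-1" \<rho> "- snd x", simplified]
      by (simp add: mod_freq_defs algebra_simps)
  qed simp_all
  show "admissible_kernel (pair_kernel (mod2 \<sigma>) freq1)"
  proof (rule admissible_pair_kernelI3)
    show "(\<integral>\<^sup>+q. (pair_kernel (mod2 \<sigma>) freq1 q (- x - q))\<^sup>2 \<partial>lborel) \<le> (\<integral>\<^sup>+y. (decay_weight \<rho> y)\<^sup>2 \<partial>lborel)\<^sup>2" for x
      using fibre_bound_mixed[OF m(3)[of "fst x" "snd x"], of "-1" 1 \<rho> 0, simplified]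
      by (simp add: mod_freq_defs algebra_simps)
  qed simp_all
qed

end

section \<open>Schwartz functions and the decay of their Fourier transforms\<close>

lemma integrable_lborel_affine:
  fixes f :: "'a::euclidean_space \<Rightarrow> 'b::{banach, second_countable_topology}"
  assumes "integrable lborel f" "\<bar>c\<bar> = 1"
  shows "integrable lborel (\<lambda>x. f (t + c *\<^sub>R x))"
proof -
  have [measurable]: "f \<in> borel_measurable borel" using assms by auto
  show ?thesis
    using assms nn_integral_lborel_affine[of "\<lambda>x. ennreal (norm (f x))" c t] by (simp add: integrable_iff_bounded)
qed

lemma iterated_deriv_append: "iterated_deriv (vs @ ws) f = iterated_deriv vs (iterated_deriv ws f)"
  by (induction vs) auto

lemma schwartz_deriv:
  assumes "schwartz f" "v \<in> Basis"
  shows "schwartz (\<lambda>p. frechet_derivative f (at p) v)"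
proof -
  have "iterated_deriv vs (\<lambda>p. frechet_derivative f (at p) v) = iterated_deriv (vs @ [v]) f" for vs
    by (simp add: iterated_deriv_append)
  then show ?thesis
    using assms unfolding schwartz_def by (metis Un_subset_iff set_append empty_subsetI insert_subset list.simps(15) list.set(1))
qed

lemma schwartz_differentiable: "schwartz f \<Longrightarrow> f differentiable (at p)"
  unfolding schwartz_def by (metis empty_subsetI iterated_deriv.simps(1) list.set(1))

lemma schwartz_continuous: "schwartz f \<Longrightarrow> continuous_on UNIV f"
  by (simp add: schwartz_differentiable differentiable_imp_continuous_within continuous_at_imp_continuous_on)

lemma schwartz_measurable: "schwartz f \<Longrightarrow> f \<in> borel_measurable borel"
  by (simp add: schwartz_continuous borel_measurable_continuous_onI)

lemma schwartz_decay:
  assumes "schwartz f"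
  obtains C where "0 \<le> C" "\<And>p. (1 + norm p) ^ N * norm (f p) \<le> C"
proof -
  have "bounded (range (\<lambda>p. (1 + norm p) ^ N *\<^sub>R iterated_deriv [] f p))"
    using assms unfolding schwartz_def by (metis empty_subsetI list.set(1))
  then obtain C where "0 < C" "\<And>p. norm ((1 + norm p) ^ N *\<^sub>R f p) \<le> C"
    by (auto simp: bounded_pos)
  then show ?thesis by (intro that[of C]) (auto simp: add_nonneg_nonneg)
qed

section \<open>An integrable majorant on the plane\<close>

definition plane_decay :: "real \<times> real \<Rightarrow> real" where
  "plane_decay p = jbracket (fst p) powr - 2 * jbracket (snd p) powr - 2"

lemma plane_decay_measurable [measurable]: "plane_decay \<in> borel_measurable borel"
  unfolding plane_decay_def[abs_def] by measurable

lemma integrable_plane_decay: "integrable lborel plane_decay"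
proof (rule integrableI_bounded)
  let ?J = "\<integral>\<^sup>+y. ennreal (jbracket y powr - 2) \<partial>lborel"
  have "(\<integral>\<^sup>+p. ennreal (norm (plane_decay p)) \<partial>lborel)
    = (\<integral>\<^sup>+x. \<integral>\<^sup>+y. ennreal (jbracket x powr - 2) * ennreal (jbracket y powr - 2) \<partial>lborel \<partial>lborel)"
    by (subst nn_integral_lborel_pair(1)) (simp_all add: plane_decay_def ennreal_mult)
  also have "\<dots> = ?J * ?J"
    by (simp add: nn_integral_cmult nn_integral_multc)
  also have "\<dots> < \<infinity>" using nn_integral_jbracket_finite[of 2] by (simp add: ennreal_mult_less_top)
  finally show "(\<integral>\<^sup>+p. ennreal (norm (plane_decay p)) \<partial>lborel) < \<infinity>" .
qed measurable

lemma plane_decay_ge: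
  fixes p :: "real \<times> real"
  assumes "max \<bar>fst p\<bar> \<bar>snd p\<bar> \<le> r"
  shows "1 \<le> (1 + r) ^ 4 * plane_decay p"
proof -
  have a: "jbracket (fst p) \<le> 1 + r" "jbracket (snd p) \<le> 1 + r"
    using assms jbracket_le[of "fst p"] jbracket_le[of "snd p"] by auto
  have "(jbracket (fst p))\<^sup>2 * (jbracket (snd p))\<^sup>2 \<le> (1 + r)\<^sup>2 * (1 + r)\<^sup>2"
    using a by (intro mult_mono power_mono) auto
  also have "\<dots> = (1 + r) ^ 4" by (simp flip: power_add)
  moreover have "0 < (jbracket (fst p))\<^sup>2 * (jbracket (snd p))\<^sup>2" using jbracket_pos by (intro mult_pos_pos zero_less_power)
  ultimately show ?thesis
    by (simp add: plane_decay_def powr_minus powr_numeral flip: divide_inverse inverse_mult_distrib)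
qed

lemma norm_ge_components: "max \<bar>fst p\<bar> \<bar>snd p\<bar> \<le> norm (p :: real \<times> real)"
  using norm_fst_le[of "fst p" "snd p"] norm_snd_le[of "snd p" "fst p"] by simp

text \<open>The two inverse squares in \<open>plane_decay\<close> cost a fourth power. The radius
  \<open>r\<close> is left free: it is the norm for Schwartz functions and the sum of the absolute
  coordinates for their transforms.\<close>

lemma le_plane_decay:
  fixes f :: "real \<times> real \<Rightarrow> 'b::real_normed_vector"
  assumes "(1 + r) ^ 4 * norm (f p) \<le> C" "max \<bar>fst p\<bar> \<bar>snd p\<bar> \<le> r"
  shows "norm (f p) \<le> C * plane_decay p"
proof -
  have nn: "0 \<le> plane_decay p" by (simp add: plane_decay_def)
  have "norm (f p) * 1 \<le> norm (f p) * ((1 + r) ^ 4 * plane_decay p)"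
    using plane_decay_ge[OF assms(2)] by (intro mult_left_mono) auto
  also have "\<dots> = ((1 + r) ^ 4 * norm (f p)) * plane_decay p" by simp
  also have "\<dots> \<le> C * plane_decay p" using nn assms(1) by (intro mult_right_mono)
  finally show ?thesis by simp
qed

lemma integrable_by_plane_decay:
  fixes f :: "real \<times> real \<Rightarrow> 'b::{banach, second_countable_topology}"
  assumes "f \<in> borel_measurable borel" "\<And>p. norm (f p) \<le> C * plane_decay p"
  shows "integrable lborel f"
  by (rule Bochner_Integration.integrable_bound[of lborel "\<lambda>p. C * plane_decay p"])
    (use assms integrable_plane_decay order_trans[OF assms(2) abs_ge_self] in auto)

lemma schwartz_integrable:
  fixes f :: "real \<times> real \<Rightarrow> complex"
  assumes "schwartz f"
  shows "integrable lborel f"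
proof -
  obtain C where C: "\<And>p. (1 + norm p) ^ 4 * norm (f p) \<le> C" using schwartz_decay[OF assms] by metis
  show ?thesis
    by (intro integrable_by_plane_decay[of _ C] schwartz_measurable assms le_plane_decay[OF C norm_ge_components])
qed

section \<open>Basic properties of the Fourier transform\<close>

lemma cis_measurable [measurable]: "cis \<in> borel_measurable borel"
  by (intro borel_measurable_continuous_onI continuous_intros)

lemma integrable_cis_mult:
  fixes f :: "'a::euclidean_space \<Rightarrow> complex"
  assumes "integrable lborel f" "g \<in> borel_measurable borel"
  shows "integrable lborel (\<lambda>p. cis (g p) * f p)"
  by (rule Bochner_Integration.integrable_bound[OF assms(1)])
    (use assms in \<open>auto simp: norm_mult\<close>)

lemma fourier_measurable [measurable]:
  fixes f :: "'a::euclidean_space \<Rightarrow> complex"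
  assumes [measurable]: "f \<in> borel_measurable borel"
  shows "fourier f \<in> borel_measurable borel"
  unfolding fourier_def[abs_def] by measurable

lemma norm_fourier_le: "norm (fourier f q) \<le> (LINT p|lborel. norm (f p))"
  unfolding fourier_def
  using integral_norm_bound[of lborel "\<lambda>p. cis (- (p \<bullet> q)) * f p"] by (simp add: norm_mult)

lemma fourier_translate:
  fixes f :: "'a::euclidean_space \<Rightarrow> complex"
  assumes [measurable]: "f \<in> borel_measurable borel"
  shows "fourier (\<lambda>p. f (a + p)) q = cis (a \<bullet> q) * fourier f q"
proof -
  have "fourier (\<lambda>p. f (a + p)) q = (LINT p|lborel. cis (a \<bullet> q) * (cis (- ((a + p) \<bullet> q)) * f (a + p)))"
    unfolding fourier_def by (intro Bochner_Integration.integral_cong) (auto simp: inner_add_left cis_mult[symmetric] mult.assoc[symmetric] cis_mult)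
  also have "\<dots> = cis (a \<bullet> q) * (LINT p|lborel. cis (- ((a + p) \<bullet> q)) * f (a + p))"
    by simp
  also have "(LINT p|lborel. cis (- ((a + p) \<bullet> q)) * f (a + p)) = fourier f q"
    unfolding fourier_def using integral_lborel_affine[of "\<lambda>p. cis (- (p \<bullet> q)) * f p" 1 a] by simp
  finally show ?thesis .
qed

lemma cis_difference_quotient:
  assumes "h \<longlonglongrightarrow> 0" "\<And>n. h n \<noteq> (0 :: real)"
  shows "(\<lambda>n. (cis (h n * c) - 1) / of_real (h n)) \<longlonglongrightarrow> \<i> * of_real c"
proof -
  have "((\<lambda>z. exp (z * (\<i> * of_real c))) has_field_derivative \<i> * of_real c) (at 0)"
    by (auto intro!: derivative_eq_intros)
  then have "((\<lambda>z. (exp (z * (\<i> * of_real c)) - 1) / z) \<longlongrightarrow> \<i> * of_real c) (at 0)"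
    by (simp add: DERIV_def)
  moreover have "filterlim (\<lambda>n. complex_of_real (h n)) (at 0) sequentially"
    using assms by (auto simp: filterlim_at intro!: tendsto_eq_intros)
  ultimately have "(\<lambda>n. (exp (of_real (h n) * (\<i> * of_real c)) - 1) / of_real (h n)) \<longlonglongrightarrow> \<i> * of_real c"
    by (rule filterlim_compose)
  then show ?thesis by (simp add: cis_conv_exp mult_ac)
qed

text \<open>In place of integration by parts, difference quotients are formed from translates, which
  the transform turns into phases. Dominated convergence yields the derivative of \<open>f\<close>
  on one side, and the quotient of the phases converges on the other.\<close>

lemma fourier_deriv:
  fixes f :: "real \<times> real \<Rightarrow> complex"
  assumes f: "schwartz f" and v: "v \<in> Basis"
  shows "fourier (\<lambda>p. frechet_derivative f (at p) v) q = \<i> * of_real (v \<bullet> q) * fourier f q"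
proof -
  define D where "D = (\<lambda>p. frechet_derivative f (at p) v)"
  define h where "h n = inverse (real (Suc n))" for n
  have h: "h \<longlonglongrightarrow> 0" "\<And>n. h n \<noteq> 0" "\<And>n. 0 < h n" "\<And>n. h n \<le> 1"
    unfolding h_def using LIMSEQ_inverse_real_of_nat by (auto simp: field_simps)
  have [measurable]: "f \<in> borel_measurable borel" "D \<in> borel_measurable borel"
    using schwartz_measurable f schwartz_deriv[OF f v] by (auto simp: D_def)
  obtain C where C: "0 \<le> C" "\<And>p. (1 + norm p) ^ 4 * norm (D p) \<le> C"
    using schwartz_decay[OF schwartz_deriv[OF f v], of 4] unfolding D_def by metis
  have der: "((\<lambda>s. f (p + s *\<^sub>R v)) has_vector_derivative D (p + s *\<^sub>R v)) (at s within S)" for p s S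
  proof -
    have "(f has_derivative frechet_derivative f (at (p + s *\<^sub>R v))) (at (p + s *\<^sub>R v))"
      using schwartz_differentiable[OF f] frechet_derivative_works by blast
    then have "((\<lambda>s. f (p + s *\<^sub>R v)) has_derivative (\<lambda>t. frechet_derivative f (at (p + s *\<^sub>R v)) (t *\<^sub>R v))) (at s)"
      by (rule has_derivative_compose[rotated]) (auto intro!: derivative_eq_intros)
    moreover have "linear (frechet_derivative f (at (p + s *\<^sub>R v)))"
      using schwartz_differentiable[OF f] linear_frechet_derivative by blast
    ultimately show ?thesis
      unfolding has_vector_derivative_def D_def by (auto simp: linear_cmul intro: has_derivative_at_withinI)
  qed
  let ?g = "\<lambda>n p. cis (- (p \<bullet> q)) * ((f (h n *\<^sub>R v + p) - f p) / of_real (h n))"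
  have bound: "norm (?g n p) \<le> 16 * C * plane_decay p" for n p
  proof -
    have "norm (f (p + h n *\<^sub>R v) - f (p + 0 *\<^sub>R v)) \<le> (16 * C * plane_decay p) * norm (h n - 0)"
    proof (rule differentiable_bound[where S = "{0..h n}" and f' = "\<lambda>s t. t *\<^sub>R D (p + s *\<^sub>R v)"])
      fix s assume s: "s \<in> {0..h n}"
      show "((\<lambda>s. f (p + s *\<^sub>R v)) has_derivative (\<lambda>t. t *\<^sub>R D (p + s *\<^sub>R v))) (at s within {0..h n})"
        using der[of p s "{0..h n}"] by (simp add: has_vector_derivative_def)
      \<comment> \<open>A shift by at most one unit vector at most doubles
        \<open>1 + norm p\<close>, whence the factor 16 = 2^4 in the majorant.\<close>
      have "1 + norm p \<le> 2 * (1 + norm (p + s *\<^sub>R v))"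
        using norm_triangle_ineq4[of "p + s *\<^sub>R v" "s *\<^sub>R v"] s h(4)[of n] v norm_ge_zero[of "p + s *\<^sub>R v"]
        by (simp add: norm_Basis del: norm_ge_zero)
      then have "(1 + norm p) ^ 4 \<le> (2 * (1 + norm (p + s *\<^sub>R v))) ^ 4"
        by (intro power_mono) auto
      also have "\<dots> = 16 * (1 + norm (p + s *\<^sub>R v)) ^ 4" by (simp only: power_mult_distrib) simp
      finally have "(1 + norm p) ^ 4 * norm (D (p + s *\<^sub>R v)) \<le> (16 * (1 + norm (p + s *\<^sub>R v)) ^ 4) * norm (D (p + s *\<^sub>R v))"
        by (intro mult_right_mono) auto
      also have "\<dots> \<le> 16 * C" using C(2)[of "p + s *\<^sub>R v"] by simp
      finally have "norm (D (p + s *\<^sub>R v)) \<le> 16 * C * plane_decay p"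
        using le_plane_decay[where f = "\<lambda>p. D (p + s *\<^sub>R v)", OF _ norm_ge_components] by blast
      then show "onorm (\<lambda>t. t *\<^sub>R D (p + s *\<^sub>R v)) \<le> 16 * C * plane_decay p"
        by (intro onorm_le) (auto simp: mult.commute intro: mult_left_mono order_trans)
    qed (use h(3)[of n] in auto)
    then have "norm (f (h n *\<^sub>R v + p) - f p) / h n \<le> 16 * C * plane_decay p"
      using h(3)[of n] by (simp add: add.commute pos_divide_le_eq)
    then show ?thesis using h(3)[of n] by (simp add: norm_mult norm_divide)
  qed
  have lim: "(\<lambda>n. ?g n p) \<longlonglongrightarrow> cis (- (p \<bullet> q)) * D p" for p
  proof -
    have "((\<lambda>s. (f (p + s *\<^sub>R v) - f (p + 0 *\<^sub>R v)) /\<^sub>R (s - 0)) \<longlongrightarrow> D (p + 0 *\<^sub>R v)) (at 0)"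
    proof -
      let ?\<phi> = "\<lambda>s. f (p + s *\<^sub>R v)"
      have eq: "norm (?\<phi> s - ?\<phi> 0 - (s - 0) *\<^sub>R D (p + 0 *\<^sub>R v)) / norm (s - 0)
        = norm ((?\<phi> s - ?\<phi> 0) /\<^sub>R (s - 0) - D (p + 0 *\<^sub>R v))" if "s \<noteq> 0" for s
      proof -
        have "(?\<phi> s - ?\<phi> 0) /\<^sub>R s - D (p + 0 *\<^sub>R v) = (?\<phi> s - ?\<phi> 0 - s *\<^sub>R D (p + 0 *\<^sub>R v)) /\<^sub>R s"
          using that by (simp add: scaleR_diff_right)
        then show ?thesis by (simp add: divide_inverse mult.commute)
      qed
      have "((\<lambda>s. norm (?\<phi> s - ?\<phi> 0 - (s - 0) *\<^sub>R D (p + 0 *\<^sub>R v)) / norm (s - 0)) \<longlongrightarrow> 0) (at 0)"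
        using der[of p 0 UNIV] unfolding has_vector_derivative_def has_derivative_iff_norm by blast
      moreover have "\<forall>\<^sub>F s in at 0. norm (?\<phi> s - ?\<phi> 0 - (s - 0) *\<^sub>R D (p + 0 *\<^sub>R v)) / norm (s - 0)
        = norm ((?\<phi> s - ?\<phi> 0) /\<^sub>R (s - 0) - D (p + 0 *\<^sub>R v))"
        unfolding eventually_at_filter using eq by (intro always_eventually) blast
      ultimately have "((\<lambda>s. norm ((?\<phi> s - ?\<phi> 0) /\<^sub>R (s - 0) - D (p + 0 *\<^sub>R v))) \<longlongrightarrow> 0) (at 0)"
        by (rule Lim_transform_eventually)
      then show ?thesis by (rule LIM_zero_cancel[OF tendsto_norm_zero_cancel])
    qed
    moreover have "filterlim h (at 0) sequentially"
      using h by (auto simp: filterlim_at)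
    ultimately have "(\<lambda>n. (f (p + h n *\<^sub>R v) - f (p + 0 *\<^sub>R v)) /\<^sub>R (h n - 0)) \<longlonglongrightarrow> D (p + 0 *\<^sub>R v)"
      by (rule filterlim_compose)
    then show ?thesis
      by (intro tendsto_mult tendsto_const) (simp add: scaleR_conv_of_real divide_inverse mult.commute add.commute)
  qed
  have lim1: "(\<lambda>n. LINT p|lborel. ?g n p) \<longlonglongrightarrow> (LINT p|lborel. cis (- (p \<bullet> q)) * D p)"
    by (rule integral_dominated_convergence[where w = "\<lambda>p. 16 * C * plane_decay p"])
      (use bound lim integrable_plane_decay in auto)
  have eq: "(LINT p|lborel. ?g n p) = (cis (h n * (v \<bullet> q)) - 1) / of_real (h n) * fourier f q" for n
  proof -
    have i: "integrable lborel f" using schwartz_integrable[OF f] .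
    have i': "integrable lborel (\<lambda>p. f (h n *\<^sub>R v + p))"
      using integrable_lborel_affine[OF i, of 1] by simp
    have "(LINT p|lborel. ?g n p) = (LINT p|lborel. (cis (- (p \<bullet> q)) * f (h n *\<^sub>R v + p) - cis (- (p \<bullet> q)) * f p) / of_real (h n))"
      by (simp add: algebra_simps)
    also have "\<dots> = (LINT p|lborel. cis (- (p \<bullet> q)) * f (h n *\<^sub>R v + p) - cis (- (p \<bullet> q)) * f p) / of_real (h n)"
      by simp
    also have "\<dots> = (fourier (\<lambda>p. f (h n *\<^sub>R v + p)) q - fourier f q) / of_real (h n)"
      unfolding fourier_def by (subst Bochner_Integration.integral_diff) (auto intro!: integrable_cis_mult i i')
    also have "\<dots> = (cis (h n * (v \<bullet> q)) - 1) / of_real (h n) * fourier f q"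
      by (subst fourier_translate) (simp_all add: algebra_simps)
    finally show ?thesis .
  qed
  have lim2: "(\<lambda>n. (cis (h n * (v \<bullet> q)) - 1) / of_real (h n) * fourier f q) \<longlonglongrightarrow> \<i> * of_real (v \<bullet> q) * fourier f q"
    by (intro tendsto_mult tendsto_const cis_difference_quotient h)
  have "(LINT p|lborel. cis (- (p \<bullet> q)) * D p) = \<i> * of_real (v \<bullet> q) * fourier f q"
    by (rule LIMSEQ_unique[OF lim1[unfolded eq] lim2])
  then show ?thesis by (simp add: fourier_def D_def)
qed

text \<open>Each factor \<open>v \<bullet> q\<close> is paid for by one derivative, so the induction
  has to range over all Schwartz functions.\<close>

lemma fourier_decay_Basis:
  fixes f :: "real \<times> real \<Rightarrow> complex"
  assumes "schwartz f" "v \<in> Basis"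
  shows "\<exists>C. \<forall>q. \<bar>v \<bullet> q\<bar> ^ n * norm (fourier f q) \<le> C"
  using assms(1)
proof (induction n arbitrary: f)
  case 0
  then show ?case using norm_fourier_le[of f] by auto
next
  case (Suc n)
  obtain C where C: "\<And>q. \<bar>v \<bullet> q\<bar> ^ n * norm (fourier (\<lambda>p. frechet_derivative f (at p) v) q) \<le> C"
    using Suc.IH[OF schwartz_deriv[OF Suc.prems assms(2)]] by blast
  then show ?case
    by (intro exI[of _ C]) (simp add: fourier_deriv[OF Suc.prems assms(2)] norm_mult mult_ac)
qed

lemma fourier_decay:
  fixes f :: "real \<times> real \<Rightarrow> complex"
  assumes f: "schwartz f"
  obtains C where "0 \<le> C" "\<And>q. (1 + \<bar>fst q\<bar> + \<bar>snd q\<bar>) ^ n * norm (fourier f q) \<le> C"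
proof -
  have B: "(1, 0) \<in> (Basis :: (real \<times> real) set)" "(0, 1) \<in> (Basis :: (real \<times> real) set)"
    by (auto simp: Basis_prod_def)
  obtain C1 where C1: "\<And>q. \<bar>(1, 0) \<bullet> q\<bar> ^ n * norm (fourier f q) \<le> C1"
    using fourier_decay_Basis[OF f B(1)] by blast
  obtain C2 where C2: "\<And>q. \<bar>(0, 1) \<bullet> q\<bar> ^ n * norm (fourier f q) \<le> C2"
    using fourier_decay_Basis[OF f B(2)] by blast
  obtain C3 where C3: "\<And>q. norm (fourier f q) \<le> C3"
    using norm_fourier_le[of f] by blast
  have *: "(1 + \<bar>fst q\<bar> + \<bar>snd q\<bar>) ^ n * norm (fourier f q) \<le> 3 ^ n * (C1 + C2 + C3)" for q
  proof -
    \<comment> \<open>Pure powers of the two coordinates suffice, because the largest of 1, |fst q|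
      and |snd q| is at least a third of their sum.\<close>
    let ?m = "max 1 (max \<bar>fst q\<bar> \<bar>snd q\<bar>)"
    have "(1 + \<bar>fst q\<bar> + \<bar>snd q\<bar>) ^ n \<le> (3 * ?m) ^ n" by (intro power_mono) auto
    also have "\<dots> = 3 ^ n * ?m ^ n" by (simp add: power_mult_distrib)
    also have "?m ^ n \<le> 1 + \<bar>fst q\<bar> ^ n + \<bar>snd q\<bar> ^ n" by (auto simp: max_def)
    finally have "(1 + \<bar>fst q\<bar> + \<bar>snd q\<bar>) ^ n * norm (fourier f q)
      \<le> 3 ^ n * (1 + \<bar>fst q\<bar> ^ n + \<bar>snd q\<bar> ^ n) * norm (fourier f q)"
      by (intro mult_right_mono) auto
    also have "\<dots> = 3 ^ n * (\<bar>fst q\<bar> ^ n * norm (fourier f q) + \<bar>snd q\<bar> ^ n * norm (fourier f q) + norm (fourier f q))"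
      by (simp add: algebra_simps)
    also have "\<dots> \<le> 3 ^ n * (C1 + C2 + C3)"
      using C1[of q] C2[of q] C3[of q] by (intro mult_left_mono add_mono) (auto simp: inner_prod_def)
    finally show ?thesis .
  qed
  have "0 \<le> 3 ^ n * (C1 + C2 + C3)" by (rule order_trans[OF _ *[of 0]]) simp
  with * show ?thesis using that by blast
qed

section \<open>Gaussian wave packets\<close>

text \<open>Spreading the exponential over m + 1 factors rather than m covers m = 0 as well; the
  power m then leaves exp (r m / (m + 1)), which is at most exp r.\<close>

lemma powr_le_exp:
  fixes m r :: real
  assumes "0 \<le> m" "0 \<le> r"
  shows "(1 + r) powr m \<le> (m + 1) powr m * exp r"
proof -
  have "1 + r \<le> (m + 1) * (1 + r / (m + 1))" using assms by (simp add: field_simps)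
  also have "\<dots> \<le> (m + 1) * exp (r / (m + 1))"
    using assms exp_ge_add_one_self[of "r / (m + 1)"] by (intro mult_left_mono) auto
  finally have "(1 + r) powr m \<le> ((m + 1) * exp (r / (m + 1))) powr m"
    using assms by (intro powr_mono2) auto
  also have "\<dots> = (m + 1) powr m * exp (r * m / (m + 1))"
  proof -
    have "exp (r / (m + 1)) powr m = exp (r * m / (m + 1))" by (simp add: powr_def mult.commute)
    then show ?thesis using assms by (simp add: powr_mult)
  qed
  also have "\<dots> \<le> (m + 1) powr m * exp r"
    using assms by (intro mult_left_mono) (auto simp: field_simps)
  finally show ?thesis .
qed

lemma powr_mult_gaussian_bounded:
  fixes m c :: real
  assumes "0 \<le> m" "0 < c"
  obtains B where "0 \<le> B" "\<And>r. 0 \<le> r \<Longrightarrow> (1 + r) powr m * exp (- (c * r\<^sup>2)) \<le> B"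
proof
  show "0 \<le> (m + 1) powr m * exp (1 / (4 * c))" by simp
  fix r :: real assume r: "0 \<le> r"
  \<comment> \<open>Completing the square: r - c r^2 has its maximum 1 / (4 c) at r = 1 / (2
    c).\<close>
  have "0 \<le> c * (r - 1 / (2 * c))\<^sup>2" using assms by simp
  also have "\<dots> = c * r\<^sup>2 - r + 1 / (4 * c)" using assms by (simp add: power2_eq_square field_simps)
  finally have "r - c * r\<^sup>2 \<le> 1 / (4 * c)" by simp
  then have e: "exp r * exp (- (c * r\<^sup>2)) \<le> exp (1 / (4 * c))" by (simp flip: exp_add)
  have "(1 + r) powr m * exp (- (c * r\<^sup>2)) \<le> ((m + 1) powr m * exp r) * exp (- (c * r\<^sup>2))"
    using assms r by (intro mult_right_mono powr_le_exp) auto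
  also have "\<dots> \<le> (m + 1) powr m * exp (1 / (4 * c))"
    unfolding mult.assoc using e by (intro mult_left_mono) auto
  finally show "(1 + r) powr m * exp (- (c * r\<^sup>2)) \<le> (m + 1) powr m * exp (1 / (4 * c))" .
qed

text \<open>Complex polynomials in the two real coordinates, given by generators so that
  differentiability and growth follow by induction. They serve as the factors in front of a fixed
  exponential when wave packets are differentiated.\<close>

inductive polynomial_fun :: "(real \<times> real \<Rightarrow> complex) \<Rightarrow> bool" where
  const: "polynomial_fun (\<lambda>p. c)"
| fst: "polynomial_fun (\<lambda>p. of_real (fst p))"
| snd: "polynomial_fun (\<lambda>p. of_real (snd p))"
| add: "polynomial_fun f \<Longrightarrow> polynomial_fun g \<Longrightarrow> polynomial_fun (\<lambda>p. f p + g p)"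
| mult: "polynomial_fun f \<Longrightarrow> polynomial_fun g \<Longrightarrow> polynomial_fun (\<lambda>p. f p * g p)"

lemma polynomial_fun_deriv:
  assumes "polynomial_fun f"
  shows "\<exists>f'. \<forall>v. polynomial_fun (f' v) \<and> (\<forall>p. (f has_derivative (\<lambda>v. f' v p)) (at p))"
  using assms
proof induction
  case (const c)
  then show ?case by (intro exI[of _ "\<lambda>v p. 0"]) (auto intro: polynomial_fun.const)
next
  case fst
  have "((\<lambda>p. of_real (fst p)) has_derivative (\<lambda>v. complex_of_real (fst v))) (at p)" for p :: "real \<times> real"
    by (auto intro!: derivative_eq_intros)
  then show ?case by (intro exI[of _ "\<lambda>v p. of_real (fst v)"]) (auto intro: polynomial_fun.const)
next
  case snd
  have "((\<lambda>p. of_real (snd p)) has_derivative (\<lambda>v. complex_of_real (snd v))) (at p)" for p :: "real \<times> real"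
    by (auto intro!: derivative_eq_intros)
  then show ?case by (intro exI[of _ "\<lambda>v p. of_real (snd v)"]) (auto intro: polynomial_fun.const)
next
  case (add f g)
  then obtain f' g' where "\<forall>v. polynomial_fun (f' v) \<and> (\<forall>p. (f has_derivative (\<lambda>v. f' v p)) (at p))"
    "\<forall>v. polynomial_fun (g' v) \<and> (\<forall>p. (g has_derivative (\<lambda>v. g' v p)) (at p))" by blast
  then show ?case
    by (intro exI[of _ "\<lambda>v p. f' v p + g' v p"]) (auto intro: polynomial_fun.add has_derivative_add)
next
  case (mult f g)
  then obtain f' g' where "\<forall>v. polynomial_fun (f' v) \<and> (\<forall>p. (f has_derivative (\<lambda>v. f' v p)) (at p))"
    "\<forall>v. polynomial_fun (g' v) \<and> (\<forall>p. (g has_derivative (\<lambda>v. g' v p)) (at p))" by blast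
  then show ?case
    using mult.hyps
    by (intro exI[of _ "\<lambda>v p. f p * g' v p + f' v p * g p"])
      (auto intro!: polynomial_fun.add polynomial_fun.mult has_derivative_mult)
qed

lemma polynomial_fun_growth:
  assumes "polynomial_fun f"
  shows "\<exists>C n. 0 \<le> C \<and> (\<forall>p. norm (f p) \<le> C * (1 + norm p) ^ n)"
  using assms
proof induction
  case (const c)
  then show ?case by (intro exI[of _ "norm c"] exI[of _ 0]) auto
next
  case fst
  have "\<bar>fst p\<bar> \<le> 1 * (1 + norm p) ^ 1" for p :: "real \<times> real"
    using norm_ge_components[of p] by simp
  then show ?case by (intro exI[of _ 1] exI[of _ "1::nat"]) simp
next
  case snd
  have "\<bar>snd p\<bar> \<le> 1 * (1 + norm p) ^ 1" for p :: "real \<times> real"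
    using norm_ge_components[of p] by simp
  then show ?case by (intro exI[of _ 1] exI[of _ "1::nat"]) simp
next
  case (add f g)
  then obtain C n D m where *: "0 \<le> C" "\<And>p. norm (f p) \<le> C * (1 + norm p) ^ n"
    "0 \<le> D" "\<And>p. norm (g p) \<le> D * (1 + norm p) ^ m" by blast
  have "norm (f p + g p) \<le> (C + D) * (1 + norm p) ^ (n + m)" for p
  proof -
    have "norm (f p + g p) \<le> C * (1 + norm p) ^ n + D * (1 + norm p) ^ m"
      using * by (intro order_trans[OF norm_triangle_ineq] add_mono) auto
    also have "\<dots> \<le> C * (1 + norm p) ^ (n + m) + D * (1 + norm p) ^ (n + m)"
      using * by (intro add_mono mult_left_mono power_increasing) auto
    finally show ?thesis by (simp add: algebra_simps)
  qed
  then show ?case using * by (intro exI[of _ "C + D"] exI[of _ "n + m"]) auto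
next
  case (mult f g)
  then obtain C n D m where *: "0 \<le> C" "\<And>p. norm (f p) \<le> C * (1 + norm p) ^ n"
    "0 \<le> D" "\<And>p. norm (g p) \<le> D * (1 + norm p) ^ m" by blast
  have "norm (f p * g p) \<le> (C * D) * (1 + norm p) ^ (n + m)" for p
  proof -
    have "norm (f p * g p) \<le> (C * (1 + norm p) ^ n) * (D * (1 + norm p) ^ m)"
      unfolding norm_mult using * by (intro mult_mono) (auto intro: order_trans[OF norm_ge_zero])
    then show ?thesis by (simp add: algebra_simps power_add)
  qed
  then show ?case using * by (intro exI[of _ "C * D"] exI[of _ "n + m"]) auto
qed

lemma polynomial_times_exp_deriv:
  assumes f: "polynomial_fun f" and Q: "polynomial_fun Q"
  obtains g where "polynomial_fun g"
    "\<And>p. (\<lambda>p. f p * exp (Q p)) differentiable (at p)"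
    "(\<lambda>p. frechet_derivative (\<lambda>p. f p * exp (Q p)) (at p) v) = (\<lambda>p. g p * exp (Q p))"
proof -
  obtain f' where f': "\<And>v. polynomial_fun (f' v)" "\<And>p. (f has_derivative (\<lambda>v. f' v p)) (at p)"
    using polynomial_fun_deriv[OF f] by blast
  obtain Q' where Q': "\<And>v. polynomial_fun (Q' v)" "\<And>p. (Q has_derivative (\<lambda>v. Q' v p)) (at p)"
    using polynomial_fun_deriv[OF Q] by blast
  have e: "((\<lambda>p. exp (Q p)) has_derivative (\<lambda>v. exp (Q p) * Q' v p)) (at p)" for p
  proof -
    have "(exp has_derivative (\<lambda>z. exp (Q p) * z)) (at (Q p))"
      using DERIV_exp[of "Q p"] by (simp add: has_field_derivative_def)
    from has_derivative_compose[OF Q'(2) this] show ?thesis .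
  qed
  have d: "((\<lambda>p. f p * exp (Q p)) has_derivative (\<lambda>v. f p * (exp (Q p) * Q' v p) + f' v p * exp (Q p))) (at p)" for p
    by (rule has_derivative_mult[OF f'(2) e])
  show ?thesis
  proof
    show "polynomial_fun (\<lambda>p. f p * Q' v p + f' v p)"
      by (intro polynomial_fun.add polynomial_fun.mult f f' Q')
    show "(\<lambda>p. f p * exp (Q p)) differentiable (at p)" for p
      unfolding differentiable_def using d by blast
    show "(\<lambda>p. frechet_derivative (\<lambda>p. f p * exp (Q p)) (at p) v) = (\<lambda>p. (f p * Q' v p + f' v p) * exp (Q p))"
      using frechet_derivative_at[OF d, symmetric] by (auto simp: algebra_simps)
  qed
qed

text \<open>For fixed \<open>Q\<close> the products of a polynomial and \<open>exp Q\<close> are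
  closed under differentiation. Every iterated derivative therefore has the same Gaussian factor,
  which beats any polynomial growth.\<close>

lemma schwartz_polynomial_times_exp:
  assumes f: "polynomial_fun f" and Q: "polynomial_fun Q"
    and c: "0 < c" "\<And>p. Re (Q p) \<le> - (c * (norm p)\<^sup>2)"
  shows "schwartz (\<lambda>p. f p * exp (Q p))"
  unfolding schwartz_def
proof (intro allI impI conjI)
  fix vs :: "(real \<times> real) list"
  have "\<exists>g. polynomial_fun g \<and> iterated_deriv vs (\<lambda>p. f p * exp (Q p)) = (\<lambda>p. g p * exp (Q p))"
  proof (induction vs)
    case Nil
    then show ?case using f by auto
  next
    case (Cons v vs)
    then obtain g where g: "polynomial_fun g" "iterated_deriv vs (\<lambda>p. f p * exp (Q p)) = (\<lambda>p. g p * exp (Q p))"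
      by blast
    obtain h where "polynomial_fun h"
      "(\<lambda>p. frechet_derivative (\<lambda>p. g p * exp (Q p)) (at p) v) = (\<lambda>p. h p * exp (Q p))"
      by (rule polynomial_times_exp_deriv[OF g(1) Q])
    then show ?case by (intro exI[of _ h]) (simp add: g(2))
  qed
  then obtain g where g: "polynomial_fun g" "iterated_deriv vs (\<lambda>p. f p * exp (Q p)) = (\<lambda>p. g p * exp (Q p))" by blast
  show "iterated_deriv vs (\<lambda>p. f p * exp (Q p)) differentiable (at p)" for p
    unfolding g by (rule polynomial_times_exp_deriv[OF g(1) Q])
  fix N :: nat
  obtain C n where C: "0 \<le> C" "\<And>p. norm (g p) \<le> C * (1 + norm p) ^ n" using polynomial_fun_growth[OF g(1)] by blast
  obtain B where B: "0 \<le> B" "\<And>r. 0 \<le> r \<Longrightarrow> (1 + r) powr real (N + n) * exp (- (c * r\<^sup>2)) \<le> B"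
    using powr_mult_gaussian_bounded[of "real (N + n)" c] c(1) by auto
  show "bounded (range (\<lambda>p. (1 + norm p) ^ N *\<^sub>R iterated_deriv vs (\<lambda>p. f p * exp (Q p)) p))"
  proof (rule boundedI, elim rangeE, hypsubst)
    fix p :: "real \<times> real"
    have "norm ((1 + norm p) ^ N *\<^sub>R iterated_deriv vs (\<lambda>p. f p * exp (Q p)) p)
      = (1 + norm p) ^ N * (norm (g p) * exp (Re (Q p)))"
      by (simp add: g norm_mult)
    also have "\<dots> \<le> (1 + norm p) ^ N * ((C * (1 + norm p) ^ n) * exp (- (c * (norm p)\<^sup>2)))"
      using C c by (intro mult_left_mono mult_mono) auto
    also have "\<dots> = C * ((1 + norm p) powr real (N + n) * exp (- (c * (norm p)\<^sup>2)))"
      by (simp add: powr_realpow add_pos_nonneg power_add del: of_nat_add)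
    also have "\<dots> \<le> C * B" using B C by (intro mult_left_mono) auto
    finally show "norm ((1 + norm p) ^ N *\<^sub>R iterated_deriv vs (\<lambda>p. f p * exp (Q p)) p) \<le> C * B" .
  qed
qed

text \<open>\<open>L\<close> and \<open>N\<close> are the widths on the frequency side, so the
  inverse widths in space-time. The shear x - r t matches the modulation \<tau> + r \<xi>: the
  transform is centred where this equals \<open>u\<close> and \<xi> equals \<open>k\<close>.\<close>

definition gauss :: "real \<Rightarrow> real \<Rightarrow> real \<Rightarrow> real \<Rightarrow> real \<Rightarrow> real \<times> real \<Rightarrow> complex" where
  "gauss L N r u k p = exp (- of_real ((L * fst p)\<^sup>2 / 2 + (N * (snd p - r * fst p))\<^sup>2 / 2)
     + \<i> * of_real (u * fst p + k * (snd p - r * fst p)))"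

lemma gauss_split: "gauss L N r u k (t, x) =
  (cis (u * t) * of_real (exp (- ((L * t)\<^sup>2 / 2)))) * (cis (k * (x - r * t)) * of_real (exp (- ((N * (x - r * t))\<^sup>2 / 2))))"
  unfolding gauss_def cis_conv_exp exp_of_real[symmetric] exp_add[symmetric]
  by (simp add: algebra_simps)

lemma schwartz_gauss:
  assumes "0 < L" "0 < N"
  shows "schwartz (gauss L N r u k)"
proof -
  define Q :: "real \<times> real \<Rightarrow> complex" where "Q p = of_real (- L\<^sup>2 / 2) * (of_real (fst p) * of_real (fst p))
    + of_real (- N\<^sup>2 / 2) * ((of_real (snd p) + of_real (- r) * of_real (fst p)) * (of_real (snd p) + of_real (- r) * of_real (fst p)))
    + (\<i> * of_real u) * of_real (fst p) + (\<i> * of_real k) * (of_real (snd p) + of_real (- r) * of_real (fst p))" for p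
  have Q: "polynomial_fun Q" unfolding Q_def[abs_def] by (intro polynomial_fun.intros)
  have QQ: "Q p = - of_real ((L * fst p)\<^sup>2 / 2 + (N * (snd p - r * fst p))\<^sup>2 / 2)
     + \<i> * of_real (u * fst p + k * (snd p - r * fst p))" for p
    by (simp add: Q_def power2_eq_square field_simps)
  define m where "m = min (L\<^sup>2) (N\<^sup>2)"
  have m: "0 < m" "m \<le> L\<^sup>2" "m \<le> N\<^sup>2" using assms by (auto simp: m_def)
  \<comment> \<open>One factor 2 is the 1/2 in the exponent; the remaining 2 (1 + r^2) bounds the
    squared norm of (t, y + r t) in terms of t^2 + y^2, that is, the cost of undoing the
    shear.\<close>
  define c where "c = m / (4 * (1 + r\<^sup>2))"
  have rp: "0 < 1 + r\<^sup>2" by (simp add: add_pos_nonneg)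
  have c: "0 < c" using m rp by (simp add: c_def)
  have "Re (Q p) \<le> - (c * (norm p)\<^sup>2)" for p
  proof -
    define t y where "t = fst p" and "y = snd p - r * fst p"
    have x: "snd p = y + r * t" by (simp add: t_def y_def)
    have "(norm p)\<^sup>2 = t\<^sup>2 + (y + r * t)\<^sup>2" unfolding x[symmetric] by (simp add: norm_prod_def t_def)
    also have "\<dots> \<le> t\<^sup>2 + (2 * y\<^sup>2 + 2 * (r * t)\<^sup>2)"
      using sum_squares_ge_zero[of "y - r * t" 0] by (simp add: power2_eq_square algebra_simps)
    also have "\<dots> \<le> 2 * (1 + r\<^sup>2) * (t\<^sup>2 + y\<^sup>2)"
      by (simp add: power_mult_distrib algebra_simps)
    finally have "c * (norm p)\<^sup>2 \<le> c * (2 * (1 + r\<^sup>2) * (t\<^sup>2 + y\<^sup>2))" using c by (intro mult_left_mono) auto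
    also have "\<dots> = m * (t\<^sup>2 + y\<^sup>2) / 2" using rp by (simp add: c_def field_simps)
    also have "\<dots> = (m * t\<^sup>2 + m * y\<^sup>2) / 2" by (simp add: algebra_simps)
    also have "\<dots> \<le> (L\<^sup>2 * t\<^sup>2 + N\<^sup>2 * y\<^sup>2) / 2"
      using m by (intro divide_right_mono add_mono mult_right_mono) auto
    finally show ?thesis by (simp add: QQ t_def y_def power_mult_distrib)
  qed
  from schwartz_polynomial_times_exp[OF polynomial_fun.const[of 1] Q c this]
  have "schwartz (\<lambda>p. exp (Q p))" by simp
  then show ?thesis unfolding QQ gauss_def[abs_def] .
qed

lemma gauss_measurable [measurable]: "gauss L N r u k \<in> borel_measurable borel"
  unfolding gauss_def[abs_def] by measurable

text \<open>After the scaling x = L t the integral is the characteristic function of the standard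
  normal distribution.\<close>

lemma fourier_gauss_real:
  assumes L: "0 < L"
  shows "(LINT t|lborel. cis (- (t * y)) * complex_of_real (exp (- ((L * t)\<^sup>2 / 2))))
    = of_real (sqrt (2 * pi) / L * exp (- (y / L)\<^sup>2 / 2))"
proof -
  let ?g = "\<lambda>x. std_normal_density x *\<^sub>R cis (- (y / L) * x)"
  have "complex_of_real (exp (- (- (y / L))\<^sup>2 / 2)) = char std_normal_distribution (- (y / L))"
    by (simp only: char_std_normal_distribution)
  also have "\<dots> = (LINT x|lborel. ?g x)"
    unfolding char_def by (subst integral_density) (auto simp: cis_conv_exp)
  also have "\<dots> = L *\<^sub>R (LINT t|lborel. ?g (0 + L * t))"
    using L lborel_integral_real_affine[of L ?g 0] by simp
  also have "(\<lambda>t. ?g (0 + L * t)) = (\<lambda>t. of_real (1 / sqrt (2 * pi)) * (cis (- (t * y)) * of_real (exp (- ((L * t)\<^sup>2 / 2)))))"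
    using L by (auto simp: std_normal_density_def scaleR_conv_of_real mult_ac)
  also have "(LINT t|lborel. of_real (1 / sqrt (2 * pi)) * (cis (- (t * y)) * complex_of_real (exp (- ((L * t)\<^sup>2 / 2)))))
    = of_real (1 / sqrt (2 * pi)) * (LINT t|lborel. cis (- (t * y)) * of_real (exp (- ((L * t)\<^sup>2 / 2))))"
    by simp
  finally show ?thesis using L by (simp add: scaleR_conv_of_real field_simps)
qed

lemma integral_plane_iterated:
  fixes f :: "real \<times> real \<Rightarrow> 'b::{banach, second_countable_topology}"
  assumes "integrable lborel f"
  shows "(LINT p|lborel. f p) = (LINT t|lborel. LINT x|lborel. f (t, x))"
  using lborel_pair.integral_fst'[of f] assms by (simp add: lborel_prod)

text \<open>The substitution x = r t + y undoes the shear, so that phases and Gaussians separate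
  into a factor in t and a factor in y. The result is real and positive, which later makes its
  integral available through inversion.\<close>

lemma fourier_gauss:
  assumes L: "0 < L" and N: "0 < N"
  shows "fourier (gauss L N r u k) (\<tau>, \<xi>) =
    of_real (2 * pi / (L * N) * exp (- ((\<tau> + r * \<xi> - u) / L)\<^sup>2 / 2) * exp (- ((\<xi> - k) / N)\<^sup>2 / 2))"
proof -
  let ?A = "\<lambda>t. cis (- (t * (\<tau> + r * \<xi> - u))) * complex_of_real (exp (- ((L * t)\<^sup>2 / 2)))"
  let ?B = "\<lambda>y. cis (- (y * (\<xi> - k))) * complex_of_real (exp (- ((N * y)\<^sup>2 / 2)))"
  have int: "integrable lborel (\<lambda>p. cis (- (p \<bullet> (\<tau>, \<xi>))) * gauss L N r u k p)"
    by (intro integrable_cis_mult schwartz_integrable schwartz_gauss L N) measurable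
  have "fourier (gauss L N r u k) (\<tau>, \<xi>) = (LINT t|lborel. LINT x|lborel. cis (- (t * \<tau> + x * \<xi>)) * gauss L N r u k (t, x))"
    unfolding fourier_def by (subst integral_plane_iterated[OF int]) simp
  also have "\<dots> = (LINT t|lborel. ?A t * (LINT y|lborel. ?B y))"
  proof (rule Bochner_Integration.integral_cong)
    fix t :: real
    have m: "(\<lambda>x. cis (- (t * \<tau> + x * \<xi>)) * gauss L N r u k (t, x)) \<in> borel_measurable borel"
      by measurable
    have c: "cis (- (t * \<tau> + (r * t + y) * \<xi>)) * (cis (u * t) * cis (k * y)) = cis (- (t * (\<tau> + r * \<xi> - u))) * cis (- (y * (\<xi> - k)))" for y
      by (simp add: cis_mult algebra_simps)
    have "cis (- (t * \<tau> + (r * t + y) * \<xi>)) * gauss L N r u k (t, r * t + y) = ?A t * ?B y" for y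
    proof -
      have "cis (- (t * \<tau> + (r * t + y) * \<xi>)) * gauss L N r u k (t, r * t + y)
        = (cis (- (t * \<tau> + (r * t + y) * \<xi>)) * (cis (u * t) * cis (k * y)))
          * (complex_of_real (exp (- ((L * t)\<^sup>2 / 2))) * complex_of_real (exp (- ((N * y)\<^sup>2 / 2))))"
        by (simp add: gauss_split mult_ac)
      also have "\<dots> = ?A t * ?B y" unfolding c by (simp only: mult_ac)
      finally show ?thesis .
    qed
    then have "(LINT x|lborel. cis (- (t * \<tau> + x * \<xi>)) * gauss L N r u k (t, x)) = (LINT y|lborel. ?A t * ?B y)"
      using integral_lborel_affine[OF m, of 1 "r * t"] by simp
    then show "(LINT x|lborel. cis (- (t * \<tau> + x * \<xi>)) * gauss L N r u k (t, x)) = ?A t * (LINT y|lborel. ?B y)"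
      by simp
  qed simp
  also have "\<dots> = (LINT t|lborel. ?A t) * (LINT y|lborel. ?B y)" by simp
  also have "\<dots> = of_real (sqrt (2 * pi) / L * exp (- ((\<tau> + r * \<xi> - u) / L)\<^sup>2 / 2)) * of_real (sqrt (2 * pi) / N * exp (- ((\<xi> - k) / N)\<^sup>2 / 2))"
    by (simp only: fourier_gauss_real L N)
  also have "\<dots> = of_real ((sqrt (2 * pi) * sqrt (2 * pi)) / (L * N) * exp (- ((\<tau> + r * \<xi> - u) / L)\<^sup>2 / 2) * exp (- ((\<xi> - k) / N)\<^sup>2 / 2))"
    by (simp only: of_real_mult[symmetric] times_divide_times_eq[symmetric] mult_ac)
  finally show ?thesis by simp
qed

section \<open>Fourier inversion and the trilinear form in frequency space\<close>

lemma integrable_pair_bound: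
  fixes k :: "(real \<times> real) \<times> (real \<times> real) \<Rightarrow> complex" and f g :: "real \<times> real \<Rightarrow> complex"
  assumes [measurable]: "k \<in> borel_measurable (borel \<Otimes>\<^sub>M borel)"
    and f: "integrable lborel f" and g: "integrable lborel g"
    and b: "\<And>p q. norm (k (p, q)) \<le> norm (f p) * norm (g q)"
  shows "integrable (lborel \<Otimes>\<^sub>M lborel) k"
proof (rule integrableI_bounded)
  have [measurable]: "f \<in> borel_measurable borel" "g \<in> borel_measurable borel"
    using f g by auto
  have "(\<integral>\<^sup>+z. ennreal (norm (k z)) \<partial>(lborel \<Otimes>\<^sub>M lborel)) = (\<integral>\<^sup>+p. \<integral>\<^sup>+q. ennreal (norm (k (p, q))) \<partial>lborel \<partial>lborel)"
    by (rule lborel.nn_integral_fst[symmetric]) measurable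
  also have "\<dots> \<le> (\<integral>\<^sup>+p. \<integral>\<^sup>+q. ennreal (norm (f p)) * ennreal (norm (g q)) \<partial>lborel \<partial>lborel)"
    using b by (intro nn_integral_mono) (simp add: ennreal_leI flip: ennreal_mult)
  also have "\<dots> = (\<integral>\<^sup>+p. ennreal (norm (f p)) \<partial>lborel) * (\<integral>\<^sup>+q. ennreal (norm (g q)) \<partial>lborel)"
    by (simp add: nn_integral_cmult nn_integral_multc)
  also have "\<dots> < \<infinity>" using f g by (simp add: integrable_iff_bounded ennreal_mult_less_top)
  finally show "(\<integral>\<^sup>+z. ennreal (norm (k z)) \<partial>(lborel \<Otimes>\<^sub>M lborel)) < \<infinity>" .
qed measurable

lemma integral_plane_dilate:
  fixes f :: "real \<times> real \<Rightarrow> complex"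
  assumes [measurable]: "f \<in> borel_measurable borel" and c: "0 < c"
  shows "(LINT x|lborel. f x) = of_real (c\<^sup>2) * (LINT x|lborel. f (t + c *\<^sub>R x))"
proof -
  have "(LINT x|lborel. f x) = (LINT x|density (distr lborel borel (\<lambda>x. t + c *\<^sub>R x)) (\<lambda>_. \<bar>c\<bar>^DIM(real \<times> real)). f x)"
    using lborel_affine[of c t] c by simp
  also have "\<dots> = (LINT x|lborel. of_real (c\<^sup>2) * f (t + c *\<^sub>R x))"
    by (simp add: integral_density integral_distr scaleR_conv_of_real power2_eq_square)
  finally show ?thesis by simp
qed

text \<open>A cut-off for the inversion integral, tending to 1 as \<open>d\<close> tends to
  0.\<close>

definition centred_gauss :: "real \<Rightarrow> real \<times> real \<Rightarrow> complex" where
  "centred_gauss d = gauss d d 0 0 0"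

lemma centred_gauss_eq: "centred_gauss d p = of_real (exp (- ((d * norm p)\<^sup>2 / 2)))"
  by (simp add: centred_gauss_def gauss_def norm_prod_def power_mult_distrib exp_of_real[symmetric] add_divide_distrib algebra_simps)

lemma fourier_centred_gauss:
  assumes "0 < d"
  shows "fourier (centred_gauss d) q = of_real (2 * pi / d\<^sup>2) * centred_gauss (1 / d) q"
proof -
  have "fourier (centred_gauss d) (fst q, snd q) = of_real (2 * pi / d\<^sup>2) * of_real (exp (- ((fst q) / d)\<^sup>2 / 2) * exp (- ((snd q) / d)\<^sup>2 / 2))"
    unfolding centred_gauss_def fourier_gauss[OF assms assms] by (simp add: power2_eq_square)
  also have "exp (- ((fst q) / d)\<^sup>2 / 2) * exp (- ((snd q) / d)\<^sup>2 / 2) = exp (- ((1 / d * norm q)\<^sup>2 / 2))"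
    by (simp add: norm_prod_def power_divide add_divide_distrib flip: exp_add)
  finally show ?thesis by (simp only: prod.collapse centred_gauss_eq[of "1 / d"])
qed

lemma integrable_centred_gauss: "0 < d \<Longrightarrow> integrable lborel (centred_gauss d)"
  unfolding centred_gauss_def by (intro schwartz_integrable schwartz_gauss)

lemma centred_gauss_measurable [measurable]: "centred_gauss d \<in> borel_measurable borel"
  unfolding centred_gauss_def by measurable

lemma norm_centred_gauss_le: "norm (centred_gauss d p) \<le> 1"
  by (simp add: centred_gauss_eq)

lemma integral_centred_gauss: "(LINT p|lborel. centred_gauss 1 p) = of_real (2 * pi)"
  using fourier_centred_gauss[of 1 0] by (simp add: fourier_def centred_gauss_eq[of _ 0])

text \<open>The cut-off makes the double integral absolutely convergent, so the order may be
  exchanged. The transform of the cut-off is a Gaussian of width d around x, and y = x + d z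
  rescales it to unit width.\<close>

lemma gauss_smoothed_inversion:
  fixes f :: "real \<times> real \<Rightarrow> complex"
  assumes f: "integrable lborel f" and d: "0 < d"
  shows "(LINT q|lborel. centred_gauss d q * (cis (x \<bullet> q) * fourier f q))
    = of_real (2 * pi) * (LINT z|lborel. f (x + d *\<^sub>R z) * centred_gauss 1 z)"
proof -
  have [measurable]: "f \<in> borel_measurable borel" using f by auto
  let ?k = "\<lambda>q y. centred_gauss d q * (cis ((x - y) \<bullet> q) * f y)"
  have int: "integrable (lborel \<Otimes>\<^sub>M lborel) (case_prod ?k)"
  proof (rule integrable_pair_bound[OF _ integrable_centred_gauss[OF d] f])
    show "norm (case (q, y) of (q, y) \<Rightarrow> ?k q y) \<le> norm (centred_gauss d q) * norm (f y)" for q y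
      by (simp add: norm_mult)
  qed measurable
  have "(LINT q|lborel. centred_gauss d q * (cis (x \<bullet> q) * fourier f q)) = (LINT q|lborel. LINT y|lborel. ?k q y)"
  proof (rule Bochner_Integration.integral_cong)
    fix q
    have c: "cis ((x - y) \<bullet> q) = cis (x \<bullet> q) * cis (- (y \<bullet> q))" for y
      by (simp add: cis_mult inner_diff_left)
    have "centred_gauss d q * (cis (x \<bullet> q) * fourier f q) = (LINT y|lborel. (centred_gauss d q * cis (x \<bullet> q)) * (cis (- (y \<bullet> q)) * f y))"
      unfolding fourier_def by simp
    also have "\<dots> = (LINT y|lborel. ?k q y)"
      by (intro Bochner_Integration.integral_cong) (simp_all add: c mult_ac)
    finally show "centred_gauss d q * (cis (x \<bullet> q) * fourier f q) = (LINT y|lborel. ?k q y)" .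
  qed simp
  also have "\<dots> = (LINT y|lborel. LINT q|lborel. ?k q y)"
    using lborel_pair.Fubini_integral[OF int] by simp
  also have "\<dots> = (LINT y|lborel. f y * fourier (centred_gauss d) (y - x))"
  proof (rule Bochner_Integration.integral_cong)
    fix y
    have "(LINT q|lborel. ?k q y) = (LINT q|lborel. f y * (cis (- (q \<bullet> (y - x))) * centred_gauss d q))"
      by (intro Bochner_Integration.integral_cong) (simp_all add: inner_diff_left inner_diff_right inner_commute mult_ac)
    then show "(LINT q|lborel. ?k q y) = f y * fourier (centred_gauss d) (y - x)"
      unfolding fourier_def by simp
  qed simp
  also have "\<dots> = of_real (d\<^sup>2) * (LINT z|lborel. f (x + d *\<^sub>R z) * fourier (centred_gauss d) (x + d *\<^sub>R z - x))"
    by (intro integral_plane_dilate d) measurable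
  also have "\<dots> = of_real (d\<^sup>2) * (LINT z|lborel. of_real (2 * pi / d\<^sup>2) * (f (x + d *\<^sub>R z) * centred_gauss 1 z))"
    using d by (simp add: fourier_centred_gauss centred_gauss_eq mult_ac)
  also have "\<dots> = of_real (2 * pi) * (LINT z|lborel. f (x + d *\<^sub>R z) * centred_gauss 1 z)"
    using d by simp
  finally show ?thesis .
qed

text \<open>Both sides of the smoothed formula pass to the limit of vanishing cut-off: the left one
  is dominated by the integrable transform, the right one by the bound \<open>B\<close>, with
  continuity giving the limit \<open>f x\<close>. One factor 2 pi is already present, the other is
  the mass of the unit Gaussian.\<close>

lemma fourier_inversion:
  fixes f :: "real \<times> real \<Rightarrow> complex"
  assumes f: "integrable lborel f" and f': "integrable lborel (fourier f)"
    and cont: "continuous_on UNIV f" and bdd: "\<And>p. norm (f p) \<le> B"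
  shows "(LINT q|lborel. cis (x \<bullet> q) * fourier f q) = of_real ((2 * pi)\<^sup>2) * f x"
proof -
  have [measurable]: "f \<in> borel_measurable borel" "fourier f \<in> borel_measurable borel" using f f' by auto
  define h where "h n = inverse (real (Suc n))" for n
  have h: "h \<longlonglongrightarrow> 0" "\<And>n. 0 < h n"
    unfolding h_def using LIMSEQ_inverse_real_of_nat by auto
  have l1: "(\<lambda>n. LINT q|lborel. centred_gauss (h n) q * (cis (x \<bullet> q) * fourier f q))
    \<longlonglongrightarrow> (LINT q|lborel. cis (x \<bullet> q) * fourier f q)"
  proof (rule integral_dominated_convergence[where w = "\<lambda>q. norm (fourier f q)"])
    have "(\<lambda>n. centred_gauss (h n) q * (cis (x \<bullet> q) * fourier f q)) \<longlonglongrightarrow> of_real (exp (- ((0 * norm q)\<^sup>2 / 2))) * (cis (x \<bullet> q) * fourier f q)" for q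
      unfolding centred_gauss_eq by (intro tendsto_intros h) simp_all
    then show "AE q in lborel. (\<lambda>n. centred_gauss (h n) q * (cis (x \<bullet> q) * fourier f q)) \<longlonglongrightarrow> cis (x \<bullet> q) * fourier f q"
      by simp
    show "AE q in lborel. norm (centred_gauss (h n) q * (cis (x \<bullet> q) * fourier f q)) \<le> norm (fourier f q)" for n
      using norm_centred_gauss_le by (auto simp: norm_mult mult_left_le_one_le)
  qed (use f' in auto)
  have l2: "(\<lambda>n. LINT z|lborel. f (x + h n *\<^sub>R z) * centred_gauss 1 z) \<longlonglongrightarrow> (LINT z|lborel. f x * centred_gauss 1 z)"
  proof (rule integral_dominated_convergence[where w = "\<lambda>z. B * norm (centred_gauss 1 z)"])
    have "(\<lambda>n. f (x + h n *\<^sub>R z)) \<longlonglongrightarrow> f (x + 0 *\<^sub>R z)" for z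
      by (intro continuous_on_tendsto_compose[OF cont] tendsto_intros h) auto
    then show "AE z in lborel. (\<lambda>n. f (x + h n *\<^sub>R z) * centred_gauss 1 z) \<longlonglongrightarrow> f x * centred_gauss 1 z"
      by (auto intro!: tendsto_intros)
    show "AE z in lborel. norm (f (x + h n *\<^sub>R z) * centred_gauss 1 z) \<le> B * norm (centred_gauss 1 z)" for n
      by (intro always_eventually allI) (simp add: norm_mult mult_right_mono bdd)
  qed (use integrable_centred_gauss[of 1] in auto)
  have "(LINT q|lborel. cis (x \<bullet> q) * fourier f q) = of_real (2 * pi) * (LINT z|lborel. f x * centred_gauss 1 z)"
    using l1 unfolding gauss_smoothed_inversion[OF f h(2)]
    by (rule LIMSEQ_unique) (intro tendsto_mult tendsto_const l2)
  also have "\<dots> = of_real (2 * pi) * (f x * of_real (2 * pi))"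
    by (simp add: integral_centred_gauss)
  finally show ?thesis by (simp add: power2_eq_square mult_ac)
qed

lemma schwartz_fourier_integrable:
  fixes f :: "real \<times> real \<Rightarrow> complex"
  assumes f: "schwartz f"
  shows "integrable lborel (fourier f)"
proof -
  obtain C where C: "\<And>q. (1 + (\<bar>fst q\<bar> + \<bar>snd q\<bar>)) ^ 4 * norm (fourier f q) \<le> C"
    using fourier_decay[OF f, of 4] by (metis add.assoc)
  show ?thesis
    by (intro integrable_by_plane_decay[of _ C] fourier_measurable schwartz_measurable f le_plane_decay[OF C]) auto
qed

lemma schwartz_bounded:
  fixes f :: "'a::euclidean_space \<Rightarrow> complex"
  assumes "schwartz f"
  obtains B where "\<And>p. norm (f p) \<le> B"
  using schwartz_decay[OF assms, of 0] by auto

text \<open>Parseval's identity in which only \<open>f\<close> is inverted. Hence \<open>h\<close>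
  may later be a product of two Schwartz functions, or one times a character, with integrability as
  the only thing to check.\<close>

lemma schwartz_pairing:
  fixes f h :: "real \<times> real \<Rightarrow> complex"
  assumes f: "schwartz f" and h: "integrable lborel h"
  shows "of_real ((2 * pi)\<^sup>2) * (LINT x|lborel. f x * h x) = (LINT p|lborel. fourier f p * fourier h (- p))"
proof -
  have [measurable]: "f \<in> borel_measurable borel" "h \<in> borel_measurable borel" using f h schwartz_measurable by auto
  obtain B where B: "\<And>p. norm (f p) \<le> B" using schwartz_bounded[OF f] by blast
  let ?k = "\<lambda>x p. cis (x \<bullet> p) * fourier f p * h x"
  have int: "integrable (lborel \<Otimes>\<^sub>M lborel) (case_prod ?k)"
  proof (rule integrable_pair_bound[OF _ h schwartz_fourier_integrable[OF f]])
    show "norm (case (x, p) of (x, p) \<Rightarrow> ?k x p) \<le> norm (h x) * norm (fourier f p)" for x p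
      by (simp add: norm_mult)
  qed measurable
  note inv = fourier_inversion[OF schwartz_integrable[OF f] schwartz_fourier_integrable[OF f] schwartz_continuous[OF f] B, symmetric]
  have "of_real ((2 * pi)\<^sup>2) * (LINT x|lborel. f x * h x) = (LINT x|lborel. (of_real ((2 * pi)\<^sup>2) * f x) * h x)"
    unfolding mult.assoc integral_mult_right_zero ..
  also have "\<dots> = (LINT x|lborel. LINT p|lborel. ?k x p)"
    unfolding inv by simp
  also have "\<dots> = (LINT p|lborel. LINT x|lborel. ?k x p)"
    using lborel_pair.Fubini_integral[OF int] by simp
  also have "\<dots> = (LINT p|lborel. fourier f p * fourier h (- p))"
  proof (rule Bochner_Integration.integral_cong)
    fix p
    have "(LINT x|lborel. ?k x p) = (LINT x|lborel. fourier f p * (cis (- (x \<bullet> - p)) * h x))"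
      by (intro Bochner_Integration.integral_cong) (simp_all add: mult_ac)
    then show "(LINT x|lborel. ?k x p) = fourier f p * fourier h (- p)"
      unfolding fourier_def by simp
  qed simp
  finally show ?thesis .
qed

text \<open>In the case without integrability the Bochner integral has its default value 0.\<close>

lemma ennreal_norm_integral_le:
  fixes f :: "'a \<Rightarrow> 'b::{banach, second_countable_topology}"
  shows "ennreal (norm (LINT x|M. f x)) \<le> (\<integral>\<^sup>+x. ennreal (norm (f x)) \<partial>M)"
proof (cases "integrable M f")
  case True
  then show ?thesis by (rule integral_norm_bound_ennreal)
next
  case False
  then show ?thesis by (simp add: not_integrable_integral_eq)
qed

lemma schwartz_trilinear_bound:
  fixes f g h :: "real \<times> real \<Rightarrow> complex"
  assumes f: "schwartz f" and g: "schwartz g" and h: "schwartz h"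
  shows "ennreal (norm (LINT x|lborel. f x * g x * h x))
    \<le> (\<integral>\<^sup>+p. \<integral>\<^sup>+q. ennreal (norm (fourier f p)) * ennreal (norm (fourier g q)) * ennreal (norm (fourier h (- p - q))) \<partial>lborel \<partial>lborel)"
proof -
  have [measurable]: "f \<in> borel_measurable borel" "g \<in> borel_measurable borel" "h \<in> borel_measurable borel"
    using f g h schwartz_measurable by auto
  \<comment> \<open>The normalising factor of Parseval's identity is at least 1 and is simply
    dropped.\<close>
  have pi: "1 \<le> (2 * pi)\<^sup>2" using pi_ge_two by (intro one_le_power) linarith
  have pairing: "ennreal (norm (LINT x|lborel. f x * h x)) \<le> (\<integral>\<^sup>+p. ennreal (norm (fourier f p)) * ennreal (norm (fourier h (- p))) \<partial>lborel)"
    if "schwartz f" "integrable lborel h" for f h :: "real \<times> real \<Rightarrow> complex"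
  proof -
    have "norm (LINT x|lborel. f x * h x) \<le> (2 * pi)\<^sup>2 * norm (LINT x|lborel. f x * h x)"
      using mult_right_mono[OF pi, of "norm (LINT x|lborel. f x * h x)"] by simp
    also have "\<dots> = norm (of_real ((2 * pi)\<^sup>2) * (LINT x|lborel. f x * h x))"
      by (simp add: norm_mult norm_power)
    also have "\<dots> = norm (LINT p|lborel. fourier f p * fourier h (- p))"
      by (simp only: schwartz_pairing[OF that])
    finally have "ennreal (norm (LINT x|lborel. f x * h x)) \<le> ennreal (norm (LINT p|lborel. fourier f p * fourier h (- p)))"
      by (rule ennreal_leI)
    also have "\<dots> \<le> (\<integral>\<^sup>+p. ennreal (norm (fourier f p * fourier h (- p))) \<partial>lborel)"
      by (rule ennreal_norm_integral_le)
    finally show ?thesis by (simp add: norm_mult ennreal_mult)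
  qed
  obtain B where B: "\<And>p. norm (g p) \<le> B" using schwartz_bounded[OF g] by blast
  have gh: "integrable lborel (\<lambda>x. g x * h x)"
    by (rule Bochner_Integration.integrable_bound[of lborel "\<lambda>x. B * norm (h x)"])
      (use schwartz_integrable[OF h] order_trans[OF B abs_ge_self] in \<open>auto simp: norm_mult abs_mult intro!: mult_right_mono\<close>)
  have "ennreal (norm (LINT x|lborel. f x * g x * h x)) = ennreal (norm (LINT x|lborel. f x * (g x * h x)))"
    by (simp add: mult.assoc)
  also have "\<dots> \<le> (\<integral>\<^sup>+p. ennreal (norm (fourier f p)) * ennreal (norm (fourier (\<lambda>x. g x * h x) (- p))) \<partial>lborel)"
    by (rule pairing[OF f gh])
  also have "\<dots> \<le> (\<integral>\<^sup>+p. ennreal (norm (fourier f p)) * (\<integral>\<^sup>+q. ennreal (norm (fourier g q)) * ennreal (norm (fourier h (- p - q))) \<partial>lborel) \<partial>lborel)"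
  proof (intro nn_integral_mono mult_left_mono)
    fix p :: "real \<times> real"
    \<comment> \<open>The character left by the first transform is given to \<open>h\<close>, where
      it shifts the frequency to \<open>- p - q\<close>.\<close>
    have e: "fourier (\<lambda>x. cis (x \<bullet> p) * h x) (- q) = fourier h (- p - q)" for q
      unfolding fourier_def
      by (intro Bochner_Integration.integral_cong) (simp_all add: mult.assoc[symmetric] cis_mult inner_diff_right add.commute)
    have "fourier (\<lambda>x. g x * h x) (- p) = (LINT x|lborel. g x * (cis (x \<bullet> p) * h x))"
      unfolding fourier_def by (intro Bochner_Integration.integral_cong) (simp_all add: mult_ac)
    then show "ennreal (norm (fourier (\<lambda>x. g x * h x) (- p))) \<le> (\<integral>\<^sup>+q. ennreal (norm (fourier g q)) * ennreal (norm (fourier h (- p - q))) \<partial>lborel)"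
      using pairing[OF g integrable_cis_mult[OF schwartz_integrable[OF h], of "\<lambda>x. x \<bullet> p"]] by (simp add: e)
  qed simp
  also have "\<dots> = (\<integral>\<^sup>+p. \<integral>\<^sup>+q. ennreal (norm (fourier f p)) * ennreal (norm (fourier g q)) * ennreal (norm (fourier h (- p - q))) \<partial>lborel \<partial>lborel)"
    by (simp add: nn_integral_cmult[symmetric] mult.assoc)
  finally show ?thesis .
qed

section \<open>The X norms as weighted L2 norms\<close>

lemma jbracket_powr_le: "jbracket y powr b \<le> (1 + \<bar>y\<bar>) powr \<bar>b\<bar>"
proof -
  have "jbracket y powr b \<le> jbracket y powr \<bar>b\<bar>"
    using jbracket_ge_1 by (intro powr_mono) auto
  also have "\<dots> \<le> (1 + \<bar>y\<bar>) powr \<bar>b\<bar>" by (intro powr_mono2) (auto simp: jbracket_le)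
  finally show ?thesis .
qed

definition X_weighted :: "real \<Rightarrow> real \<Rightarrow> real \<Rightarrow> (real \<times> real \<Rightarrow> complex) \<Rightarrow> real \<times> real \<Rightarrow> real" where
  "X_weighted \<sigma> s b \<psi> p = jbracket (fst p + \<sigma> * snd p) powr b * jbracket (snd p) powr s * norm (fourier \<psi> p)"

lemma X_weighted_measurable [measurable]:
  assumes [measurable]: "\<psi> \<in> borel_measurable borel"
  shows "X_weighted \<sigma> s b \<psi> \<in> borel_measurable borel"
  unfolding X_weighted_def[abs_def] by measurable

lemma X_weighted_nonneg: "0 \<le> X_weighted \<sigma> s b \<psi> p"
  by (simp add: X_weighted_def)

lemma X_norm_X_weighted: "X_norm \<sigma> s b \<psi> = sqrt (LINT p|lborel. (X_weighted \<sigma> s b \<psi> p)\<^sup>2)"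
  by (simp add: X_norm_def X_weighted_def case_prod_beta')

lemma integrable_X_weighted:
  assumes \<psi>: "schwartz \<psi>" and \<sigma>: "\<bar>\<sigma>\<bar> = 1"
  shows "integrable lborel (\<lambda>p. (X_weighted \<sigma> s b \<psi> p)\<^sup>2)"
proof -
  have [measurable]: "\<psi> \<in> borel_measurable borel" using \<psi> schwartz_measurable by auto
  \<comment> \<open>The weights grow at most with order |b| + |s|. Two further powers become four
    after squaring, as \<open>plane_decay\<close> requires.\<close>
  define n where "n = nat \<lceil>\<bar>b\<bar> + \<bar>s\<bar>\<rceil> + 2"
  have n: "2 + \<bar>b\<bar> + \<bar>s\<bar> \<le> real n" unfolding n_def using real_nat_ceiling_ge[of "\<bar>b\<bar> + \<bar>s\<bar>"] by simp
  obtain C where C: "0 \<le> C" "\<And>q. (1 + \<bar>fst q\<bar> + \<bar>snd q\<bar>) ^ n * norm (fourier \<psi> q) \<le> C"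
    using fourier_decay[OF \<psi>] by metis
  have b: "(1 + (\<bar>fst p\<bar> + \<bar>snd p\<bar>)) ^ 4 * norm ((X_weighted \<sigma> s b \<psi> p)\<^sup>2) \<le> C\<^sup>2" for p
  proof -
    let ?r = "1 + \<bar>fst p\<bar> + \<bar>snd p\<bar>"
    have a: "\<bar>fst p + \<sigma> * snd p\<bar> \<le> \<bar>fst p\<bar> + \<bar>snd p\<bar>"
      using abs_triangle_ineq[of "fst p" "\<sigma> * snd p"] \<sigma> by (simp add: abs_mult)
    have "jbracket (fst p + \<sigma> * snd p) powr b \<le> ?r powr \<bar>b\<bar>"
      using a by (intro order_trans[OF jbracket_powr_le] powr_mono2) auto
    moreover have "jbracket (snd p) powr s \<le> ?r powr \<bar>s\<bar>"
      by (intro order_trans[OF jbracket_powr_le] powr_mono2) auto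
    ultimately have "X_weighted \<sigma> s b \<psi> p \<le> ?r powr \<bar>b\<bar> * ?r powr \<bar>s\<bar> * norm (fourier \<psi> p)"
      unfolding X_weighted_def by (intro mult_right_mono mult_mono) auto
    then have "?r\<^sup>2 * X_weighted \<sigma> s b \<psi> p \<le> ?r\<^sup>2 * (?r powr \<bar>b\<bar> * ?r powr \<bar>s\<bar> * norm (fourier \<psi> p))"
      by (intro mult_left_mono) auto
    also have "\<dots> = ?r powr (2 + \<bar>b\<bar> + \<bar>s\<bar>) * norm (fourier \<psi> p)"
      by (simp add: powr_add powr_numeral)
    also have "\<dots> \<le> ?r powr real n * norm (fourier \<psi> p)"
      using n by (intro mult_right_mono powr_mono) auto
    also have "\<dots> \<le> C" using C(2)[of p] by (simp add: powr_realpow add_pos_nonneg)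
    finally have "(?r\<^sup>2 * X_weighted \<sigma> s b \<psi> p)\<^sup>2 \<le> C\<^sup>2"
      using X_weighted_nonneg by (intro power_mono) auto
    then show ?thesis by (simp add: power_mult_distrib add.assoc flip: power_mult)
  qed
  show ?thesis
    by (rule integrable_by_plane_decay[OF _ le_plane_decay[OF b]]) auto
qed

lemma X_norm_square:
  assumes "schwartz \<psi>" "\<bar>\<sigma>\<bar> = 1"
  shows "(\<integral>\<^sup>+p. (ennreal (X_weighted \<sigma> s b \<psi> p))\<^sup>2 \<partial>lborel) = ennreal ((X_norm \<sigma> s b \<psi>)\<^sup>2)"
proof -
  have "(\<integral>\<^sup>+p. (ennreal (X_weighted \<sigma> s b \<psi> p))\<^sup>2 \<partial>lborel) = (\<integral>\<^sup>+p. ennreal ((X_weighted \<sigma> s b \<psi> p)\<^sup>2) \<partial>lborel)"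
    by (simp add: ennreal_power X_weighted_nonneg)
  also have "\<dots> = ennreal (LINT p|lborel. (X_weighted \<sigma> s b \<psi> p)\<^sup>2)"
    by (intro nn_integral_eq_integral integrable_X_weighted assms) auto
  finally show ?thesis by (simp add: X_norm_X_weighted)
qed

lemma X_norm_nonneg: "0 \<le> X_norm \<sigma> s b \<psi>"
  by (simp add: X_norm_X_weighted)

section \<open>The inequality between exponents\<close>

text \<open>Abel summation: a linear form is nonnegative on the cone 0 <= x <= y <= z <= w as soon
  as it is so on the extreme rays (0,0,0,1), (0,0,1,1), (0,1,1,1), (1,1,1,1), where its values are
  the partial sums of coefficients from the top.\<close>

lemma chain4_nonneg:
  fixes x y z w :: real
  assumes "0 \<le> x" "x \<le> y" "y \<le> z" "z \<le> w"
    and "0 \<le> \<delta>" "0 \<le> \<gamma> + \<delta>" "0 \<le> \<beta> + \<gamma> + \<delta>" "0 \<le> \<alpha> + \<beta> + \<gamma> + \<delta>"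
  shows "0 \<le> \<alpha> * x + \<beta> * y + \<gamma> * z + \<delta> * w"
proof -
  have "0 \<le> (\<alpha> + \<beta> + \<gamma> + \<delta>) * x + (\<beta> + \<gamma> + \<delta>) * (y - x) + (\<gamma> + \<delta>) * (z - y) + \<delta> * (w - z)"
    by (rule add_nonneg_nonneg mult_nonneg_nonneg assms diff_ge_0_iff_ge[THEN iffD2])+
  then show ?thesis by (simp add: algebra_simps)
qed

lemma chain4_cover:
  fixes a' a'' m n :: real
  assumes ord: "0 \<le> a'" "a' \<le> a''" "a'' \<le> n" "0 \<le> m" "m \<le> n"
    and r: "0 \<le> T" "0 \<le> T + b''" "\<rho> \<le> T + b' + b''"
      "\<rho> \<le> T + s" "\<rho> \<le> T + s + b''" "2 * \<rho> \<le> T + s + b' + b''"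
  shows "\<rho> * (a' + m) \<le> T * n + s * m + b' * a' + b'' * a''"
proof -
  consider "m \<le> a'" | "a' \<le> m" "m \<le> a''" | "a'' \<le> m" by linarith
  then show ?thesis
  proof cases
    case 1
    then show ?thesis
      using chain4_nonneg[of m a' a'' n T b'' "b' - \<rho>" "s - \<rho>"] ord r by (simp add: algebra_simps)
  next
    case 2
    then show ?thesis
      using chain4_nonneg[of a' m a'' n T b'' "s - \<rho>" "b' - \<rho>"] ord r by (simp add: algebra_simps)
  next
    case 3
    then show ?thesis
      using chain4_nonneg[of a' a'' m n T "s - \<rho>" b'' "b' - \<rho>"] ord r by (simp add: algebra_simps)
  qed
qed

text \<open>For the case that the first or the second modulation equals \<open>n\<close>. In each
  ordering the gain is the sum of the two smallest among \<open>a'\<close>, \<open>a''\<close> and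
  \<open>m\<close>, and the hypotheses are the values on the rays: no gain on the top two rays,
  \<rho> on the next, 2\<rho> on the last.\<close>

lemma resonant_bound:
  fixes a' a'' m n :: real
  assumes ord: "0 \<le> a'" "a' \<le> n" "0 \<le> a''" "a'' \<le> n" "0 \<le> m" "m \<le> n"
    and r: "0 \<le> T" "0 \<le> T + b'" "0 \<le> T + b''" "\<rho> \<le> T + b' + b''"
      "0 \<le> T + s" "\<rho> \<le> T + s + b'" "\<rho> \<le> T + s + b''" "2 * \<rho> \<le> T + s + b' + b''"
  shows "\<rho> * (a' + a'') \<le> T * n + s * m + b' * a' + b'' * a''
    \<or> \<rho> * (a' + m) \<le> T * n + s * m + b' * a' + b'' * a''
    \<or> \<rho> * (a'' + m) \<le> T * n + s * m + b' * a' + b'' * a''"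
proof -
  consider "a' \<le> a''" "a'' \<le> m" | "a'' \<le> a'" "a' \<le> m" | "a' \<le> m" "m \<le> a''" | "m \<le> a'" "a' \<le> a''"
    | "a'' \<le> m" "m \<le> a'" | "m \<le> a''" "a'' \<le> a'" by linarith
  then show ?thesis
  proof cases
    case 1
    then show ?thesis
      using chain4_nonneg[of a' a'' m n T s "b'' - \<rho>" "b' - \<rho>"] ord r by (simp add: algebra_simps)
  next
    case 2
    then show ?thesis
      using chain4_nonneg[of a'' a' m n T s "b' - \<rho>" "b'' - \<rho>"] ord r by (simp add: algebra_simps)
  next
    case 3
    then show ?thesis
      using chain4_nonneg[of a' m a'' n T b'' "s - \<rho>" "b' - \<rho>"] ord r by (simp add: algebra_simps)
  next
    case 4
    then show ?thesis
      using chain4_nonneg[of m a' a'' n T b'' "b' - \<rho>" "s - \<rho>"] ord r by (simp add: algebra_simps)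
  next
    case 5
    then show ?thesis
      using chain4_nonneg[of a'' m a' n T b' "s - \<rho>" "b'' - \<rho>"] ord r by (simp add: algebra_simps)
  next
    case 6
    then show ?thesis
      using chain4_nonneg[of m a'' a' n T b' "b'' - \<rho>" "s - \<rho>"] ord r by (simp add: algebra_simps)
  qed
qed

text \<open>Two modulations share the top value \<open>a\<close>, with \<open>b\<close> the sum of
  their exponents. If \<open>n \<le> a'\<close>, the two smallest coordinates are both frequencies,
  which is not an admissible pair; the gain remains \<open>a' + m\<close>, at the price of requiring
  \<open>\<rho> \<le> b + b'\<close>.\<close>

lemma nonresonant_bound:
  fixes a a' m n :: real
  assumes ord: "0 \<le> a'" "a' \<le> a" "n \<le> a" "0 \<le> m" "m \<le> n"
    and r: "0 \<le> b" "\<rho> \<le> b + b'" "0 \<le> T + b" "\<rho> \<le> T + b + b'"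
      "\<rho> \<le> T + s + b" "2 * \<rho> \<le> T + s + b + b'"
  shows "\<rho> * (a' + m) \<le> T * n + s * m + b * a + b' * a'"
proof -
  consider "a' \<le> m" | "m \<le> a'" "a' \<le> n" | "n \<le> a'" by linarith
  then show ?thesis
  proof cases
    case 1
    then show ?thesis
      using chain4_nonneg[of a' m n a b T "s - \<rho>" "b' - \<rho>"] ord r by (simp add: algebra_simps)
  next
    case 2
    then show ?thesis
      using chain4_nonneg[of m a' n a b T "b' - \<rho>" "s - \<rho>"] ord r by (simp add: algebra_simps)
  next
    case 3
    then show ?thesis
      using chain4_nonneg[of m n a' a b "b' - \<rho>" T "s - \<rho>"] ord r by (simp add: algebra_simps)
  qed
qed

text \<open>
  The hypotheses of the theorem as linear inequalities, with 1/2 replaced by a slightly larger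
  \<open>\<rho>\<close>; \<open>\<rho>\<close> is the decay exponent of the factors in the majorants.
\<close>

locale admissible_exponents =
  fixes s1 s2 s3 b1 b2 b3 \<rho> :: real
  assumes \<rho>: "1/2 < \<rho>"
    and bb: "0 \<le> b1 + b2" "0 \<le> b1 + b3" "0 \<le> b2 + b3" "\<rho> \<le> b1 + b2 + b3"
    and s12: "0 \<le> s1 + s2"
    and s13: "0 \<le> s1 + s3 + b1" "0 \<le> s1 + s3 + b2" "0 \<le> s1 + s3 + b3" "\<rho> \<le> s1 + s3 + b1 + b2 + b3"
    and s23: "0 \<le> s2 + s3 + b1" "0 \<le> s2 + s3 + b2" "0 \<le> s2 + s3 + b3" "\<rho> \<le> s2 + s3 + b1 + b2 + b3"
    and S: "\<rho> \<le> s1 + s2 + s3 + b3"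
      "\<rho> \<le> s1 + s2 + s3 + b1 + b2" "\<rho> \<le> s1 + s2 + s3 + b1 + b3" "\<rho> \<le> s1 + s2 + s3 + b2 + b3"
      "2 * \<rho> \<le> s1 + s2 + s3 + b1 + b2 + b3"
begin

text \<open>The hypothesis \<open>top\<close> says that the maximum of the three modulations and
  \<open>n\<close> is attained twice. Here \<open>n\<close> stands for the third frequency and
  carries its exponent together with that of one other, and \<open>m\<close> stands for the
  remaining frequency. Merging the two equal coordinates leaves a chain of four.\<close>

lemma exponent_bound_aux:
  fixes a1 a2 a3 m n T s :: real
  assumes nonneg: "0 \<le> a1" "0 \<le> a2" "0 \<le> a3" "0 \<le> m" "m \<le> n"
    and top: "a1 = n \<and> a2 \<le> n \<and> a3 \<le> n \<or> a2 = n \<and> a1 \<le> n \<and> a3 \<le> n \<or> a3 = n \<and> a1 \<le> n \<and> a2 \<le> n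
      \<or> a1 = a2 \<and> a3 \<le> a1 \<and> n \<le> a1 \<or> a1 = a3 \<and> a2 \<le> a1 \<and> n \<le> a1 \<or> a2 = a3 \<and> a1 \<le> a2 \<and> n \<le> a2"
    and T: "T = s1 + s3 \<and> s = s2 \<or> T = s2 + s3 \<and> s = s1"
  shows "\<exists>k\<in>{a2 + a3, a1 + a3, a1 + m, a2 + m, a3 + m}.
    \<rho> * k \<le> T * n + s * m + b1 * a1 + b2 * a2 + b3 * a3"
proof -
  have TS: "0 \<le> T + b1" "0 \<le> T + b2" "0 \<le> T + b3" "\<rho> \<le> T + b1 + b2 + b3" "T + s = s1 + s2 + s3"
    using T s13 s23 by auto
  \<comment> \<open>Both \<open>Tp\<close> and \<open>S0\<close> are half sums:
    \<open>T + b1 + b2\<close> of \<open>T + b1\<close>, \<open>T + b2\<close> and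
    \<open>b1 + b2\<close>; \<open>s1 + s2 + s3 + b1\<close> of \<open>s1 + s2\<close>,
    \<open>s1 + s3 + b1\<close> and \<open>s2 + s3 + b1\<close>.\<close>
  have Tp: "0 \<le> T + b1 + b2" "0 \<le> T + b1 + b3" "0 \<le> T + b2 + b3"
    using TS bb by linarith+
  have S0: "0 \<le> s1 + s2 + s3 + b1" "0 \<le> s1 + s2 + s3 + b2"
    using s12 s13 s23 by linarith+
  note r = TS(1-4) Tp S0 S bb
  have sT: "s = s1 + s2 + s3 - T" using TS(5) by linarith
  consider "a1 = n" "a2 \<le> n" "a3 \<le> n" | "a2 = n" "a1 \<le> n" "a3 \<le> n"
    | "a3 = n" "a1 \<le> n" "a2 \<le> n" "a1 \<le> a2" | "a3 = n" "a1 \<le> n" "a2 \<le> n" "a2 \<le> a1"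
    | "a1 = a2" "a3 \<le> a1" "n \<le> a1" | "a1 = a3" "a2 \<le> a1" "n \<le> a1" | "a2 = a3" "a1 \<le> a2" "n \<le> a2"
    using top linear[of a1 a2] by blast
  then show ?thesis
  proof cases
    case 1
    have "\<rho> * (a2 + a3) \<le> (T + b1) * n + s * m + b2 * a2 + b3 * a3
      \<or> \<rho> * (a2 + m) \<le> (T + b1) * n + s * m + b2 * a2 + b3 * a3
      \<or> \<rho> * (a3 + m) \<le> (T + b1) * n + s * m + b2 * a2 + b3 * a3"
      using 1 nonneg r by (intro resonant_bound) (auto simp: sT)
    then show ?thesis using 1 by (auto simp: algebra_simps)
  next
    case 2
    have "\<rho> * (a1 + a3) \<le> (T + b2) * n + s * m + b1 * a1 + b3 * a3
      \<or> \<rho> * (a1 + m) \<le> (T + b2) * n + s * m + b1 * a1 + b3 * a3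
      \<or> \<rho> * (a3 + m) \<le> (T + b2) * n + s * m + b1 * a1 + b3 * a3"
      using 2 nonneg r by (intro resonant_bound) (auto simp: sT algebra_simps)
    then show ?thesis using 2 by (auto simp: algebra_simps)
  next
    case 3
    have "\<rho> * (a1 + m) \<le> (T + b3) * n + s * m + b1 * a1 + b2 * a2"
      using 3 nonneg r by (intro chain4_cover) (auto simp: sT algebra_simps)
    then show ?thesis using 3 by (auto simp: algebra_simps)
  next
    case 4
    have "\<rho> * (a2 + m) \<le> (T + b3) * n + s * m + b2 * a2 + b1 * a1"
      using 4 nonneg r by (intro chain4_cover) (auto simp: sT algebra_simps)
    then show ?thesis using 4 by (auto simp: algebra_simps)
  next
    case 5
    have "\<rho> * (a3 + m) \<le> T * n + s * m + (b1 + b2) * a1 + b3 * a3"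
      using 5 nonneg r by (intro nonresonant_bound) (auto simp: sT algebra_simps)
    then show ?thesis using 5 by (auto simp: algebra_simps)
  next
    case 6
    have "\<rho> * (a2 + m) \<le> T * n + s * m + (b1 + b3) * a1 + b2 * a2"
      using 6 nonneg r by (intro nonresonant_bound) (auto simp: sT algebra_simps)
    then show ?thesis using 6 by (auto simp: algebra_simps)
  next
    case 7
    have "\<rho> * (a1 + m) \<le> T * n + s * m + (b2 + b3) * a2 + b1 * a1"
      using 7 nonneg r by (intro nonresonant_bound) (auto simp: sT algebra_simps)
    then show ?thesis using 7 by (auto simp: algebra_simps)
  qed
qed

text \<open>Minus the logarithm of the weight left over when the three norms are divided
  out.\<close>

definition energy :: "real \<Rightarrow> real \<Rightarrow> real \<Rightarrow> real \<Rightarrow> real \<Rightarrow> real \<Rightarrow> real" where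
  "energy a1 a2 a3 n1 n2 n3 = s1 * n1 + s2 * n2 + s3 * n3 + b1 * a1 + b2 * a2 + b3 * a3"

text \<open>One sum for each admissible product; \<open>a1 + a2\<close> is absent.\<close>

definition gains :: "real \<Rightarrow> real \<Rightarrow> real \<Rightarrow> real \<Rightarrow> real \<Rightarrow> real \<Rightarrow> real set" where
  "gains a1 a2 a3 n1 n2 n3 = {a2 + a3, a1 + a3, a1 + n1, a2 + n1, a3 + n1, a1 + n2, a2 + n2, a3 + n2,
     a1 + n3, a2 + n3, a3 + n3}"

text \<open>
  \<open>a1\<close>, \<open>a2\<close>, \<open>a3\<close> and \<open>n1\<close>, \<open>n2\<close>, \<open>n3\<close> stand for the logarithms of the brackets of the
  modulations and the frequencies.
\<close>

lemma exponent_bound_exact: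
  fixes a1 a2 a3 n1 n2 n3 :: real
  assumes nonneg: "0 \<le> a1" "0 \<le> a2" "0 \<le> a3" "0 \<le> n1" "0 \<le> n2" "0 \<le> n3"
    and topn: "n1 = n2 \<and> n3 \<le> n1 \<or> n1 = n3 \<and> n2 \<le> n1 \<or> n2 = n3 \<and> n1 \<le> n2"
    and top: "a1 = n3 \<and> a2 \<le> n3 \<and> a3 \<le> n3 \<or> a2 = n3 \<and> a1 \<le> n3 \<and> a3 \<le> n3 \<or> a3 = n3 \<and> a1 \<le> n3 \<and> a2 \<le> n3
      \<or> a1 = a2 \<and> a3 \<le> a1 \<and> n3 \<le> a1 \<or> a1 = a3 \<and> a2 \<le> a1 \<and> n3 \<le> a1 \<or> a2 = a3 \<and> a1 \<le> a2 \<and> n3 \<le> a2"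
  shows "\<exists>k\<in>gains a1 a2 a3 n1 n2 n3. \<rho> * k \<le> energy a1 a2 a3 n1 n2 n3"
proof -
  consider "n1 = n2" "n3 \<le> n1" | "n1 = n3" "n2 \<le> n1" | "n2 = n3" "n1 \<le> n2" using topn by blast
  then show ?thesis
  proof cases
    case 1
    obtain k where k: "k \<in> {a2 + a3, a1 + a3, a1 + n3, a2 + n3, a3 + n3}"
      "\<rho> * k \<le> (s1 + s3) * n3 + s2 * n3 + b1 * a1 + b2 * a2 + b3 * a3"
      using exponent_bound_aux[of a1 a2 a3 n3 n3 "s1 + s3" s2] nonneg top by auto
    \<comment> \<open>Lowering the two high frequencies to \<open>n3\<close> changes the energy by
      this term alone. No gain involving \<open>n1\<close> is claimed, so s_1 + s_2 = 0 is
      allowed.\<close>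
    have "0 \<le> (s1 + s2) * (n1 - n3)" using s12 1 by simp
    then have "\<rho> * k \<le> energy a1 a2 a3 n1 n2 n3"
      using k(2) 1 by (simp add: energy_def algebra_simps)
    then show ?thesis using k(1) by (auto simp: gains_def)
  next
    case 2
    obtain k where k: "k \<in> {a2 + a3, a1 + a3, a1 + n2, a2 + n2, a3 + n2}"
      "\<rho> * k \<le> (s1 + s3) * n3 + s2 * n2 + b1 * a1 + b2 * a2 + b3 * a3"
      using exponent_bound_aux[of a1 a2 a3 n2 n3 "s1 + s3" s2] nonneg top 2 by auto
    then have "\<rho> * k \<le> energy a1 a2 a3 n1 n2 n3"
      using 2 by (simp add: energy_def algebra_simps)
    then show ?thesis using k(1) by (auto simp: gains_def)
  next
    case 3
    obtain k where k: "k \<in> {a2 + a3, a1 + a3, a1 + n1, a2 + n1, a3 + n1}"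
      "\<rho> * k \<le> (s2 + s3) * n3 + s1 * n1 + b1 * a1 + b2 * a2 + b3 * a3"
      using exponent_bound_aux[of a1 a2 a3 n1 n3 "s2 + s3" s1] nonneg top 3 by auto
    then have "\<rho> * k \<le> energy a1 a2 a3 n1 n2 n3"
      using 3 by (simp add: energy_def algebra_simps)
    then show ?thesis using k(1) by (auto simp: gains_def)
  qed
qed

text \<open>The true constraints hold only up to an additive \<open>c\<close>. The point is moved by
  at most \<open>2 * c\<close> in each coordinate onto the exact polyhedral complex; the energy then
  changes by 2c times the sum of its absolute coefficients and a gain by 4c.\<close>

lemma exponent_bound:
  fixes a1 a2 a3 n1 n2 n3 c :: real
  assumes nonneg: "0 \<le> a1" "0 \<le> a2" "0 \<le> a3" "0 \<le> n1" "0 \<le> n2" "0 \<le> n3"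
    and n: "n1 \<le> max n2 n3 + c" "n2 \<le> max n1 n3 + c" "n3 \<le> max n1 n2 + c"
    and a: "a1 \<le> max (max a2 a3) n3 + c" "a2 \<le> max (max a1 a3) n3 + c" "a3 \<le> max (max a1 a2) n3 + c"
      "n3 \<le> max (max a1 a2) a3 + c" and c: "0 \<le> c"
  shows "\<exists>k\<in>gains a1 a2 a3 n1 n2 n3. \<rho> * k \<le> energy a1 a2 a3 n1 n2 n3
    + 2 * c * (2 * \<rho> + \<bar>s1\<bar> + \<bar>s2\<bar> + \<bar>s3\<bar> + \<bar>b1\<bar> + \<bar>b2\<bar> + \<bar>b3\<bar>)"
proof -
  \<comment> \<open>Only the two largest frequencies are moved, up to their common maximum.\<close>
  obtain m1 m2 m3 where m: "m1 = m2 \<and> m3 \<le> m1 \<or> m1 = m3 \<and> m2 \<le> m1 \<or> m2 = m3 \<and> m1 \<le> m2"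
    "n1 \<le> m1" "m1 \<le> n1 + c" "n2 \<le> m2" "m2 \<le> n2 + c" "n3 \<le> m3" "m3 \<le> n3 + c"
  proof -
    consider "n3 \<le> n1" "n3 \<le> n2" | "n2 \<le> n1" "n2 \<le> n3" | "n1 \<le> n2" "n1 \<le> n3" by linarith
    then show ?thesis
    proof cases
      case 1 then show ?thesis using n c by (intro that[of "max n1 n2" "max n1 n2" n3]; (simp; fail | linarith))
    next
      case 2 then show ?thesis using n c by (intro that[of "max n1 n3" n2 "max n1 n3"]; (simp; fail | linarith))
    next
      case 3 then show ?thesis using n c by (intro that[of n1 "max n2 n3" "max n2 n3"]; (simp; fail | linarith))
    qed
  qed
  have m0: "0 \<le> m1" "0 \<le> m2" "0 \<le> m3" using m nonneg by linarith+
  have a': "a1 \<le> max (max a2 a3) m3 + c" "a2 \<le> max (max a1 a3) m3 + c" "a3 \<le> max (max a1 a2) m3 + c"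
      "m3 \<le> max (max a1 a2) a3 + 2 * c"
  proof -
    have "max (max x y) n3 + c \<le> max (max x y) m3 + c" for x y :: real
      by (intro add_right_mono max.mono order_refl m(6))
    then show "a1 \<le> max (max a2 a3) m3 + c" "a2 \<le> max (max a1 a3) m3 + c" "a3 \<le> max (max a1 a2) m3 + c"
      using a(1-3) order_trans by blast+
    show "m3 \<le> max (max a1 a2) a3 + 2 * c" using order_trans[OF m(7) add_right_mono[OF a(4), of c]] by simp
  qed
  \<comment> \<open>If \<open>m3\<close> is among the two largest of the four numbers, the other one
    is set to \<open>m3\<close>; otherwise the two largest modulations are raised to their maximum.
    The shift can reach \<open>2 * c\<close> because \<open>m3\<close> may already exceed
    \<open>n3\<close> by \<open>c\<close>.\<close>
  obtain e1 e2 e3 where e: "e1 = m3 \<and> e2 \<le> m3 \<and> e3 \<le> m3 \<or> e2 = m3 \<and> e1 \<le> m3 \<and> e3 \<le> m3 \<or> e3 = m3 \<and> e1 \<le> m3 \<and> e2 \<le> m3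
      \<or> e1 = e2 \<and> e3 \<le> e1 \<and> m3 \<le> e1 \<or> e1 = e3 \<and> e2 \<le> e1 \<and> m3 \<le> e1 \<or> e2 = e3 \<and> e1 \<le> e2 \<and> m3 \<le> e2"
    "\<bar>e1 - a1\<bar> \<le> 2 * c" "\<bar>e2 - a2\<bar> \<le> 2 * c" "\<bar>e3 - a3\<bar> \<le> 2 * c" "0 \<le> e1" "0 \<le> e2" "0 \<le> e3"
  proof -
    consider "a2 \<le> a1" "a3 \<le> a1" "a2 \<le> m3" "a3 \<le> m3" | "a1 \<le> a2" "a3 \<le> a2" "a1 \<le> m3" "a3 \<le> m3"
      | "a1 \<le> a3" "a2 \<le> a3" "a1 \<le> m3" "a2 \<le> m3" | "a3 \<le> a1" "a3 \<le> a2" "m3 \<le> a1" "m3 \<le> a2"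
      | "a2 \<le> a1" "a2 \<le> a3" "m3 \<le> a1" "m3 \<le> a3" | "a1 \<le> a2" "a1 \<le> a3" "m3 \<le> a2" "m3 \<le> a3"
      by (smt (verit))
    then show ?thesis
    proof cases
      case 1
      then have "max (max a2 a3) m3 = m3" "max (max a1 a2) a3 = a1" by auto
      then have d: "a1 \<le> m3 + c" "m3 \<le> a1 + 2 * c" using a' by simp_all
      show ?thesis
        by (rule that[of m3 a2 a3]) (use d 1 c m0 nonneg in \<open>auto simp: abs_le_iff\<close>)
    next
      case 2
      then have "max (max a1 a3) m3 = m3" "max (max a1 a2) a3 = a2" by auto
      then have d: "a2 \<le> m3 + c" "m3 \<le> a2 + 2 * c" using a' by simp_all
      show ?thesis
        by (rule that[of a1 m3 a3]) (use d 2 c m0 nonneg in \<open>auto simp: abs_le_iff\<close>)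
    next
      case 3
      then have "max (max a1 a2) m3 = m3" "max (max a1 a2) a3 = a3" by auto
      then have d: "a3 \<le> m3 + c" "m3 \<le> a3 + 2 * c" using a' by simp_all
      show ?thesis
        by (rule that[of a1 a2 m3]) (use d 3 c m0 nonneg in \<open>auto simp: abs_le_iff\<close>)
    next
      case 4
      then have "max (max a2 a3) m3 = a2" "max (max a1 a3) m3 = a1" by auto
      then have d: "a1 \<le> a2 + c" "a2 \<le> a1 + c" using a'(1,2) by simp_all
      define e where "e = max a1 a2"
      have e: "a1 \<le> e" "a2 \<le> e" "e \<le> a1 + c" "e \<le> a2 + c" using d c by (auto simp: e_def)
      have e': "a3 \<le> e" "m3 \<le> e" using e 4 by linarith+
      show ?thesis
        by (rule that[of e e a3]) (use e e' c nonneg in \<open>auto simp: abs_le_iff\<close>)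
    next
      case 5
      then have "max (max a2 a3) m3 = a3" "max (max a1 a2) m3 = a1" by auto
      then have d: "a1 \<le> a3 + c" "a3 \<le> a1 + c" using a'(1,3) by simp_all
      define e where "e = max a1 a3"
      have e: "a1 \<le> e" "a3 \<le> e" "e \<le> a1 + c" "e \<le> a3 + c" using d c by (auto simp: e_def)
      have e': "a2 \<le> e" "m3 \<le> e" using e 5 by linarith+
      show ?thesis
        by (rule that[of e a2 e]) (use e e' c nonneg in \<open>auto simp: abs_le_iff\<close>)
    next
      case 6
      then have "max (max a1 a3) m3 = a3" "max (max a1 a2) m3 = a2" by auto
      then have d: "a2 \<le> a3 + c" "a3 \<le> a2 + c" using a'(2,3) by simp_all
      define e where "e = max a2 a3"
      have e: "a2 \<le> e" "a3 \<le> e" "e \<le> a2 + c" "e \<le> a3 + c" using d c by (auto simp: e_def)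
      have e': "a1 \<le> e" "m3 \<le> e" using e 6 by linarith+
      show ?thesis
        by (rule that[of a1 e e]) (use e e' c nonneg in \<open>auto simp: abs_le_iff\<close>)
    qed
  qed
  obtain k where k: "k \<in> gains e1 e2 e3 m1 m2 m3" "\<rho> * k \<le> energy e1 e2 e3 m1 m2 m3"
    using exponent_bound_exact[OF e(5-7) m0 m(1) e(1)] by blast
  obtain k' where k': "k' \<in> gains a1 a2 a3 n1 n2 n3" "k' \<le> k + 4 * c"
  proof -
    have le: "e1 \<ge> a1 - 2 * c" "e2 \<ge> a2 - 2 * c" "e3 \<ge> a3 - 2 * c" "m1 \<ge> n1 - 2 * c" "m2 \<ge> n2 - 2 * c" "m3 \<ge> n3 - 2 * c"
      using m e(2-4) c by linarith+
    show ?thesis using k(1) unfolding gains_def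
    proof (elim insertE emptyE)
      assume "k = e2 + e3" then show ?thesis using le by (intro that[of "a2 + a3"]) (simp_all add: gains_def)
    next
      assume "k = e1 + e3" then show ?thesis using le by (intro that[of "a1 + a3"]) (simp_all add: gains_def)
    next
      assume "k = e1 + m1" then show ?thesis using le by (intro that[of "a1 + n1"]) (simp_all add: gains_def)
    next
      assume "k = e2 + m1" then show ?thesis using le by (intro that[of "a2 + n1"]) (simp_all add: gains_def)
    next
      assume "k = e3 + m1" then show ?thesis using le by (intro that[of "a3 + n1"]) (simp_all add: gains_def)
    next
      assume "k = e1 + m2" then show ?thesis using le by (intro that[of "a1 + n2"]) (simp_all add: gains_def)
    next
      assume "k = e2 + m2" then show ?thesis using le by (intro that[of "a2 + n2"]) (simp_all add: gains_def)
    next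
      assume "k = e3 + m2" then show ?thesis using le by (intro that[of "a3 + n2"]) (simp_all add: gains_def)
    next
      assume "k = e1 + m3" then show ?thesis using le by (intro that[of "a1 + n3"]) (simp_all add: gains_def)
    next
      assume "k = e2 + m3" then show ?thesis using le by (intro that[of "a2 + n3"]) (simp_all add: gains_def)
    next
      assume "k = e3 + m3" then show ?thesis using le by (intro that[of "a3 + n3"]) (simp_all add: gains_def)
    qed
  qed
  have d: "x * u \<le> x * v + 2 * c * \<bar>x\<bar>" if "\<bar>u - v\<bar> \<le> 2 * c" for x u v :: real
  proof -
    have "\<bar>x * (u - v)\<bar> \<le> \<bar>x\<bar> * (2 * c)"
      using that by (simp add: abs_mult mult_left_mono)
    then have "x * (u - v) \<le> \<bar>x\<bar> * (2 * c)" by linarith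
    then show ?thesis by (simp add: algebra_simps)
  qed
  have m': "\<bar>m1 - n1\<bar> \<le> 2 * c" "\<bar>m2 - n2\<bar> \<le> 2 * c" "\<bar>m3 - n3\<bar> \<le> 2 * c" using m(2-7) c by linarith+
  have "energy e1 e2 e3 m1 m2 m3 \<le> energy a1 a2 a3 n1 n2 n3
      + 2 * c * (\<bar>s1\<bar> + \<bar>s2\<bar> + \<bar>s3\<bar> + \<bar>b1\<bar> + \<bar>b2\<bar> + \<bar>b3\<bar>)"
    unfolding energy_def distrib_left
    using d[OF m'(1), of s1] d[OF m'(2), of s2] d[OF m'(3), of s3]
      d[OF e(2), of b1] d[OF e(3), of b2] d[OF e(4), of b3] by linarith
  moreover have "\<rho> * k' \<le> \<rho> * (k + 4 * c)" using k'(2) \<rho> by (intro mult_left_mono) auto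
  ultimately have "\<rho> * k' \<le> energy a1 a2 a3 n1 n2 n3
    + 2 * c * (2 * \<rho> + \<bar>s1\<bar> + \<bar>s2\<bar> + \<bar>s3\<bar> + \<bar>b1\<bar> + \<bar>b2\<bar> + \<bar>b3\<bar>)"
    using k(2) by (simp add: algebra_simps)
  with k'(1) show ?thesis by blast
qed

end

section \<open>Sufficiency\<close>

lemma admissible_kernel_0: "admissible_kernel (\<lambda>p q. 0)"
  unfolding admissible_kernel_def by (intro conjI exI[of _ 0]) auto

lemma admissible_kernel_sum_list:
  "(\<And>k. k \<in> set ks \<Longrightarrow> admissible_kernel k) \<Longrightarrow> admissible_kernel (\<lambda>p q. \<Sum>k\<leftarrow>ks. k p q)"
  by (induction ks) (auto intro: admissible_kernel_0 admissible_kernel_add)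

lemma jbracket_mono: "\<bar>x\<bar> \<le> \<bar>y\<bar> \<Longrightarrow> jbracket x \<le> jbracket y"
  unfolding jbracket_def by (simp add: abs_le_square_iff)

lemma ln_jbracket_nonneg: "0 \<le> ln (jbracket x)"
  by (simp add: jbracket_ge_1)

text \<open>The shape of the hypothesis fits both constraints: the coefficient 2 comes from the
  resonance identity, and \<open>y3 = 0\<close> gives the relation between frequencies. The 4 is 1 +
  1 + 2.\<close>

lemma ln_jbracket_le_max:
  assumes "\<bar>x\<bar> \<le> \<bar>y1\<bar> + \<bar>y2\<bar> + 2 * \<bar>y3\<bar>"
  shows "ln (jbracket x) \<le> max (max (ln (jbracket y1)) (ln (jbracket y2))) (ln (jbracket y3)) + ln 4"
proof -
  define M where "M = max (max (jbracket y1) (jbracket y2)) (jbracket y3)"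
  have M: "jbracket y1 \<le> M" "jbracket y2 \<le> M" "jbracket y3 \<le> M" by (auto simp: M_def)
  then have M0: "0 < M" using jbracket_pos[of y1] by linarith
  have "jbracket x \<le> jbracket (\<bar>y1\<bar> + (\<bar>y2\<bar> + 2 * \<bar>y3\<bar>))" using assms by (intro jbracket_mono) auto
  also have "\<dots> \<le> jbracket \<bar>y1\<bar> + (\<bar>y2\<bar> + 2 * \<bar>y3\<bar>)" using jbracket_add[of "\<bar>y1\<bar>" "\<bar>y2\<bar> + 2 * \<bar>y3\<bar>"] by simp
  also have "jbracket \<bar>y1\<bar> = jbracket y1" by (simp add: jbracket_def)
  also have "jbracket y1 + (\<bar>y2\<bar> + 2 * \<bar>y3\<bar>) \<le> 4 * M"
    using M jbracket_abs_le[of y2] jbracket_abs_le[of y3] by linarith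
  finally have "ln (jbracket x) \<le> ln (4 * M)" using M0 by (simp del: ln_mult)
  also have "\<dots> = ln M + ln 4" using M0 by (simp add: ln_mult)
  also have "ln M = max (max (ln (jbracket y1)) (ln (jbracket y2))) (ln (jbracket y3))"
    by (auto simp: M_def max_def)
  finally show ?thesis .
qed

section \<open>The weight in frequency space and its majorant\<close>

context admissible_exponents
begin

definition pair_list :: "real \<Rightarrow> ((real \<times> real \<Rightarrow> real \<times> real \<Rightarrow> real) \<times> (real \<times> real \<Rightarrow> real \<times> real \<Rightarrow> real)) list" where
  "pair_list \<sigma> = [(mod2 \<sigma>, mod3 \<sigma>), (mod1 \<sigma>, mod3 \<sigma>), (mod1 \<sigma>, freq1), (mod2 \<sigma>, freq1), (mod3 \<sigma>, freq1),
    (mod1 \<sigma>, freq2), (mod2 \<sigma>, freq2), (mod3 \<sigma>, freq2), (mod1 \<sigma>, freq3), (mod2 \<sigma>, freq3), (mod3 \<sigma>, freq3)]"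

definition majorant :: "real \<Rightarrow> real \<times> real \<Rightarrow> real \<times> real \<Rightarrow> ennreal" where
  "majorant \<sigma> p q = (\<Sum>k\<leftarrow>map (\<lambda>(X, Y) p q. decay_weight \<rho> (X p q) * decay_weight \<rho> (Y p q)) (pair_list \<sigma>). k p q)"

lemma admissible_majorant: "\<bar>\<sigma>\<bar> = 1 \<Longrightarrow> admissible_kernel (majorant \<sigma>)"
  unfolding majorant_def[abs_def]
  by (rule admissible_kernel_sum_list) (auto simp: pair_list_def intro: admissible_pair_kernels[OF _ \<rho>])

definition weight :: "real \<Rightarrow> real \<times> real \<Rightarrow> real \<times> real \<Rightarrow> real" where
  "weight \<sigma> p q = jbracket (mod1 \<sigma> p q) powr - b1 * jbracket (mod2 \<sigma> p q) powr - b2 * jbracket (mod3 \<sigma> p q) powr - b3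
     * (jbracket (freq1 p q) powr - s1 * jbracket (freq2 p q) powr - s2 * jbracket (freq3 p q) powr - s3)"

lemma weight_le_majorant:
  assumes \<sigma>: "\<bar>\<sigma>\<bar> = 1"
  shows "ennreal (weight \<sigma> p q) \<le> ennreal (exp (2 * ln 4 * (2 * \<rho> + \<bar>s1\<bar> + \<bar>s2\<bar> + \<bar>s3\<bar> + \<bar>b1\<bar> + \<bar>b2\<bar> + \<bar>b3\<bar>))) * majorant \<sigma> p q"
proof -
  define D where "D = 2 * ln 4 * (2 * \<rho> + \<bar>s1\<bar> + \<bar>s2\<bar> + \<bar>s3\<bar> + \<bar>b1\<bar> + \<bar>b2\<bar> + \<bar>b3\<bar>)"
  define l where "l X = ln (jbracket (X p q))" for X :: "real \<times> real \<Rightarrow> real \<times> real \<Rightarrow> real"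
  \<comment> \<open>The resonance identity: the time frequencies cancel, while the opposite sign of
    the third modulation doubles the spatial contribution.\<close>
  have "mod1 \<sigma> p q + mod2 \<sigma> p q + mod3 \<sigma> p q = 2 * (\<sigma> * freq3 p q)"
    by (simp add: mod_freq_defs algebra_simps)
  moreover have "\<bar>\<sigma> * freq3 p q\<bar> = \<bar>freq3 p q\<bar>" using \<sigma> by (simp add: abs_mult)
  ultimately have m: "\<bar>mod1 \<sigma> p q\<bar> \<le> \<bar>mod2 \<sigma> p q\<bar> + \<bar>mod3 \<sigma> p q\<bar> + 2 * \<bar>freq3 p q\<bar>"
    "\<bar>mod2 \<sigma> p q\<bar> \<le> \<bar>mod1 \<sigma> p q\<bar> + \<bar>mod3 \<sigma> p q\<bar> + 2 * \<bar>freq3 p q\<bar>"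
    "\<bar>mod3 \<sigma> p q\<bar> \<le> \<bar>mod1 \<sigma> p q\<bar> + \<bar>mod2 \<sigma> p q\<bar> + 2 * \<bar>freq3 p q\<bar>"
    "\<bar>freq3 p q\<bar> \<le> \<bar>mod1 \<sigma> p q\<bar> + \<bar>mod2 \<sigma> p q\<bar> + 2 * \<bar>mod3 \<sigma> p q\<bar>"
    by linarith+
  \<comment> \<open>The summand \<open>2 * \<bar>0\<bar>\<close> only matches the shape of
    \<open>ln_jbracket_le_max\<close>; its bracket is 1 and its logarithm 0 drops out of the
    maximum.\<close>
  have f: "\<bar>freq1 p q\<bar> \<le> \<bar>freq2 p q\<bar> + \<bar>freq3 p q\<bar> + 2 * \<bar>0\<bar>"
    "\<bar>freq2 p q\<bar> \<le> \<bar>freq1 p q\<bar> + \<bar>freq3 p q\<bar> + 2 * \<bar>0\<bar>"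
    "\<bar>freq3 p q\<bar> \<le> \<bar>freq1 p q\<bar> + \<bar>freq2 p q\<bar> + 2 * \<bar>0\<bar>"
    unfolding mod_freq_defs by linarith+
  have nn: "0 \<le> l X" for X by (simp add: l_def ln_jbracket_nonneg)
  have mx: "max (max (l X) (l Y)) 0 = max (l X) (l Y)" for X Y
    using nn[of X] by (simp add: max.absorb1 le_max_iff_disj)
  have fl: "l freq1 \<le> max (l freq2) (l freq3) + ln 4" "l freq2 \<le> max (l freq1) (l freq3) + ln 4"
    "l freq3 \<le> max (l freq1) (l freq2) + ln 4"
    using f[THEN ln_jbracket_le_max] unfolding jbracket_0 ln_one l_def[symmetric] mx .
  have "\<exists>k\<in>gains (l (mod1 \<sigma>)) (l (mod2 \<sigma>)) (l (mod3 \<sigma>)) (l freq1) (l freq2) (l freq3).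
    \<rho> * k \<le> energy (l (mod1 \<sigma>)) (l (mod2 \<sigma>)) (l (mod3 \<sigma>)) (l freq1) (l freq2) (l freq3) + D"
    unfolding D_def
    by (rule exponent_bound[OF nn nn nn nn nn nn fl m[THEN ln_jbracket_le_max, folded l_def]]) simp
  then obtain k where k: "k \<in> gains (l (mod1 \<sigma>)) (l (mod2 \<sigma>)) (l (mod3 \<sigma>)) (l freq1) (l freq2) (l freq3)"
    "\<rho> * k \<le> energy (l (mod1 \<sigma>)) (l (mod2 \<sigma>)) (l (mod3 \<sigma>)) (l freq1) (l freq2) (l freq3) + D" by blast
  from k(1) obtain X Y where XY: "(X, Y) \<in> set (pair_list \<sigma>)" "k = l X + l Y"
    unfolding gains_def pair_list_def by auto
  have e: "jbracket (X p q) powr - c = exp (- (c * l X))" for X c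
    using jbracket_pos[of "X p q"] by (simp add: powr_def l_def less_imp_neq[symmetric])
  have "weight \<sigma> p q = exp (- energy (l (mod1 \<sigma>)) (l (mod2 \<sigma>)) (l (mod3 \<sigma>)) (l freq1) (l freq2) (l freq3))"
    unfolding weight_def e energy_def by (simp flip: exp_add)
  also have "\<dots> \<le> exp (D - \<rho> * k)" using k(2) by simp
  also have "\<dots> = exp D * (jbracket (X p q) powr - \<rho> * jbracket (Y p q) powr - \<rho>)"
    unfolding e XY(2) by (simp add: algebra_simps flip: exp_add)
  finally have "ennreal (weight \<sigma> p q) \<le> ennreal (exp D) * (decay_weight \<rho> (X p q) * decay_weight \<rho> (Y p q))"
    unfolding decay_weight_def by (simp add: ennreal_leI flip: ennreal_mult)
  \<comment> \<open>The selected pair depends on \<open>p\<close> and \<open>q\<close>, so its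
    product is replaced by the sum of all eleven.\<close>
  also have "\<dots> \<le> ennreal (exp D) * majorant \<sigma> p q"
    unfolding majorant_def map_map
    by (intro mult_left_mono member_le_sum_list) (use XY(1) in \<open>auto simp: image_iff intro!: bexI[of _ "(X, Y)"]\<close>)
  finally show ?thesis unfolding D_def .
qed

lemma admissible_weight:
  assumes \<sigma>: "\<bar>\<sigma>\<bar> = 1"
  shows "admissible_kernel (\<lambda>p q. ennreal (weight \<sigma> p q))"
proof (rule admissible_kernel_cmult_mono[OF admissible_majorant[OF \<sigma>] _ _ weight_le_majorant[OF \<sigma>]])
  show "(\<lambda>(p, q). ennreal (weight \<sigma> p q)) \<in> borel_measurable (borel \<Otimes>\<^sub>M borel)"
    unfolding weight_def mod_freq_defs by measurable
qed simp

lemma trilinear_estimate_holds: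
  assumes \<sigma>: "\<bar>\<sigma>\<bar> = 1"
  shows "\<exists>C. trilinear_estimate \<sigma> s1 s2 s3 b1 b2 b3 C"
proof -
  obtain B where B: "B < \<infinity>"
    "\<And>F G H. F \<in> borel_measurable borel \<Longrightarrow> G \<in> borel_measurable borel \<Longrightarrow> H \<in> borel_measurable borel \<Longrightarrow>
      (\<integral>\<^sup>+p. \<integral>\<^sup>+q. ennreal (weight \<sigma> p q) * (F p * G q * H (- p - q)) \<partial>lborel \<partial>lborel)\<^sup>2
        \<le> B * ((\<integral>\<^sup>+p. (F p)\<^sup>2 \<partial>lborel) * (\<integral>\<^sup>+p. (G p)\<^sup>2 \<partial>lborel) * (\<integral>\<^sup>+p. (H p)\<^sup>2 \<partial>lborel))"
    using admissible_weight[OF \<sigma>] unfolding admissible_kernel_def by blast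
  define c where "c = enn2real B"
  have c: "B = ennreal c" "0 \<le> c" using B(1) by (simp_all add: c_def)
  have "trilinear_estimate \<sigma> s1 s2 s3 b1 b2 b3 (sqrt c)"
    unfolding trilinear_estimate_def
  proof (intro allI impI)
    fix f g h :: "real \<times> real \<Rightarrow> complex"
    assume f: "schwartz f" and g: "schwartz g" and h: "schwartz h"
    have [measurable]: "f \<in> borel_measurable borel" "g \<in> borel_measurable borel" "h \<in> borel_measurable borel"
      using f g h schwartz_measurable by auto
    let ?F = "X_weighted \<sigma> s1 b1 f" and ?G = "X_weighted \<sigma> s2 b2 g" and ?H = "X_weighted (- \<sigma>) s3 b3 h"
    have inv: "norm (fourier f p) = jbracket (fst p + \<sigma> * snd p) powr - b * jbracket (snd p) powr - s * X_weighted \<sigma> s b f p" for f \<sigma> s b p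
    proof -
      have "jbracket x powr - a * jbracket x powr a = 1" for x a
        using jbracket_pos[of x] by (simp add: less_imp_neq[symmetric] flip: powr_add)
      then show ?thesis unfolding X_weighted_def by (simp add: mult_ac)
    qed
    have e: "ennreal (norm (fourier f p)) * ennreal (norm (fourier g q)) * ennreal (norm (fourier h (- p - q)))
      = ennreal (weight \<sigma> p q) * (ennreal (?F p) * ennreal (?G q) * ennreal (?H (- p - q)))" for p q
    proof -
      \<comment> \<open>For the third function the sign and the point are both reversed: its
        modulation is exactly \<open>mod3\<close>, and its frequency is \<open>freq3\<close> up to a
        sign that the even bracket ignores.\<close>
      have m3: "fst (- p - q) + - \<sigma> * snd (- p - q) = mod3 \<sigma> p q" by (simp add: mod3_def algebra_simps)
      have f3: "jbracket (snd (- p - q)) = jbracket (freq3 p q)"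
        unfolding freq3_def jbracket_def by (simp add: power2_eq_square algebra_simps)
      have "norm (fourier f p) * norm (fourier g q) * norm (fourier h (- p - q)) = weight \<sigma> p q * (?F p * ?G q * ?H (- p - q))"
        unfolding inv[of f p \<sigma> b1 s1] inv[of g q \<sigma> b2 s2] inv[of h "- p - q" "- \<sigma>" b3 s3] m3 f3 weight_def mod1_def mod2_def freq1_def freq2_def
        by (simp only: mult_ac)
      moreover have "0 \<le> weight \<sigma> p q" by (simp add: weight_def)
      ultimately show ?thesis by (simp add: X_weighted_nonneg flip: ennreal_mult)
    qed
    have "(ennreal (norm (LINT x|lborel. f x * g x * h x)))\<^sup>2
      \<le> (\<integral>\<^sup>+p. \<integral>\<^sup>+q. ennreal (weight \<sigma> p q) * (ennreal (?F p) * ennreal (?G q) * ennreal (?H (- p - q))) \<partial>lborel \<partial>lborel)\<^sup>2"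
      using schwartz_trilinear_bound[OF f g h] unfolding e by (intro power_mono) auto
    also have "\<dots> \<le> B * ((\<integral>\<^sup>+p. (ennreal (?F p))\<^sup>2 \<partial>lborel) * (\<integral>\<^sup>+p. (ennreal (?G p))\<^sup>2 \<partial>lborel) * (\<integral>\<^sup>+p. (ennreal (?H p))\<^sup>2 \<partial>lborel))"
      by (rule B(2)[of "\<lambda>p. ennreal (?F p)" "\<lambda>p. ennreal (?G p)" "\<lambda>p. ennreal (?H p)"]) measurable
    also have "\<dots> = ennreal (c * ((X_norm \<sigma> s1 b1 f)\<^sup>2 * (X_norm \<sigma> s2 b2 g)\<^sup>2 * (X_norm (- \<sigma>) s3 b3 h)\<^sup>2))"
      using f g h \<sigma> by (simp add: X_norm_square c flip: ennreal_mult)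
    finally have "(norm (LINT x|lborel. f x * g x * h x))\<^sup>2
      \<le> c * ((X_norm \<sigma> s1 b1 f)\<^sup>2 * (X_norm \<sigma> s2 b2 g)\<^sup>2 * (X_norm (- \<sigma>) s3 b3 h)\<^sup>2)"
      using c by (simp add: ennreal_power ennreal_le_iff)
    also have "\<dots> = (sqrt c * X_norm \<sigma> s1 b1 f * X_norm \<sigma> s2 b2 g * X_norm (- \<sigma>) s3 b3 h)\<^sup>2"
      using c by (simp add: power_mult_distrib mult_ac)
    finally show "norm (LINT p|lborel. f p * g p * h p) \<le> sqrt c * X_norm \<sigma> s1 b1 f * X_norm \<sigma> s2 b2 g * X_norm (- \<sigma>) s3 b3 h"
      by (rule power2_le_imp_le) (use c X_norm_nonneg in auto)
  qed
  then show ?thesis by blast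
qed

end

section \<open>Testing the estimate on wave packets\<close>

text \<open>At distance \<open>W * z\<close> from \<open>l0\<close> the bracket changes by at most a
  factor R = (2 + 6 z) powr (1 / \<epsilon>) in either direction. The weight thus changes by a power
  of z, of order \<open>m\<close> after squaring, which the Gaussian absorbs uniformly in
  \<open>l0\<close>. This is why the widths have to stay below the power 1 - \<epsilon>.\<close>

lemma bracket_gaussian_bound:
  fixes b \<epsilon> :: real
  assumes \<epsilon>: "0 < \<epsilon>" "\<epsilon> < 1"
  obtains C where "0 < C" "\<And>l l0 W z. 0 \<le> z \<Longrightarrow> W \<le> 3 * jbracket l0 powr (1 - \<epsilon>) \<Longrightarrow> \<bar>l - l0\<bar> \<le> W * z \<Longrightarrow>
    (jbracket l powr b)\<^sup>2 * exp (- (z\<^sup>2 / 8)) \<le> C * (jbracket l0 powr b)\<^sup>2"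
proof -
  define m where "m = 2 * \<bar>b\<bar> / \<epsilon>"
  have m0: "0 \<le> m" using \<epsilon> by (simp add: m_def)
  obtain B where B: "0 \<le> B" "\<And>r. 0 \<le> r \<Longrightarrow> (1 + r) powr m * exp (- (1/8 * r\<^sup>2)) \<le> B"
    using powr_mult_gaussian_bounded[OF m0, of "1/8"] by auto
  define C where "C = 6 powr m * B + 1"
  have C0: "0 < C" using B by (simp add: C_def add_nonneg_pos)
  show ?thesis
  proof (rule that[OF C0])
    fix l l0 W z :: real
    assume z: "0 \<le> z" and W: "W \<le> 3 * jbracket l0 powr (1 - \<epsilon>)" and d: "\<bar>l - l0\<bar> \<le> W * z"
    let ?J = "jbracket l" and ?K = "jbracket l0"
    define R where "R = (2 + 6 * z) powr (1 / \<epsilon>)"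
    have Wz: "W * z \<le> 3 * ?K powr (1 - \<epsilon>) * z" using W z by (intro mult_right_mono)
    have p1: "?K powr (1 - \<epsilon>) \<le> ?K"
      using powr_mono[of "1 - \<epsilon>" 1 ?K] jbracket_ge_1[of l0] \<epsilon> by (simp add: less_imp_le)
    have R1: "2 + 6 * z \<le> R"
      using powr_mono[of 1 "1 / \<epsilon>" "2 + 6 * z"] \<epsilon> z by (simp add: R_def)
    have up: "?J \<le> R * ?K"
    proof -
      have "3 * ?K powr (1 - \<epsilon>) * z \<le> 3 * ?K * z" using p1 z by (intro mult_right_mono mult_left_mono) auto
      moreover have "?J \<le> ?K + \<bar>l - l0\<bar>" using jbracket_add[of l0 "l - l0"] by simp
      ultimately have "?J \<le> ?K + 3 * ?K * z" using d Wz by linarith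
      also have "\<dots> = (1 + 3 * z) * ?K" by (simp add: algebra_simps)
      also have "\<dots> \<le> R * ?K" using R1 z by (intro mult_right_mono) auto
      finally show ?thesis .
    qed
    have down: "?K \<le> R * ?J"
    proof (cases "\<bar>l - l0\<bar> \<le> ?K / 2")
      case True
      have "?K \<le> ?J + \<bar>l - l0\<bar>" using jbracket_add[of l "l0 - l"] by simp
      then have "?K \<le> 2 * ?J" using True by simp
      also have "\<dots> \<le> R * ?J" using R1 z by (intro mult_right_mono) auto
      finally show ?thesis .
    next
      case False
      \<comment> \<open>Leaving the ball of radius \<open>?K / 2\<close> around \<open>l0\<close>
        needs 6 z to be at least \<open>?K powr \<epsilon>\<close>, so \<open>?K\<close> itself is
        bounded by a power of z.\<close>
      have "?K powr (1 - \<epsilon>) * ?K powr \<epsilon> = ?K" by (simp flip: powr_add)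
      moreover have "?K \<le> ?K powr (1 - \<epsilon>) * (6 * z)" using False d Wz by (simp add: mult_ac)
      ultimately have "?K powr (1 - \<epsilon>) * ?K powr \<epsilon> \<le> ?K powr (1 - \<epsilon>) * (6 * z)" by simp
      moreover have "0 < ?K powr (1 - \<epsilon>)" using jbracket_pos[of l0] by (simp add: less_imp_neq[symmetric])
      ultimately have "?K powr \<epsilon> \<le> 6 * z" by (simp add: mult_le_cancel_left_pos)
      then have "?K powr \<epsilon> \<le> 2 + 6 * z" by simp
      then have "(?K powr \<epsilon>) powr (1 / \<epsilon>) \<le> R"
        unfolding R_def using \<epsilon> by (intro powr_mono2) auto
      then have "?K \<le> R * 1" using \<epsilon> jbracket_ge_1[of l0] by (simp add: powr_powr)
      also have "R * 1 \<le> R * jbracket l" using R1 z by (intro mult_left_mono jbracket_ge_1) auto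
      finally show ?thesis .
    qed
    have R0: "1 \<le> R" using R1 z by linarith
    have "?J powr b \<le> R powr \<bar>b\<bar> * ?K powr b"
    proof (cases "0 \<le> b")
      case True
      then have "?J powr b \<le> (R * ?K) powr b" using up by (intro powr_mono2) auto
      then show ?thesis using True R0 by (simp add: powr_mult)
    next
      case False
      then have "(R * ?J) powr b \<le> ?K powr b" using down by (intro powr_mono2') auto
      then have "R powr - b * (R powr b * ?J powr b) \<le> R powr - b * ?K powr b"
        using R0 by (intro mult_left_mono) (auto simp: powr_mult)
      then show ?thesis using False R0 by (simp add: mult.assoc[symmetric] flip: powr_add)
    qed
    then have "(?J powr b)\<^sup>2 \<le> (R powr \<bar>b\<bar> * ?K powr b)\<^sup>2" by (intro power_mono) auto
    also have "\<dots> = R powr (2 * \<bar>b\<bar>) * (?K powr b)\<^sup>2"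
      unfolding power_mult_distrib power2_eq_square[of "R powr _"] by (simp flip: powr_add)
    also have "R powr (2 * \<bar>b\<bar>) = (2 + 6 * z) powr m"
      by (simp add: R_def powr_powr m_def)
    also have "(2 + 6 * z) powr m \<le> (6 * (1 + z)) powr m" using z m0 by (intro powr_mono2) auto
    also have "\<dots> = 6 powr m * (1 + z) powr m" using z by (simp only: powr_mult)
    finally have "(?J powr b)\<^sup>2 * exp (- (z\<^sup>2 / 8)) \<le> 6 powr m * (1 + z) powr m * (?K powr b)\<^sup>2 * exp (- (z\<^sup>2 / 8))"
      by (simp add: mult_right_mono)
    also have "\<dots> = 6 powr m * ((1 + z) powr m * exp (- (1/8 * z\<^sup>2))) * (?K powr b)\<^sup>2" by simp
    also have "\<dots> \<le> C * (?K powr b)\<^sup>2"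
      unfolding C_def using B(2)[OF z] by (intro mult_right_mono) (auto simp: add_increasing2 mult_left_mono)
    finally show "(?J powr b)\<^sup>2 * exp (- (z\<^sup>2 / 8)) \<le> C * (?K powr b)\<^sup>2" .
  qed
qed

text \<open>Inversion at the origin, where the packet has the value 1.\<close>

lemma integral_fourier_gauss:
  assumes "0 < L" "0 < N"
  shows "(LINT q|lborel. fourier (gauss L N r u k) q) = of_real ((2 * pi)\<^sup>2)"
proof -
  have g: "schwartz (gauss L N r u k)" using assms by (rule schwartz_gauss)
  have g0: "gauss L N r u k 0 = 1" by (simp add: gauss_def)
  obtain B where B: "\<And>p. norm (gauss L N r u k p) \<le> B" using schwartz_bounded[OF g] by blast
  show ?thesis
    using fourier_inversion[OF schwartz_integrable[OF g] schwartz_fourier_integrable[OF g] schwartz_continuous[OF g] B, of 0]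
    g0 by simp
qed

text \<open>The weights may be frozen at the centre of the packet. Because the transform is
  positive, one power of it is kept as a density with known integral, and only the other is spent on
  the weights. The modulation of sign \<open>\<sigma>\<close> spreads over L + |\<sigma> - r| N,
  since the packet is adapted to the velocity \<open>r\<close>.\<close>

lemma X_norm_gauss_le:
  fixes b s \<epsilon> :: real
  assumes \<epsilon>: "0 < \<epsilon>" "\<epsilon> < 1"
  obtains C where "0 < C" "\<And>\<sigma> r L N u k. \<bar>\<sigma>\<bar> = 1 \<Longrightarrow> 1 \<le> L \<Longrightarrow> 1 \<le> N \<Longrightarrow>
    L + \<bar>\<sigma> - r\<bar> * N \<le> 3 * jbracket (u + (\<sigma> - r) * k) powr (1 - \<epsilon>) \<Longrightarrow> N \<le> 3 * jbracket k powr (1 - \<epsilon>) \<Longrightarrow>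
    X_norm \<sigma> s b (gauss L N r u k) \<le> C * (jbracket (u + (\<sigma> - r) * k) powr b * jbracket k powr s / sqrt (L * N))"
proof -
  obtain C1 where C1: "0 < C1" "\<And>l l0 W z. 0 \<le> z \<Longrightarrow> W \<le> 3 * jbracket l0 powr (1 - \<epsilon>) \<Longrightarrow> \<bar>l - l0\<bar> \<le> W * z \<Longrightarrow>
    (jbracket l powr b)\<^sup>2 * exp (- (z\<^sup>2 / 8)) \<le> C1 * (jbracket l0 powr b)\<^sup>2"
    using bracket_gaussian_bound[OF \<epsilon>, where b = b] by metis
  obtain C2 where C2: "0 < C2" "\<And>l l0 W z. 0 \<le> z \<Longrightarrow> W \<le> 3 * jbracket l0 powr (1 - \<epsilon>) \<Longrightarrow> \<bar>l - l0\<bar> \<le> W * z \<Longrightarrow>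
    (jbracket l powr s)\<^sup>2 * exp (- (z\<^sup>2 / 8)) \<le> C2 * (jbracket l0 powr s)\<^sup>2"
    using bracket_gaussian_bound[OF \<epsilon>, where b = s] by metis
  \<comment> \<open>One factor 2 pi is the height of the transform, the other two are its
    integral.\<close>
  define C where "C = sqrt (C1 * C2 * (2 * pi) ^ 3)"
  have C0: "0 < C" using C1 C2 by (simp add: C_def)
  show ?thesis
  proof (rule that[OF C0])
    fix \<sigma> r L N u k :: real
    assume \<sigma>: "\<bar>\<sigma>\<bar> = 1" and L: "1 \<le> L" and N: "1 \<le> N"
      and W: "L + \<bar>\<sigma> - r\<bar> * N \<le> 3 * jbracket (u + (\<sigma> - r) * k) powr (1 - \<epsilon>)"
      and W': "N \<le> 3 * jbracket k powr (1 - \<epsilon>)"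
    define l0 where "l0 = u + (\<sigma> - r) * k"
    define A where "A = C1 * (jbracket l0 powr b)\<^sup>2 * (C2 * (jbracket k powr s)\<^sup>2) * (2 * pi / (L * N))"
    let ?g = "gauss L N r u k"
    have g: "schwartz ?g" using L N by (intro schwartz_gauss) auto
    have pw: "(X_weighted \<sigma> s b ?g q)\<^sup>2 \<le> A * Re (fourier ?g q)" for q
    proof -
      obtain \<tau> \<xi> where q: "q = (\<tau>, \<xi>)" by (cases q)
      define z1 z2 where "z1 = \<bar>\<tau> + r * \<xi> - u\<bar> / L" and "z2 = \<bar>\<xi> - k\<bar> / N"
      have z: "0 \<le> z1" "0 \<le> z2" using L N by (auto simp: z1_def z2_def)
      have zz: "z1\<^sup>2 = ((\<tau> + r * \<xi> - u) / L)\<^sup>2" "z2\<^sup>2 = ((\<xi> - k) / N)\<^sup>2"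
        by (simp_all add: z1_def z2_def power_divide)
      have F: "fourier ?g q = of_real (2 * pi / (L * N) * exp (- (z1\<^sup>2 + z2\<^sup>2) / 2))"
      proof -
        have "exp (- (z1\<^sup>2 + z2\<^sup>2) / 2) = exp (- ((\<tau> + r * \<xi> - u) / L)\<^sup>2 / 2) * exp (- ((\<xi> - k) / N)\<^sup>2 / 2)"
          unfolding exp_add[symmetric] zz by (simp add: add_divide_distrib diff_divide_distrib)
        then show ?thesis using L N by (simp add: q fourier_gauss)
      qed
      have d1: "\<bar>\<tau> + \<sigma> * \<xi> - l0\<bar> \<le> (L + \<bar>\<sigma> - r\<bar> * N) * (z1 + z2)"
      proof -
        have e: "\<tau> + \<sigma> * \<xi> - l0 = (\<tau> + r * \<xi> - u) + (\<sigma> - r) * (\<xi> - k)" by (simp add: l0_def algebra_simps)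
        have "\<bar>\<tau> + \<sigma> * \<xi> - l0\<bar> \<le> \<bar>\<tau> + r * \<xi> - u\<bar> + \<bar>\<sigma> - r\<bar> * \<bar>\<xi> - k\<bar>"
          unfolding e by (metis abs_mult abs_triangle_ineq)
        also have "\<dots> = L * z1 + (\<bar>\<sigma> - r\<bar> * N) * z2" using L N by (simp add: z1_def z2_def)
        also have "\<dots> \<le> (L * z1 + (\<bar>\<sigma> - r\<bar> * N) * z2) + (L * z2 + (\<bar>\<sigma> - r\<bar> * N) * z1)"
          using L N z by simp
        finally show ?thesis by (simp add: algebra_simps)
      qed
      have d2: "\<bar>\<xi> - k\<bar> \<le> N * z2" using N by (simp add: z2_def)
      have zs: "(z1 + z2)\<^sup>2 \<le> 2 * (z1\<^sup>2 + z2\<^sup>2)"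
        using zero_le_power2[of "z1 - z2"] by (simp add: power2_eq_square algebra_simps)
      have "(X_weighted \<sigma> s b ?g q)\<^sup>2 = (jbracket (\<tau> + \<sigma> * \<xi>) powr b)\<^sup>2 * (jbracket \<xi> powr s)\<^sup>2
          * ((2 * pi / (L * N))\<^sup>2 * exp (- (z1\<^sup>2 + z2\<^sup>2)))"
      proof -
        have "(exp (- (z1\<^sup>2 + z2\<^sup>2) / 2))\<^sup>2 = exp (- (z1\<^sup>2 + z2\<^sup>2))"
          unfolding power2_eq_square[of "exp _"] by (simp add: algebra_simps flip: exp_add)
        moreover have "(norm (fourier ?g q))\<^sup>2 = (2 * pi / (L * N))\<^sup>2 * (exp (- (z1\<^sup>2 + z2\<^sup>2) / 2))\<^sup>2"
          unfolding F norm_of_real power2_abs power_mult_distrib ..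
        ultimately show ?thesis unfolding X_weighted_def by (simp add: q power_mult_distrib)
      qed
      \<comment> \<open>Half of the exponent is kept as the transform itself; the other half covers
        the two Gaussians that absorb the modulation weight and the frequency weight.\<close>
      also have "exp (- (z1\<^sup>2 + z2\<^sup>2)) \<le> exp (- ((z1 + z2)\<^sup>2 / 8)) * exp (- (z2\<^sup>2 / 8)) * exp (- (z1\<^sup>2 + z2\<^sup>2) / 2)"
      proof -
        have aux: "- (x + y) \<le> - (a / 8) + - (y / 8) + - (x + y) / 2" if "a \<le> 2 * (x + y)" "0 \<le> x" "0 \<le> y" for a x y :: real
          using that by (simp add: field_simps)
        have "- (z1\<^sup>2 + z2\<^sup>2) \<le> - ((z1 + z2)\<^sup>2 / 8) + - (z2\<^sup>2 / 8) + - (z1\<^sup>2 + z2\<^sup>2) / 2"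
          using aux[OF zs zero_le_power2 zero_le_power2] .
        then have "exp (- (z1\<^sup>2 + z2\<^sup>2)) \<le> exp (- ((z1 + z2)\<^sup>2 / 8) + - (z2\<^sup>2 / 8) + - (z1\<^sup>2 + z2\<^sup>2) / 2)" by simp
        then show ?thesis by (simp only: exp_add)
      qed
      finally have "(X_weighted \<sigma> s b ?g q)\<^sup>2 \<le> (jbracket (\<tau> + \<sigma> * \<xi>) powr b)\<^sup>2 * (jbracket \<xi> powr s)\<^sup>2
          * ((2 * pi / (L * N))\<^sup>2 * (exp (- ((z1 + z2)\<^sup>2 / 8)) * exp (- (z2\<^sup>2 / 8)) * exp (- (z1\<^sup>2 + z2\<^sup>2) / 2)))"
        by (simp add: mult_left_mono)
      also have "\<dots> = ((jbracket (\<tau> + \<sigma> * \<xi>) powr b)\<^sup>2 * exp (- ((z1 + z2)\<^sup>2 / 8))) * ((jbracket \<xi> powr s)\<^sup>2 * exp (- (z2\<^sup>2 / 8)))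
          * ((2 * pi / (L * N))\<^sup>2 * exp (- (z1\<^sup>2 + z2\<^sup>2) / 2))"
        by (simp only: mult_ac)
      also have "\<dots> \<le> (C1 * (jbracket l0 powr b)\<^sup>2) * (C2 * (jbracket k powr s)\<^sup>2) * ((2 * pi / (L * N))\<^sup>2 * exp (- (z1\<^sup>2 + z2\<^sup>2) / 2))"
        using z C1(1) C2(1)
        by (intro mult_right_mono[OF mult_mono[OF C1(2)[OF _ W[folded l0_def] d1] C2(2)[OF z(2) W' d2]]]) auto
      also have "\<dots> = A * Re (fourier ?g q)" unfolding A_def F by (simp add: power2_eq_square)
      finally show ?thesis .
    qed
    have int: "integrable lborel (\<lambda>q. Re (fourier ?g q))"
      by (intro integrable_Re schwartz_fourier_integrable g)
    have "(LINT q|lborel. (X_weighted \<sigma> s b ?g q)\<^sup>2) \<le> (LINT q|lborel. A * Re (fourier ?g q))"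
      by (intro integral_mono integrable_X_weighted g \<sigma> integrable_mult_right int pw)
    also have "\<dots> = A * (2 * pi)\<^sup>2"
      using integral_Re[OF schwartz_fourier_integrable[OF g]] integral_fourier_gauss[of L N r u k] L N by simp
    also have "\<dots> = (C * (jbracket l0 powr b * jbracket k powr s / sqrt (L * N)))\<^sup>2"
      using C1 C2 L N unfolding A_def C_def power_mult_distrib power_divide
      by (simp add: power2_eq_square power3_eq_cube field_simps)
    finally have "X_norm \<sigma> s b ?g \<le> sqrt ((C * (jbracket l0 powr b * jbracket k powr s / sqrt (L * N)))\<^sup>2)"
      unfolding X_norm_X_weighted by (rule real_sqrt_le_mono)
    then show "X_norm \<sigma> s b ?g \<le> C * (jbracket (u + (\<sigma> - r) * k) powr b * jbracket k powr s / sqrt (L * N))"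
      unfolding l0_def[symmetric] using C0 L N by (simp add: abs_mult)
  qed
qed

text \<open>The conditions on the \<open>k\<close>s and \<open>u\<close>s cancel all phases, so the
  product is a positive Gaussian. It dominates a Gaussian adapted to the velocity
  \<open>\<sigma>\<close> alone, whose integral is its transform at the origin.\<close>

lemma gauss_product_integral_ge:
  assumes L: "1 \<le> L1" "L1 \<le> P" "1 \<le> L2" "L2 \<le> P" "1 \<le> L3" "L3 \<le> P"
    and N: "1 \<le> N1" "N1 \<le> R" "1 \<le> N2" "N2 \<le> R" "1 \<le> N3" "N3 \<le> R" and r: "\<bar>\<sigma> - r\<bar> * N3 \<le> 2 * P"
    and k: "k1 + k2 + k3 = 0" and u: "u1 + u2 + u3 = \<sigma> * (k1 + k2) + r * k3"
  shows "2 * pi / (8 * P * R)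
    \<le> norm (LINT p|lborel. gauss L1 N1 \<sigma> u1 k1 p * gauss L2 N2 \<sigma> u2 k2 p * gauss L3 N3 r u3 k3 p)"
proof -
  define E where "E p = exp (- (((L1 * fst p)\<^sup>2 + (N1 * (snd p - \<sigma> * fst p))\<^sup>2) / 2 + ((L2 * fst p)\<^sup>2 + (N2 * (snd p - \<sigma> * fst p))\<^sup>2) / 2
    + ((L3 * fst p)\<^sup>2 + (N3 * (snd p - r * fst p))\<^sup>2) / 2))" for p :: "real \<times> real"
  have eq: "gauss L1 N1 \<sigma> u1 k1 p * gauss L2 N2 \<sigma> u2 k2 p * gauss L3 N3 r u3 k3 p = of_real (E p)" for p
  proof -
    have k3: "k3 = - k1 - k2" using k by linarith
    have u3: "u3 = \<sigma> * (k1 + k2) + r * k3 - u1 - u2" using u by linarith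
    show ?thesis
      unfolding gauss_def E_def exp_of_real[symmetric] exp_add[symmetric] u3 k3
      by (simp add: algebra_simps add_divide_distrib)
  qed
  \<comment> \<open>In the coordinates t and y = x - \<sigma> t the third packet contains N3 y + N3
    (\<sigma> - r) t, whose mixed term is split by (a + b)^2 <= 2 a^2 + 2 b^2. The widths 4 P and 2
    R are large enough for the total of the three exponents.\<close>
  have g: "schwartz (gauss (4 * P) (2 * R) \<sigma> 0 0)" "schwartz (gauss L1 N1 \<sigma> u1 k1)"
    using L N by (auto intro!: schwartz_gauss)
  have e2: "gauss (4 * P) (2 * R) \<sigma> 0 0 p = of_real (exp (- ((4 * P * fst p)\<^sup>2 / 2 + (2 * R * (snd p - \<sigma> * fst p))\<^sup>2 / 2)))" for p
    unfolding gauss_def exp_of_real[symmetric] by simp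
  have le: "exp (- ((4 * P * fst p)\<^sup>2 / 2 + (2 * R * (snd p - \<sigma> * fst p))\<^sup>2 / 2)) \<le> E p" for p
  proof -
    define t where "t = fst p"
    define y where "y = snd p - \<sigma> * t"
    have aux: "- (8 * a + 2 * c) \<le> - ((x1 + y1) / 2 + (x2 + y2) / 2 + (x3 + y3) / 2)"
      if "x1 \<le> a" "x2 \<le> a" "x3 \<le> a" "y1 \<le> c" "y2 \<le> c" "y3 \<le> 2 * c + 8 * a" "0 \<le> a" for a c x1 x2 x3 y1 y2 y3 :: real
      using that by argo
    have LL: "(L * t)\<^sup>2 \<le> P\<^sup>2 * t\<^sup>2" if "1 \<le> L" "L \<le> P" for L
      unfolding power_mult_distrib using that by (intro mult_right_mono power_mono) auto
    have NN: "(N * y)\<^sup>2 \<le> R\<^sup>2 * y\<^sup>2" if "1 \<le> N" "N \<le> R" for N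
      unfolding power_mult_distrib using that by (intro mult_right_mono power_mono) auto
    have "(N3 * (snd p - r * fst p))\<^sup>2 = (N3 * y + N3 * (\<sigma> - r) * t)\<^sup>2"
      by (simp add: t_def y_def algebra_simps)
    also have "\<dots> \<le> 2 * (N3 * y)\<^sup>2 + 2 * (N3 * (\<sigma> - r) * t)\<^sup>2"
      using zero_le_power2[of "N3 * y - N3 * (\<sigma> - r) * t"] by (simp add: power2_eq_square algebra_simps)
    also have "(N3 * (\<sigma> - r) * t)\<^sup>2 = (\<bar>\<sigma> - r\<bar> * N3)\<^sup>2 * t\<^sup>2" by (simp add: power_mult_distrib)
    also have "(\<bar>\<sigma> - r\<bar> * N3)\<^sup>2 * t\<^sup>2 \<le> (2 * P)\<^sup>2 * t\<^sup>2"
      using r N by (intro mult_right_mono power_mono) auto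
    finally have "(N3 * (snd p - r * fst p))\<^sup>2 \<le> 2 * (R\<^sup>2 * y\<^sup>2) + 8 * (P\<^sup>2 * t\<^sup>2)"
      using NN[OF N(5,6)] by (simp add: power_mult_distrib)
    moreover have "0 \<le> P\<^sup>2 * t\<^sup>2" by simp
    moreover have "(4 * P * t)\<^sup>2 / 2 = 8 * (P\<^sup>2 * t\<^sup>2)" "(2 * R * y)\<^sup>2 / 2 = 2 * (R\<^sup>2 * y\<^sup>2)"
      by (simp_all add: power_mult_distrib)
    ultimately show ?thesis
      using aux[OF LL[OF L(1,2)] LL[OF L(3,4)] LL[OF L(5,6)] NN[OF N(1,2)] NN[OF N(3,4)]]
      unfolding E_def exp_le_cancel_iff t_def[symmetric] y_def[symmetric] by simp
  qed
  have E0: "0 \<le> E p" for p by (simp add: E_def)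
  have intE: "integrable lborel E"
  proof (rule Bochner_Integration.integrable_bound[OF schwartz_integrable[OF g(2)]])
    show "E \<in> borel_measurable lborel" unfolding E_def[abs_def] by measurable
    show "AE p in lborel. norm (E p) \<le> norm (gauss L1 N1 \<sigma> u1 k1 p)"
    proof (intro always_eventually allI)
      fix p
      have "0 \<le> ((L2 * fst p)\<^sup>2 + (N2 * (snd p - \<sigma> * fst p))\<^sup>2) / 2"
        "0 \<le> ((L3 * fst p)\<^sup>2 + (N3 * (snd p - r * fst p))\<^sup>2) / 2" by simp_all
      then have "E p \<le> exp (- (((L1 * fst p)\<^sup>2 + (N1 * (snd p - \<sigma> * fst p))\<^sup>2) / 2))"
        unfolding E_def exp_le_cancel_iff by linarith
      also have "\<dots> = norm (gauss L1 N1 \<sigma> u1 k1 p)" by (simp add: gauss_def add_divide_distrib)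
      finally show "norm (E p) \<le> norm (gauss L1 N1 \<sigma> u1 k1 p)" by (simp add: E_def)
    qed
  qed
  have "2 * pi / (8 * P * R) = (LINT p|lborel. exp (- ((4 * P * fst p)\<^sup>2 / 2 + (2 * R * (snd p - \<sigma> * fst p))\<^sup>2 / 2)))"
  proof -
    have "complex_of_real (2 * pi / (8 * P * R)) = fourier (gauss (4 * P) (2 * R) \<sigma> 0 0) (0, 0)"
      using L N by (subst fourier_gauss) (auto simp: mult_ac)
    also have "\<dots> = (LINT p|lborel. complex_of_real (exp (- ((4 * P * fst p)\<^sup>2 / 2 + (2 * R * (snd p - \<sigma> * fst p))\<^sup>2 / 2))))"
      by (simp add: fourier_def e2 inner_prod_def)
    also have "\<dots> = of_real (LINT p|lborel. exp (- ((4 * P * fst p)\<^sup>2 / 2 + (2 * R * (snd p - \<sigma> * fst p))\<^sup>2 / 2)))"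
      by (rule integral_complex_of_real)
    finally show ?thesis by (simp only: of_real_eq_iff)
  qed
  also have "\<dots> \<le> (LINT p|lborel. E p)"
    by (intro integral_mono' intE le E0)
  also have "\<dots> \<le> norm (LINT p|lborel. complex_of_real (E p))"
    by simp
  finally show ?thesis unfolding eq .
qed

text \<open>The lower bound for the integral, of order 1 / (P R), is compared with the three norms.
  The constant \<open>K\<close> depends on none of the packet parameters, so these may tend to
  infinity. The relation between the \<open>l\<close>s and \<open>k3\<close> is the resonance
  identity at the centres, equivalent to the cancellation of phases.\<close>

lemma test_function_bound:
  assumes tri: "trilinear_estimate \<sigma> s1 s2 s3 b1 b2 b3 C" and \<sigma>: "\<bar>\<sigma>\<bar> = 1" and \<epsilon>: "0 < \<epsilon>" "\<epsilon> < 1"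
  obtains K where "0 < K" "\<And>L1 L2 L3 N1 N2 N3 P R l1 l2 l3 k1 k2 k3 r.
    1 \<le> L1 \<Longrightarrow> L1 \<le> P \<Longrightarrow> 1 \<le> L2 \<Longrightarrow> L2 \<le> P \<Longrightarrow> 1 \<le> L3 \<Longrightarrow> L3 \<le> P \<Longrightarrow>
    1 \<le> N1 \<Longrightarrow> N1 \<le> R \<Longrightarrow> 1 \<le> N2 \<Longrightarrow> N2 \<le> R \<Longrightarrow> 1 \<le> N3 \<Longrightarrow> N3 \<le> R \<Longrightarrow> \<bar>\<sigma> - r\<bar> * N3 \<le> 2 * P \<Longrightarrow>
    k1 + k2 + k3 = 0 \<Longrightarrow> l1 + l2 + l3 = - 2 * \<sigma> * k3 \<Longrightarrow>
    L1 \<le> 3 * jbracket l1 powr (1 - \<epsilon>) \<Longrightarrow> L2 \<le> 3 * jbracket l2 powr (1 - \<epsilon>) \<Longrightarrow>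
    L3 + \<bar>- \<sigma> - r\<bar> * N3 \<le> 3 * jbracket l3 powr (1 - \<epsilon>) \<Longrightarrow>
    N1 \<le> 3 * jbracket k1 powr (1 - \<epsilon>) \<Longrightarrow> N2 \<le> 3 * jbracket k2 powr (1 - \<epsilon>) \<Longrightarrow> N3 \<le> 3 * jbracket k3 powr (1 - \<epsilon>) \<Longrightarrow>
    sqrt (L1 * N1) * sqrt (L2 * N2) * sqrt (L3 * N3) \<le> K * (P * R * (jbracket l1 powr b1 * jbracket k1 powr s1)
      * (jbracket l2 powr b2 * jbracket k2 powr s2) * (jbracket l3 powr b3 * jbracket k3 powr s3))"
proof -
  obtain C1 where C1: "0 < C1" "\<And>\<sigma> r L N u k. \<bar>\<sigma>\<bar> = 1 \<Longrightarrow> 1 \<le> L \<Longrightarrow> 1 \<le> N \<Longrightarrow>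
    L + \<bar>\<sigma> - r\<bar> * N \<le> 3 * jbracket (u + (\<sigma> - r) * k) powr (1 - \<epsilon>) \<Longrightarrow> N \<le> 3 * jbracket k powr (1 - \<epsilon>) \<Longrightarrow>
    X_norm \<sigma> s1 b1 (gauss L N r u k) \<le> C1 * (jbracket (u + (\<sigma> - r) * k) powr b1 * jbracket k powr s1 / sqrt (L * N))"
    using X_norm_gauss_le[OF \<epsilon>, where b = b1 and s = s1] by metis
  obtain C2 where C2: "0 < C2" "\<And>\<sigma> r L N u k. \<bar>\<sigma>\<bar> = 1 \<Longrightarrow> 1 \<le> L \<Longrightarrow> 1 \<le> N \<Longrightarrow>
    L + \<bar>\<sigma> - r\<bar> * N \<le> 3 * jbracket (u + (\<sigma> - r) * k) powr (1 - \<epsilon>) \<Longrightarrow> N \<le> 3 * jbracket k powr (1 - \<epsilon>) \<Longrightarrow>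
    X_norm \<sigma> s2 b2 (gauss L N r u k) \<le> C2 * (jbracket (u + (\<sigma> - r) * k) powr b2 * jbracket k powr s2 / sqrt (L * N))"
    using X_norm_gauss_le[OF \<epsilon>, where b = b2 and s = s2] by metis
  obtain C3 where C3: "0 < C3" "\<And>\<sigma> r L N u k. \<bar>\<sigma>\<bar> = 1 \<Longrightarrow> 1 \<le> L \<Longrightarrow> 1 \<le> N \<Longrightarrow>
    L + \<bar>\<sigma> - r\<bar> * N \<le> 3 * jbracket (u + (\<sigma> - r) * k) powr (1 - \<epsilon>) \<Longrightarrow> N \<le> 3 * jbracket k powr (1 - \<epsilon>) \<Longrightarrow>
    X_norm \<sigma> s3 b3 (gauss L N r u k) \<le> C3 * (jbracket (u + (\<sigma> - r) * k) powr b3 * jbracket k powr s3 / sqrt (L * N))"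
    using X_norm_gauss_le[OF \<epsilon>, where b = b3 and s = s3] by metis
  define K where "K = 4 * \<bar>C\<bar> * C1 * C2 * C3 + 1"
  have K0: "0 < K" using C1 C2 C3 by (simp add: K_def add_nonneg_pos)
  show ?thesis
  proof (rule that[OF K0])
    fix L1 L2 L3 N1 N2 N3 P R l1 l2 l3 k1 k2 k3 r
    assume L: "1 \<le> L1" "L1 \<le> P" "1 \<le> L2" "L2 \<le> P" "1 \<le> L3" "L3 \<le> P"
      and N: "1 \<le> N1" "N1 \<le> R" "1 \<le> N2" "N2 \<le> R" "1 \<le> N3" "N3 \<le> R" and r: "\<bar>\<sigma> - r\<bar> * N3 \<le> 2 * P"
      and k: "k1 + k2 + k3 = 0" and l: "l1 + l2 + l3 = - 2 * \<sigma> * k3"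
      and WL: "L1 \<le> 3 * jbracket l1 powr (1 - \<epsilon>)" "L2 \<le> 3 * jbracket l2 powr (1 - \<epsilon>)"
        "L3 + \<bar>- \<sigma> - r\<bar> * N3 \<le> 3 * jbracket l3 powr (1 - \<epsilon>)"
      and WN: "N1 \<le> 3 * jbracket k1 powr (1 - \<epsilon>)" "N2 \<le> 3 * jbracket k2 powr (1 - \<epsilon>)" "N3 \<le> 3 * jbracket k3 powr (1 - \<epsilon>)"
    \<comment> \<open>The third norm measures the modulation with sign \<open>- \<sigma>\<close>;
      this choice centres it at \<open>l3\<close> whatever the velocity \<open>r\<close> is.\<close>
    define u3 where "u3 = l3 - (- \<sigma> - r) * k3"
    define J1 J2 J3 where "J1 = jbracket l1 powr b1 * jbracket k1 powr s1"
      and "J2 = jbracket l2 powr b2 * jbracket k2 powr s2" and "J3 = jbracket l3 powr b3 * jbracket k3 powr s3"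
    have J: "0 \<le> J1" "0 \<le> J2" "0 \<le> J3" by (simp_all add: J1_def J2_def J3_def)
    define q1 q2 q3 where "q1 = sqrt (L1 * N1)" and "q2 = sqrt (L2 * N2)" and "q3 = sqrt (L3 * N3)"
    have q: "0 < q1" "0 < q2" "0 < q3" using L N by (simp_all add: q1_def q2_def q3_def)
    let ?g1 = "gauss L1 N1 \<sigma> l1 k1" and ?g2 = "gauss L2 N2 \<sigma> l2 k2" and ?g3 = "gauss L3 N3 r u3 k3"
    have X: "X_norm \<sigma> s1 b1 ?g1 \<le> C1 * (J1 / q1)" "X_norm \<sigma> s2 b2 ?g2 \<le> C2 * (J2 / q2)"
      "X_norm (- \<sigma>) s3 b3 ?g3 \<le> C3 * (J3 / q3)"
      using C1(2)[OF \<sigma> L(1) N(1), of \<sigma> l1 k1] C2(2)[OF \<sigma> L(3) N(3), of \<sigma> l2 k2]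
        C3(2)[OF _ L(5) N(5), of "- \<sigma>" r u3 k3] WL WN \<sigma>
      by (simp_all add: u3_def J1_def J2_def J3_def q1_def q2_def q3_def)
    have kk: "k1 + k2 = - k3" using k by linarith
    have u: "l1 + l2 + u3 = \<sigma> * (k1 + k2) + r * k3"
      unfolding kk u3_def using l by (simp add: algebra_simps)
    have PR: "0 < P" "0 < R" using L N by linarith+
    have "2 * pi / (8 * P * R) \<le> norm (LINT p|lborel. ?g1 p * ?g2 p * ?g3 p)"
      by (rule gauss_product_integral_ge[OF L N r k u])
    also have "\<dots> \<le> C * X_norm \<sigma> s1 b1 ?g1 * X_norm \<sigma> s2 b2 ?g2 * X_norm (- \<sigma>) s3 b3 ?g3"
      using tri[unfolded trilinear_estimate_def, rule_format, of ?g1 ?g2 ?g3] L N by (simp add: schwartz_gauss)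
    also have "\<dots> \<le> \<bar>C\<bar> * X_norm \<sigma> s1 b1 ?g1 * X_norm \<sigma> s2 b2 ?g2 * X_norm (- \<sigma>) s3 b3 ?g3"
      by (intro mult_right_mono X_norm_nonneg) auto
    also have "\<dots> \<le> \<bar>C\<bar> * (C1 * (J1 / q1)) * (C2 * (J2 / q2)) * (C3 * (J3 / q3))"
      using C1(1) C2(1) C3(1) J q by (intro mult_mono X X_norm_nonneg mult_nonneg_nonneg) auto
    finally have *: "2 * pi / (8 * P * R) \<le> \<bar>C\<bar> * C1 * C2 * C3 * (J1 * J2 * J3) / (q1 * q2 * q3)"
      by (simp add: mult_ac)
    have "1 / (4 * (P * R)) \<le> 2 * pi / (8 * P * R)"
      using PR pi_ge_two by (simp add: field_simps)
    with * have "1 / (4 * (P * R)) \<le> \<bar>C\<bar> * C1 * C2 * C3 * (J1 * J2 * J3) / (q1 * q2 * q3)" by linarith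
    then have "q1 * q2 * q3 \<le> 4 * (P * R) * (\<bar>C\<bar> * C1 * C2 * C3 * (J1 * J2 * J3))"
      using q PR by (simp add: field_simps)
    also have "\<dots> = (4 * \<bar>C\<bar> * C1 * C2 * C3) * (P * R * J1 * J2 * J3)" by (simp only: mult_ac)
    also have "\<dots> \<le> K * (P * R * J1 * J2 * J3)"
      unfolding K_def using PR J by (intro mult_right_mono) auto
    finally show "sqrt (L1 * N1) * sqrt (L2 * N2) * sqrt (L3 * N3) \<le> K * (P * R * (jbracket l1 powr b1 * jbracket k1 powr s1)
      * (jbracket l2 powr b2 * jbracket k2 powr s2) * (jbracket l3 powr b3 * jbracket k3 powr s3))"
      unfolding q1_def q2_def q3_def J1_def J2_def J3_def .
  qed
qed

section \<open>Necessity and the theorem\<close>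

lemma powr_bounded_imp_nonpos:
  fixes X K :: real
  assumes "\<And>M. 1 \<le> M \<Longrightarrow> M powr X \<le> K"
  shows "X \<le> 0"
proof (rule ccontr)
  assume "\<not> X \<le> 0"
  then have X: "0 < X" by simp
  have "(1 :: real) \<le> (\<bar>K\<bar> + 1) powr (1 / X)" using X by (intro ge_one_powr_ge_zero) auto
  from assms[OF this] X show False by (simp add: powr_powr)
qed

text \<open>The order in M of the bracket of \<alpha> M: a packet centred at 0 contributes no power
  of M.\<close>

definition growth_exponent :: "real \<Rightarrow> real" where "growth_exponent \<alpha> = (if \<alpha> = 0 then 0 else 1)"

lemma jbracket_scaled_ge:
  assumes "\<alpha> = 0 \<or> 1 \<le> \<bar>\<alpha>\<bar>" "1 \<le> M"
  shows "M powr growth_exponent \<alpha> \<le> jbracket (\<alpha> * M)"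
proof (cases "\<alpha> = 0")
  case False
  then have "M \<le> \<bar>\<alpha>\<bar> * M" using assms by (simp add: mult_le_cancel_right1)
  also have "\<dots> \<le> jbracket (\<alpha> * M)" using jbracket_abs_le[of "\<alpha> * M"] assms by (simp add: abs_mult)
  finally show ?thesis using False assms by (simp add: growth_exponent_def)
qed (use assms in \<open>simp add: growth_exponent_def\<close>)

lemma jbracket_scaled_powr_le:
  assumes "\<alpha> = 0 \<or> 1 \<le> \<bar>\<alpha>\<bar>" "1 \<le> M"
  shows "jbracket (\<alpha> * M) powr b \<le> (1 + \<bar>\<alpha>\<bar>) powr \<bar>b\<bar> * M powr (growth_exponent \<alpha> * b)"
proof (cases "\<alpha> = 0")
  case True
  then show ?thesis using assms by (simp add: growth_exponent_def)
next
  case False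
  show ?thesis
  proof (cases "0 \<le> b")
    case True
    have "jbracket (\<alpha> * M) \<le> 1 + \<bar>\<alpha>\<bar> * M" using jbracket_le[of "\<alpha> * M"] assms by (simp add: abs_mult)
    also have "\<dots> \<le> (1 + \<bar>\<alpha>\<bar>) * M" using assms by (simp add: algebra_simps)
    finally have "jbracket (\<alpha> * M) powr b \<le> ((1 + \<bar>\<alpha>\<bar>) * M) powr b" using True by (intro powr_mono2) auto
    then show ?thesis using True False assms by (simp add: powr_mult growth_exponent_def)
  next
    case b: False
    have "jbracket (\<alpha> * M) powr b \<le> M powr b"
      using jbracket_scaled_ge[OF assms] False b assms by (intro powr_mono2') (auto simp: growth_exponent_def)
    also have "\<dots> \<le> (1 + \<bar>\<alpha>\<bar>) powr \<bar>b\<bar> * M powr b"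
      using ge_one_powr_ge_zero[of "1 + \<bar>\<alpha>\<bar>" "\<bar>b\<bar>"] by (simp add: mult_le_cancel_right1)
    finally show ?thesis using False by (simp add: growth_exponent_def)
  qed
qed

text \<open>
  The packets have modulations \<open>\<alpha>1 * M\<close>, \<open>\<alpha>2 * M\<close>, \<open>\<alpha>3 * M\<close> and frequencies \<open>\<beta>1 * M\<close>, \<open>\<beta>2 * M\<close>,
  \<open>\<beta>3 * M\<close>; the exponents of their widths are \<open>l1\<close>, \<open>l2\<close>, \<open>l3\<close> and \<open>m1\<close>, \<open>m2\<close>, \<open>m3\<close> times
  \<open>1 - \<epsilon>\<close>. The third packet travels along the characteristic \<open>x = r * t\<close>.
\<close>

lemma necessary_exponent:
  assumes tri: "trilinear_estimate \<sigma> s1 s2 s3 b1 b2 b3 C" and \<sigma>: "\<bar>\<sigma>\<bar> = 1"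
    and \<alpha>0: "\<forall>\<alpha>\<in>{\<alpha>1, \<alpha>2, \<alpha>3, \<beta>1, \<beta>2, \<beta>3}. \<alpha> = 0 \<or> 1 \<le> \<bar>\<alpha>\<bar>"
    and sum: "\<beta>1 + \<beta>2 + \<beta>3 = 0" "\<alpha>1 + \<alpha>2 + \<alpha>3 = - 2 * \<sigma> * \<beta>3"
    and l: "0 \<le> l1" "l1 \<le> growth_exponent \<alpha>1" "l1 \<le> P" "0 \<le> l2" "l2 \<le> growth_exponent \<alpha>2" "l2 \<le> P" "0 \<le> l3" "l3 \<le> growth_exponent \<alpha>3" "l3 \<le> P"
    and m: "0 \<le> m1" "m1 \<le> growth_exponent \<beta>1" "m1 \<le> R" "0 \<le> m2" "m2 \<le> growth_exponent \<beta>2" "m2 \<le> R" "0 \<le> m3" "m3 \<le> growth_exponent \<beta>3" "m3 \<le> R"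
    and r: "r = - \<sigma> \<and> m3 \<le> P \<or> r = \<sigma> \<and> m3 \<le> growth_exponent \<alpha>3"
  shows "(l1 + l2 + l3 + m1 + m2 + m3) / 2 - P - R
    \<le> growth_exponent \<alpha>1 * b1 + growth_exponent \<alpha>2 * b2 + growth_exponent \<alpha>3 * b3 + growth_exponent \<beta>1 * s1 + growth_exponent \<beta>2 * s2 + growth_exponent \<beta>3 * s3" (is "?A \<le> ?B")
proof -
  note \<alpha> = \<alpha>0[rule_format]
  have *: "(1 - \<epsilon>) * ?A \<le> ?B" if \<epsilon>: "0 < \<epsilon>" "\<epsilon> < 1" for \<epsilon>
  proof -
    obtain K where K: "0 < K" and KK: "\<And>L1 L2 L3 N1 N2 N3 P R l1 l2 l3 k1 k2 k3 r.
      1 \<le> L1 \<Longrightarrow> L1 \<le> P \<Longrightarrow> 1 \<le> L2 \<Longrightarrow> L2 \<le> P \<Longrightarrow> 1 \<le> L3 \<Longrightarrow> L3 \<le> P \<Longrightarrow>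
      1 \<le> N1 \<Longrightarrow> N1 \<le> R \<Longrightarrow> 1 \<le> N2 \<Longrightarrow> N2 \<le> R \<Longrightarrow> 1 \<le> N3 \<Longrightarrow> N3 \<le> R \<Longrightarrow> \<bar>\<sigma> - r\<bar> * N3 \<le> 2 * P \<Longrightarrow>
      k1 + k2 + k3 = 0 \<Longrightarrow> l1 + l2 + l3 = - 2 * \<sigma> * k3 \<Longrightarrow>
      L1 \<le> 3 * jbracket l1 powr (1 - \<epsilon>) \<Longrightarrow> L2 \<le> 3 * jbracket l2 powr (1 - \<epsilon>) \<Longrightarrow>
      L3 + \<bar>- \<sigma> - r\<bar> * N3 \<le> 3 * jbracket l3 powr (1 - \<epsilon>) \<Longrightarrow>
      N1 \<le> 3 * jbracket k1 powr (1 - \<epsilon>) \<Longrightarrow> N2 \<le> 3 * jbracket k2 powr (1 - \<epsilon>) \<Longrightarrow> N3 \<le> 3 * jbracket k3 powr (1 - \<epsilon>) \<Longrightarrow>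
      sqrt (L1 * N1) * sqrt (L2 * N2) * sqrt (L3 * N3) \<le> K * (P * R * (jbracket l1 powr b1 * jbracket k1 powr s1)
        * (jbracket l2 powr b2 * jbracket k2 powr s2) * (jbracket l3 powr b3 * jbracket k3 powr s3))"
      by (rule test_function_bound[OF tri \<sigma> \<epsilon>]) (rule that; assumption)
    \<comment> \<open>The constants lost when brackets are replaced by powers of M; they do not
      depend on M.\<close>
    define D where "D = (1 + \<bar>\<alpha>1\<bar>) powr \<bar>b1\<bar> * (1 + \<bar>\<beta>1\<bar>) powr \<bar>s1\<bar> * ((1 + \<bar>\<alpha>2\<bar>) powr \<bar>b2\<bar> * (1 + \<bar>\<beta>2\<bar>) powr \<bar>s2\<bar>)
      * ((1 + \<bar>\<alpha>3\<bar>) powr \<bar>b3\<bar> * (1 + \<bar>\<beta>3\<bar>) powr \<bar>s3\<bar>)"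
    have "M powr ((1 - \<epsilon>) * ?A - ?B) \<le> K * D" if M: "1 \<le> M" for M
    proof -
      define w where "w a = M powr ((1 - \<epsilon>) * a)" for a
      have w1: "1 \<le> w a" if "0 \<le> a" for a
        unfolding w_def using that M \<epsilon> by (intro ge_one_powr_ge_zero) auto
      have wm: "w a \<le> w b" if "a \<le> b" for a b
        unfolding w_def using that M \<epsilon> by (intro powr_mono) auto
      have wj: "w a \<le> jbracket (\<alpha> * M) powr (1 - \<epsilon>)" if "a \<le> growth_exponent \<alpha>" "\<alpha> \<in> {\<alpha>1, \<alpha>2, \<alpha>3, \<beta>1, \<beta>2, \<beta>3}" for a \<alpha>
      proof -
        have "w a \<le> w (growth_exponent \<alpha>)" using that by (intro wm)
        also have "\<dots> = (M powr growth_exponent \<alpha>) powr (1 - \<epsilon>)" by (simp add: w_def powr_powr mult.commute)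
        also have "\<dots> \<le> jbracket (\<alpha> * M) powr (1 - \<epsilon>)"
          using jbracket_scaled_ge[OF \<alpha>[OF that(2)] M] \<epsilon> by (intro powr_mono2) auto
        finally show ?thesis .
      qed
      have wj3: "w a \<le> 3 * jbracket (\<alpha> * M) powr (1 - \<epsilon>)" if "a \<le> growth_exponent \<alpha>" "\<alpha> \<in> {\<alpha>1, \<alpha>2, \<alpha>3, \<beta>1, \<beta>2, \<beta>3}" for a \<alpha>
        using wj[OF that] powr_ge_zero[of "jbracket (\<alpha> * M)" "1 - \<epsilon>"] by linarith
      have r1: "\<bar>\<sigma> - r\<bar> * w m3 \<le> 2 * w P"
      proof (cases "r = \<sigma>")
        case False
        then have "m3 \<le> P" "\<bar>\<sigma> - r\<bar> = 2" using r \<sigma> by auto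
        then show ?thesis using wm[of m3 P] by simp
      qed (simp add: w_def)
      \<comment> \<open>For \<open>r = \<sigma>\<close> the frequency width contributes twice to the
        spread of the third modulation. This 1 + 2 is the source of the constant 3 in the width
        conditions.\<close>
      have r2: "w l3 + \<bar>- \<sigma> - r\<bar> * w m3 \<le> 3 * jbracket (\<alpha>3 * M) powr (1 - \<epsilon>)"
      proof (cases "r = - \<sigma>")
        case True
        then show ?thesis using wj3[OF l(8)] by simp
      next
        case False
        then have "m3 \<le> growth_exponent \<alpha>3" "\<bar>- \<sigma> - r\<bar> = 2" using r \<sigma> by auto
        then show ?thesis using wj[of l3 \<alpha>3] wj[of m3 \<alpha>3] l by simp
      qed
      have s1: "\<beta>1 * M + \<beta>2 * M + \<beta>3 * M = 0" using sum(1) by (simp flip: distrib_right)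
      have s2: "\<alpha>1 * M + \<alpha>2 * M + \<alpha>3 * M = - 2 * \<sigma> * (\<beta>3 * M)" using sum(2) by (simp flip: distrib_right)
      have le: "sqrt (w l1 * w m1) * sqrt (w l2 * w m2) * sqrt (w l3 * w m3)
        \<le> K * (w P * w R * (jbracket (\<alpha>1 * M) powr b1 * jbracket (\<beta>1 * M) powr s1)
        * (jbracket (\<alpha>2 * M) powr b2 * jbracket (\<beta>2 * M) powr s2) * (jbracket (\<alpha>3 * M) powr b3 * jbracket (\<beta>3 * M) powr s3))"
        using l m by (intro KK[OF _ _ _ _ _ _ _ _ _ _ _ _ r1 s1 s2] w1 wm wj3 r2) auto
      have ww: "w a * w b = w (a + b)" for a b by (simp add: w_def distrib_left powr_add)
      have sq: "sqrt (w a * w b) = w ((a + b) / 2)" for a b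
      proof -
        have "w a * w b = (w ((a + b) / 2))\<^sup>2"
          unfolding power2_eq_square ww by simp
        then show ?thesis by (simp add: w_def)
      qed
      have jb: "jbracket (\<alpha> * M) powr b \<le> (1 + \<bar>\<alpha>\<bar>) powr \<bar>b\<bar> * M powr (growth_exponent \<alpha> * b)"
        if "\<alpha> \<in> {\<alpha>1, \<alpha>2, \<alpha>3, \<beta>1, \<beta>2, \<beta>3}" for \<alpha> b
        by (rule jbracket_scaled_powr_le[OF \<alpha>[OF that] M])
      have "M powr ((1 - \<epsilon>) * ((l1 + l2 + l3 + m1 + m2 + m3) / 2)) = sqrt (w l1 * w m1) * sqrt (w l2 * w m2) * sqrt (w l3 * w m3)"
        unfolding sq unfolding ww unfolding w_def by (simp add: add_divide_distrib add_ac)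
      also note le
      also have "K * (w P * w R * (jbracket (\<alpha>1 * M) powr b1 * jbracket (\<beta>1 * M) powr s1)
        * (jbracket (\<alpha>2 * M) powr b2 * jbracket (\<beta>2 * M) powr s2) * (jbracket (\<alpha>3 * M) powr b3 * jbracket (\<beta>3 * M) powr s3))
        \<le> K * (w P * w R * (((1 + \<bar>\<alpha>1\<bar>) powr \<bar>b1\<bar> * M powr (growth_exponent \<alpha>1 * b1)) * ((1 + \<bar>\<beta>1\<bar>) powr \<bar>s1\<bar> * M powr (growth_exponent \<beta>1 * s1)))
        * (((1 + \<bar>\<alpha>2\<bar>) powr \<bar>b2\<bar> * M powr (growth_exponent \<alpha>2 * b2)) * ((1 + \<bar>\<beta>2\<bar>) powr \<bar>s2\<bar> * M powr (growth_exponent \<beta>2 * s2)))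
        * (((1 + \<bar>\<alpha>3\<bar>) powr \<bar>b3\<bar> * M powr (growth_exponent \<alpha>3 * b3)) * ((1 + \<bar>\<beta>3\<bar>) powr \<bar>s3\<bar> * M powr (growth_exponent \<beta>3 * s3))))"
        using K by (intro mult_left_mono mult_mono jb) (auto simp: w_def)
      also have "\<dots> = (K * D) * (w P * w R * (M powr (growth_exponent \<alpha>1 * b1) * M powr (growth_exponent \<alpha>2 * b2) * M powr (growth_exponent \<alpha>3 * b3)
        * M powr (growth_exponent \<beta>1 * s1) * M powr (growth_exponent \<beta>2 * s2) * M powr (growth_exponent \<beta>3 * s3)))"
        unfolding D_def by (simp only: mult_ac)
      also have "\<dots> = (K * D) * M powr ((1 - \<epsilon>) * (P + R) + ?B)"
        unfolding ww unfolding w_def powr_add[symmetric] by (simp add: add_ac)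
      finally have fin: "M powr ((1 - \<epsilon>) * ((l1 + l2 + l3 + m1 + m2 + m3) / 2)) \<le> (K * D) * M powr ((1 - \<epsilon>) * (P + R) + ?B)" .
      have "M powr ((1 - \<epsilon>) * ?A - ?B) = M powr ((1 - \<epsilon>) * ((l1 + l2 + l3 + m1 + m2 + m3) / 2)) * M powr (- ((1 - \<epsilon>) * (P + R) + ?B))"
        unfolding powr_add[symmetric] by (simp add: algebra_simps)
      also have "\<dots> \<le> (K * D) * M powr ((1 - \<epsilon>) * (P + R) + ?B) * M powr (- ((1 - \<epsilon>) * (P + R) + ?B))"
        by (intro mult_right_mono fin) auto
      also have "\<dots> = K * D * M powr 0"
        unfolding mult.assoc powr_add[symmetric] by simp
      finally show ?thesis using M by simp
    qed
    then have "(1 - \<epsilon>) * ?A - ?B \<le> 0" by (rule powr_bounded_imp_nonpos)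
    then show ?thesis by simp
  qed
  have "((\<lambda>\<epsilon>. (1 - \<epsilon>) * ?A) \<longlongrightarrow> (1 - 0) * ?A) (at_right 0)" by (intro tendsto_intros)
  moreover have "\<forall>\<^sub>F \<epsilon> in at_right 0. (1 - \<epsilon>) * ?A \<le> ?B"
    using * eventually_at_right_less[of 0] eventually_at_right_real[of 0 1]
    by (auto simp: eventually_at_filter elim!: eventually_mono)
  ultimately have "(1 - 0) * ?A \<le> ?B" by (intro tendsto_upperbound) auto
  then show ?thesis by simp
qed

text \<open>The first two norms have the same sign, so every necessary condition also holds with
  indices 1 and 2 exchanged.\<close>

lemma trilinear_estimate_swap:
  assumes "trilinear_estimate \<sigma> s1 s2 s3 b1 b2 b3 C"
  shows "trilinear_estimate \<sigma> s2 s1 s3 b2 b1 b3 C"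
  unfolding trilinear_estimate_def
proof (intro allI impI)
  fix f g h :: "real \<times> real \<Rightarrow> complex"
  assume "schwartz f" "schwartz g" "schwartz h"
  then have "norm (LINT p|lborel. g p * f p * h p) \<le> C * X_norm \<sigma> s1 b1 g * X_norm \<sigma> s2 b2 f * X_norm (- \<sigma>) s3 b3 h"
    using assms unfolding trilinear_estimate_def by blast
  then show "norm (LINT p|lborel. f p * g p * h p) \<le> C * X_norm \<sigma> s2 b2 f * X_norm \<sigma> s1 b1 g * X_norm (- \<sigma>) s3 b3 h"
    by (simp add: mult_ac)
qed

text \<open>Each instance lists the three modulations, the three frequencies,
  \<open>l1 P l2 l3\<close>, \<open>m1 R m2 m3\<close> and the velocity. Unit widths give the lower
  bound 0; three wide widths against one of \<open>P\<close>, \<open>R\<close> give 3/2 - 1; five or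
  six against both give 5/2 - 2 or 3 - 2.\<close>

lemma necessary_conditions_one_sided:
  assumes tri: "trilinear_estimate \<sigma> s1 s2 s3 b1 b2 b3 C" and \<sigma>: "\<sigma> \<in> {1, -1}"
  shows "1/2 \<le> b1 + b2 + b3" "0 \<le> b1 + b2" "0 \<le> b1 + b3" "0 \<le> s1 + s2"
    "0 \<le> s1 + s3 + b1" "0 \<le> s1 + s3 + b2" "0 \<le> s1 + s3 + b3" "1/2 \<le> s1 + s3 + b1 + b2 + b3"
    "1/2 \<le> s1 + s2 + s3 + b3" "1/2 \<le> s1 + s2 + s3 + b1 + b2" "1/2 \<le> s1 + s2 + s3 + b1 + b3"
    "1 \<le> s1 + s2 + s3 + b1 + b2 + b3"
proof -
  have s: "\<bar>\<sigma>\<bar> = 1" "\<sigma> * \<sigma> = 1" "\<sigma> \<noteq> 0" using \<sigma> by auto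
  note N = necessary_exponent[OF tri s(1)]
  show "1/2 \<le> b1 + b2 + b3"
    using N[of 1 1 "-2" 0 0 0 1 1 1 1 0 0 0 0 "-\<sigma>"] s by (simp add: growth_exponent_def)
  show "0 \<le> b1 + b2"
    using N[of 1 "-1" 0 0 0 0 0 0 0 0 0 0 0 0 "-\<sigma>"] s by (simp add: growth_exponent_def)
  show "0 \<le> b1 + b3"
    using N[of 1 0 "-1" 0 0 0 0 0 0 0 0 0 0 0 "-\<sigma>"] s by (simp add: growth_exponent_def)
  show "0 \<le> s1 + s2"
    using N[of 0 0 0 1 "-1" 0 0 0 0 0 0 0 0 0 "-\<sigma>"] s by (simp add: growth_exponent_def)
  show "0 \<le> s1 + s3 + b1"
    using N[of "2 * \<sigma>" 0 0 1 0 "-1" 0 0 0 0 0 0 0 0 "-\<sigma>"] s by (simp add: growth_exponent_def abs_mult)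
  show "0 \<le> s1 + s3 + b2"
    using N[of 0 "2 * \<sigma>" 0 1 0 "-1" 0 0 0 0 0 0 0 0 "-\<sigma>"] s by (simp add: growth_exponent_def abs_mult)
  show "0 \<le> s1 + s3 + b3"
    using N[of 0 0 "2 * \<sigma>" 1 0 "-1" 0 0 0 0 0 0 0 0 "-\<sigma>"] s by (simp add: growth_exponent_def abs_mult)
  show "1/2 \<le> s1 + s3 + b1 + b2 + b3"
    using N[of "2 * \<sigma>" "2 * \<sigma>" "- 2 * \<sigma>" 1 0 "-1" 1 1 1 1 0 0 0 0 "-\<sigma>"] s by (simp add: growth_exponent_def abs_mult)
  \<comment> \<open>The only choice with velocity \<open>\<sigma>\<close> for the third packet. All
    three packets travel together, so wide frequencies leave \<open>P = 0\<close>; the price is a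
    large third modulation, which the frequencies force anyway.\<close>
  show "1/2 \<le> s1 + s2 + s3 + b3"
    using N[of 0 0 "4 * \<sigma>" 1 1 "-2" 0 0 0 0 1 1 1 1 "\<sigma>"] s by (simp add: growth_exponent_def abs_mult)
  show "1/2 \<le> s1 + s2 + s3 + b1 + b2"
    using N[of "2 * \<sigma>" "2 * \<sigma>" 0 1 1 "-2" 1 1 1 0 1 1 1 1 "-\<sigma>"] s by (simp add: growth_exponent_def abs_mult)
  show "1/2 \<le> s1 + s2 + s3 + b1 + b3"
    using N[of "2 * \<sigma>" 0 "2 * \<sigma>" 1 1 "-2" 1 1 0 1 1 1 1 1 "-\<sigma>"] s by (simp add: growth_exponent_def abs_mult)
  show "1 \<le> s1 + s2 + s3 + b1 + b2 + b3"
    using N[of "2 * \<sigma>" "\<sigma>" "\<sigma>" 1 1 "-2" 1 1 1 1 1 1 1 1 "-\<sigma>"] s by (simp add: growth_exponent_def abs_mult)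
qed

section \<open>Ordered exponents and positive parts\<close>

lemma min3_le: "min3 x y z \<le> x" "min3 x y z \<le> y" "min3 x y z \<le> z"
  by (simp_all add: min3_def)

lemma min3_cases: "min3 x y z = x \<or> min3 x y z = y \<or> min3 x y z = z"
  by (auto simp: min3_def min_def)

lemma order3_cases:
  obtains (123) "x \<le> y" "y \<le> z" "min3 x y z = x" "med3 x y z = y" "max3 x y z = z"
  | (132) "x \<le> z" "z \<le> y" "min3 x y z = x" "med3 x y z = z" "max3 x y z = y"
  | (213) "y \<le> x" "x \<le> z" "min3 x y z = y" "med3 x y z = x" "max3 x y z = z"
  | (231) "y \<le> z" "z \<le> x" "min3 x y z = y" "med3 x y z = z" "max3 x y z = x"
  | (312) "z \<le> x" "x \<le> y" "min3 x y z = z" "med3 x y z = x" "max3 x y z = y"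
  | (321) "z \<le> y" "y \<le> x" "min3 x y z = z" "med3 x y z = y" "max3 x y z = x"
proof -
  consider "x \<le> y" "y \<le> z" | "x \<le> z" "z \<le> y" "z \<noteq> y" | "y \<le> x" "x \<le> z" "x \<noteq> y" | "y \<le> z" "z \<le> x" "z \<noteq> x"
    | "z \<le> x" "x \<le> y" "z \<noteq> x" | "z \<le> y" "y \<le> x" "y \<noteq> x" "z \<noteq> y" by linarith
  then show ?thesis
    by cases (use that in \<open>auto simp: min3_def med3_def max3_def min_def max_def\<close>)
qed

text \<open>A sum of two positive parts is the maximum of 0, x, y and x + y, so the last condition
  of the theorem amounts to four linear ones.\<close>

lemma pos_part_sum_less_iff:
  "pos_part x + pos_part y - z < w \<longleftrightarrow> 0 < w + z \<and> x < w + z \<and> y < w + z \<and> x + y < w + z"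
  by (auto simp: pos_part_def)

lemma pos_part_sum_le_iff:
  "pos_part x + pos_part y - z \<le> w \<longleftrightarrow> 0 \<le> w + z \<and> x \<le> w + z \<and> y \<le> w + z \<and> x + y \<le> w + z"
  by (auto simp: pos_part_def)

text \<open>Lets both signs share the larger of their constants.\<close>

lemma trilinear_estimate_mono:
  assumes "trilinear_estimate \<sigma> s1 s2 s3 b1 b2 b3 C" "C \<le> D"
  shows "trilinear_estimate \<sigma> s1 s2 s3 b1 b2 b3 D"
  unfolding trilinear_estimate_def
proof (intro allI impI)
  fix f g h :: "real \<times> real \<Rightarrow> complex"
  assume "schwartz f" "schwartz g" "schwartz h"
  then have "norm (LINT p|lborel. f p * g p * h p) \<le> C * X_norm \<sigma> s1 b1 f * X_norm \<sigma> s2 b2 g * X_norm (- \<sigma>) s3 b3 h"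
    using assms(1) unfolding trilinear_estimate_def by blast
  also have "\<dots> \<le> D * X_norm \<sigma> s1 b1 f * X_norm \<sigma> s2 b2 g * X_norm (- \<sigma>) s3 b3 h"
    by (intro mult_right_mono assms(2) X_norm_nonneg)
  finally show "norm (LINT p|lborel. f p * g p * h p) \<le> D * X_norm \<sigma> s1 b1 f * X_norm \<sigma> s2 b2 g * X_norm (- \<sigma>) s3 b3 h" .
qed

lemma finite_pos_lower_bound:
  fixes A :: "real set"
  assumes "finite A" "\<forall>x\<in>A. 0 < x"
  shows "\<exists>\<delta>>0. \<forall>x\<in>A. 2 * \<delta> \<le> x"
proof (cases "A = {}")
  case False
  then show ?thesis using assms by (intro exI[of _ "Min A / 2"]) auto
qed (auto intro: exI[of _ 1])

text \<open>The finitely many strict inequalities with right-hand side 1/2 or 1 have a common margin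
  \<open>2 * \<delta>\<close>, so they survive, in weak form, the replacement of 1/2 by \<rho> = 1/2
  + \<delta>.\<close>

lemma sufficient_conditions:
  assumes b: "1/2 < b1 + b2 + b3" "0 < b1 + b2" "0 < b1 + b3" "0 < b2 + b3" and s12: "0 \<le> s1 + s2"
    and s: "\<And>s. s \<in> {s1, s2} \<Longrightarrow> - min3 b1 b2 b3 < s + s3 \<and> 1/2 - b1 - b2 - b3 < s + s3"
    and S: "1/2 - b3 < s1 + s2 + s3"
      "pos_part (1/2 - max3 b1 b2 b3) + pos_part (1/2 - med3 b1 b2 b3) - min3 b1 b2 b3 < s1 + s2 + s3"
  shows "\<exists>C. \<forall>\<sigma>\<in>{1, -1}. trilinear_estimate \<sigma> s1 s2 s3 b1 b2 b3 C"
proof -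
  note S' = S(2)[unfolded pos_part_sum_less_iff]
  \<comment> \<open>The linear conditions concern the pairs that contain the smallest exponent; the
    pair of the two largest has a sum at least as big.\<close>
  have SS: "1/2 < s1 + s2 + s3 + b1 + b2" "1/2 < s1 + s2 + s3 + b1 + b3" "1/2 < s1 + s2 + s3 + b2 + b3"
    "1 < s1 + s2 + s3 + b1 + b2 + b3"
    using S' by (cases b1 b2 b3 rule: order3_cases; simp)+
  have ss: "1/2 - b1 - b2 - b3 < s1 + s3" "1/2 - b1 - b2 - b3 < s2 + s3" "- min3 b1 b2 b3 < s1 + s3" "- min3 b1 b2 b3 < s2 + s3"
    using s by auto
  have pos: "\<forall>x\<in>{b1 + b2 + b3 - 1/2, s1 + s3 + b1 + b2 + b3 - 1/2, s2 + s3 + b1 + b2 + b3 - 1/2,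
    s1 + s2 + s3 + b3 - 1/2, s1 + s2 + s3 + b1 + b2 - 1/2, s1 + s2 + s3 + b1 + b3 - 1/2, s1 + s2 + s3 + b2 + b3 - 1/2,
    s1 + s2 + s3 + b1 + b2 + b3 - 1}. 0 < x"
    by (intro ballI; elim insertE emptyE; use SS ss b S(1) in linarith)
  obtain \<delta> where \<delta>0: "0 < \<delta>" and \<delta>: "\<forall>x\<in>{b1 + b2 + b3 - 1/2, s1 + s3 + b1 + b2 + b3 - 1/2, s2 + s3 + b1 + b2 + b3 - 1/2,
    s1 + s2 + s3 + b3 - 1/2, s1 + s2 + s3 + b1 + b2 - 1/2, s1 + s2 + s3 + b1 + b3 - 1/2, s1 + s2 + s3 + b2 + b3 - 1/2,
    s1 + s2 + s3 + b1 + b2 + b3 - 1}. 2 * \<delta> \<le> x"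
    using finite_pos_lower_bound[OF _ pos] by blast
  have \<delta>': "2 * \<delta> \<le> b1 + b2 + b3 - 1/2" "2 * \<delta> \<le> s1 + s3 + b1 + b2 + b3 - 1/2" "2 * \<delta> \<le> s2 + s3 + b1 + b2 + b3 - 1/2"
    "2 * \<delta> \<le> s1 + s2 + s3 + b3 - 1/2" "2 * \<delta> \<le> s1 + s2 + s3 + b1 + b2 - 1/2" "2 * \<delta> \<le> s1 + s2 + s3 + b1 + b3 - 1/2"
    "2 * \<delta> \<le> s1 + s2 + s3 + b2 + b3 - 1/2" "2 * \<delta> \<le> s1 + s2 + s3 + b1 + b2 + b3 - 1"
    by (rule bspec[OF \<delta>]; blast)+
  define \<rho> where "\<rho> = 1/2 + \<delta>"
  have \<rho>: "2 * \<rho> = 1 + 2 * \<delta>" by (simp add: \<rho>_def)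
  interpret admissible_exponents s1 s2 s3 b1 b2 b3 \<rho>
    using \<rho> b s12 ss \<delta>0 \<delta>' min3_le[of b1 b2 b3] by unfold_locales linarith+
  obtain C where C: "trilinear_estimate 1 s1 s2 s3 b1 b2 b3 C"
    using trilinear_estimate_holds[of 1] by auto
  obtain D where D: "trilinear_estimate (- 1) s1 s2 s3 b1 b2 b3 D"
    using trilinear_estimate_holds[of "- 1"] by auto
  show ?thesis
    using trilinear_estimate_mono[OF C, of "max C D"] trilinear_estimate_mono[OF D, of "max C D"]
    by (intro exI[of _ "max C D"]) auto
qed

theorem theorem1:
  fixes s1 s2 s3 b1 b2 b3 :: real
  shows
    "(b1 + b2 + b3 > 1/2 \<and>
      b1 + b2 > 0 \<and> b1 + b3 > 0 \<and> b2 + b3 > 0 \<and>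
      s1 + s2 \<ge> 0 \<and>
      (\<forall>s \<in> {s1, s2}.
         s + s3 > - min3 b1 b2 b3 \<and>
         s + s3 > 1/2 - b1 - b2 - b3) \<and>
      s1 + s2 + s3 > 1/2 - b3 \<and>
      s1 + s2 + s3 > pos_part (1/2 - max3 b1 b2 b3) + pos_part (1/2 - med3 b1 b2 b3)
                       - min3 b1 b2 b3
      \<longrightarrow> (\<exists>C. \<forall>\<sigma> \<in> {1, -1}. trilinear_estimate \<sigma> s1 s2 s3 b1 b2 b3 C))
     \<and>
     (\<forall>\<sigma> \<in> {1, -1}. (\<exists>C. trilinear_estimate \<sigma> s1 s2 s3 b1 b2 b3 C) \<longrightarrow>
      b1 + b2 + b3 \<ge> 1/2 \<and>
      b1 + b2 \<ge> 0 \<and> b1 + b3 \<ge> 0 \<and> b2 + b3 \<ge> 0 \<and>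
      s1 + s2 \<ge> 0 \<and>
      (\<forall>s \<in> {s1, s2}.
         s + s3 \<ge> - min3 b1 b2 b3 \<and>
         s + s3 \<ge> 1/2 - b1 - b2 - b3) \<and>
      s1 + s2 + s3 \<ge> 1/2 - b3 \<and>
      s1 + s2 + s3 \<ge> pos_part (1/2 - max3 b1 b2 b3) + pos_part (1/2 - med3 b1 b2 b3)
                       - min3 b1 b2 b3)"
proof (intro conjI impI ballI; (elim conjE exE)?)
  assume "1/2 < b1 + b2 + b3" "0 < b1 + b2" "0 < b1 + b3" "0 < b2 + b3" "0 \<le> s1 + s2"
    "\<forall>s\<in>{s1, s2}. - min3 b1 b2 b3 < s + s3 \<and> 1/2 - b1 - b2 - b3 < s + s3" "1/2 - b3 < s1 + s2 + s3"
    "pos_part (1/2 - max3 b1 b2 b3) + pos_part (1/2 - med3 b1 b2 b3) - min3 b1 b2 b3 < s1 + s2 + s3"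
  then show "\<exists>C. \<forall>\<sigma>\<in>{1, -1}. trilinear_estimate \<sigma> s1 s2 s3 b1 b2 b3 C"
    by (intro sufficient_conditions) auto
next
  fix \<sigma> C :: real
  assume \<sigma>: "\<sigma> \<in> {1, -1}" and tri: "trilinear_estimate \<sigma> s1 s2 s3 b1 b2 b3 C"
  \<comment> \<open>The exchanged estimate supplies the conditions for k = 2 and those with b_2 +
    b_3.\<close>
  note n = necessary_conditions_one_sided[OF tri \<sigma>] necessary_conditions_one_sided[OF trilinear_estimate_swap[OF tri] \<sigma>]
  show "1/2 \<le> b1 + b2 + b3" "0 \<le> b1 + b2" "0 \<le> b1 + b3" "0 \<le> b2 + b3" "0 \<le> s1 + s2" "1/2 - b3 \<le> s1 + s2 + s3"
    using n by linarith+
  show "- min3 b1 b2 b3 \<le> s + s3" "1/2 - b1 - b2 - b3 \<le> s + s3" if "s \<in> {s1, s2}" for s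
    using that n min3_cases[of b1 b2 b3] by auto
  show "pos_part (1/2 - max3 b1 b2 b3) + pos_part (1/2 - med3 b1 b2 b3) - min3 b1 b2 b3 \<le> s1 + s2 + s3"
    unfolding pos_part_sum_le_iff
    using n by (cases b1 b2 b3 rule: order3_cases; simp)
qed

end
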